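(* Let $H$ be a definite, rational quaternion algebra with orthogonal involution $\ddagger$. Let $\mathcal{O}$ be an order of $H$ that is also a $\ddagger$-Euclidean ring. There exists an algorithm to compute a Dirichlet domain for the group $SL^\ddagger(2,\mathcal{O})$ acting on $\mathbb{H}^4$. The corresponding quotient orbifold $\mathbb{H}^4/SL^\ddagger(2,\mathcal{O})$ has exactly one cusp.
   Context: An involution on a ring $R$ is an additive map $\sigma:R\to R$ with $\sigma(xy)=\sigma(y)\sigma(x)$ and $\sigma(\sigma(x))=x$ for all $x,y$; write $R^+=\{r\in R\mid\sigma(r)=r\}$. A ring with involution $(R,\sigma)$ without zero divisors is $\sigma$-Euclidean if there exist a well-ordered set $W$ and a function $\Phi:R\to W$ such that for all $a,b\in R$ with $b\neq0$ and $a\sigma(b)\in R^+$ there exists $q\in R^+$ with $\Phi(a-bq)<\Phi(b)$. An order $\mathcal{O}$ of $H$ being $\ddagger$-Euclidean includes that $\mathcal{O}$ is closed under $\ddagger$. A quaternion algebra $H$ over $\mathbb{Q}$ is definite if $H\otimes_{\mathbb{Q}}\mathbb{R}$ is a division algebra. An orthogonal involution on $H$ is a $\mathbb{Q}$-linear involution other than quaternion conjugation. An order of $H$ is a subring that is a finitely generated $\mathbb{Z}$-module spanning $H$ over $\mathbb{Q}$. For a ring with involution $(R,\sigma)$, define $\hat\sigma\begin{pmatrix}a&b\\c&d\end{pmatrix}=\begin{pmatrix}\sigma(d)&-\sigma(b)\\-\sigma(c)&\sigma(a)\end{pmatrix}$ on $\mathrm{Mat}(2,R)$ and $SL^\sigma(2,R)=\{M\in\mathrm{Mat}(2,R)\mid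 M\hat\sigma(M)=\hat\sigma(M)M=1\}$. Let $H_{\mathbb{R}}$ be the Hamilton quaternions, with $(x+yi+zj+tk)^\ddagger=x+yi+zj-tk$, $\mathrm{nrm}(z)=z\overline{z}$, and $\pi_k$ the $k$-component. Upper half-space $\mathbb{H}^4$ is identified with $\{z\in H_{\mathbb{R}}\mid\pi_k(z)>0\}$, with hyperbolic distance $d(p_1,p_2)=\cosh^{-1}\left(1+\frac{\mathrm{nrm}(p_1-p_2)}{2\pi_k(p_1)\pi_k(p_2)}\right)$. The group $SL^\ddagger(2,H_{\mathbb{R}})$ acts on $\mathbb{H}^4$ by isometries via $\begin{pmatrix}a&b\\c&d\end{pmatrix}.z=(az+b)(cz+d)^{-1}$, with $\pm id$ acting trivially. Fix an embedding of algebras with involution $(H,\ddagger)\hookrightarrow(H_{\mathbb{R}},\ddagger)$; through it $SL^\ddagger(2,\mathcal{O})$ acts on $\mathbb{H}^4$, and $SL^\ddagger(2,\mathcal{O})/\{\pm id\}$ is a discrete subgroup of $\mathrm{Isom}^0(\mathbb{H}^4)$, the group of orientation-preserving isometries. Dirichlet domain: if $\Gamma$ is a discrete group acting by isometries on a metric space $(M,d)$ and $z\in M$ has trivial stabilizer in $\Gamma$, the Dirichlet domain for $\Gamma$ centered at $z$ is $\{w\in M\mid d(w,z)\le d(w,\gamma.z)\ \forall\gamma\in\Gamma\}$. Here $\Gamma=SL^\ddagger(2,\mathcal{O})/\{\pm id\}$. *)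

theory Defs
  imports
    "HOL-Analysis.Analysis"
    "HOL-Algebra.Subrings"
    "HOL-Algebra.Generated_Groups"
    "HOL-Library.Nat_Bijection"
begin

section \<open>Rings with involution\<close>

definition involution :: "('a, 'm) ring_scheme \<Rightarrow> ('a \<Rightarrow> 'a) \<Rightarrow> bool" where
  "involution R \<sigma> \<longleftrightarrow>
     \<sigma> \<in> carrier R \<rightarrow> carrier R \<and>
     (\<forall>x\<in>carrier R. \<forall>y\<in>carrier R. \<sigma> (x \<oplus>\<^bsub>R\<^esub> y) = \<sigma> x \<oplus>\<^bsub>R\<^esub> \<sigma> y) \<and>
     (\<forall>x\<in>carrier R. \<forall>y\<in>carrier R. \<sigma> (x \<otimes>\<^bsub>R\<^esub> y) = \<sigma> y \<otimes>\<^bsub>R\<^esub> \<sigma> x) \<and>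
     (\<forall>x\<in>carrier R. \<sigma> (\<sigma> x) = x)"

definition fixed_part :: "('a, 'm) ring_scheme \<Rightarrow> ('a \<Rightarrow> 'a) \<Rightarrow> 'a set" where
  "fixed_part R \<sigma> = {r \<in> carrier R. \<sigma> r = r}"

text \<open>The well-ordered set \<open>W\<close> is taken to be the field of a well-order on the element type of
  \<open>R\<close>. This is no restriction: only the image of \<open>\<Phi>\<close> in \<open>W\<close> matters, it is
  well-ordered, and it injects into \<open>R\<close>.\<close>

definition sigma_euclidean :: "('a, 'm) ring_scheme \<Rightarrow> ('a \<Rightarrow> 'a) \<Rightarrow> bool" where
  "sigma_euclidean R \<sigma> \<longleftrightarrow>
     ring R \<and> involution R \<sigma> \<and>
     (\<forall>x\<in>carrier R. \<forall>y\<in>carrier R. x \<otimes>\<^bsub>R\<^esub> y = \<zero>\<^bsub>R\<^esub> \<longrightarrow> x = \<zero>\<^bsub>R\<^esub> \<or> y = \<zero>\<^bsub>R\<^esub>) \<and>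
     (\<exists>(W :: 'a rel) \<Phi>. Well_order W \<and> \<Phi> \<in> carrier R \<rightarrow> Field W \<and>
        (\<forall>a\<in>carrier R. \<forall>b\<in>carrier R.
           b \<noteq> \<zero>\<^bsub>R\<^esub> \<and> a \<otimes>\<^bsub>R\<^esub> \<sigma> b \<in> fixed_part R \<sigma> \<longrightarrow>
           (\<exists>q\<in>fixed_part R \<sigma>. (\<Phi> (a \<ominus>\<^bsub>R\<^esub> b \<otimes>\<^bsub>R\<^esub> q), \<Phi> b) \<in> W - Id)))"

datatype 'a mat2 = Mat2 'a 'a 'a 'a

fun mat2_mult :: "('a, 'm) ring_scheme \<Rightarrow> 'a mat2 \<Rightarrow> 'a mat2 \<Rightarrow> 'a mat2" where
  "mat2_mult R (Mat2 a b c d) (Mat2 a' b' c' d') =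
     Mat2 (a \<otimes>\<^bsub>R\<^esub> a' \<oplus>\<^bsub>R\<^esub> b \<otimes>\<^bsub>R\<^esub> c') (a \<otimes>\<^bsub>R\<^esub> b' \<oplus>\<^bsub>R\<^esub> b \<otimes>\<^bsub>R\<^esub> d')
          (c \<otimes>\<^bsub>R\<^esub> a' \<oplus>\<^bsub>R\<^esub> d \<otimes>\<^bsub>R\<^esub> c') (c \<otimes>\<^bsub>R\<^esub> b' \<oplus>\<^bsub>R\<^esub> d \<otimes>\<^bsub>R\<^esub> d')"

definition mat2_one :: "('a, 'm) ring_scheme \<Rightarrow> 'a mat2" where
  "mat2_one R = Mat2 \<one>\<^bsub>R\<^esub> \<zero>\<^bsub>R\<^esub> \<zero>\<^bsub>R\<^esub> \<one>\<^bsub>R\<^esub>"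

definition mat2_minus_one :: "('a, 'm) ring_scheme \<Rightarrow> 'a mat2" where
  "mat2_minus_one R = Mat2 (\<ominus>\<^bsub>R\<^esub> \<one>\<^bsub>R\<^esub>) \<zero>\<^bsub>R\<^esub> \<zero>\<^bsub>R\<^esub> (\<ominus>\<^bsub>R\<^esub> \<one>\<^bsub>R\<^esub>)"

fun hat :: "('a, 'm) ring_scheme \<Rightarrow> ('a \<Rightarrow> 'a) \<Rightarrow> 'a mat2 \<Rightarrow> 'a mat2" where
  "hat R \<sigma> (Mat2 a b c d) = Mat2 (\<sigma> d) (\<ominus>\<^bsub>R\<^esub> \<sigma> b) (\<ominus>\<^bsub>R\<^esub> \<sigma> c) (\<sigma> a)"

definition SL_sigma :: "('a, 'm) ring_scheme \<Rightarrow> ('a \<Rightarrow> 'a) \<Rightarrow> 'a mat2 set" where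
  "SL_sigma R \<sigma> = {M. set_mat2 M \<subseteq> carrier R \<and>
     mat2_mult R M (hat R \<sigma> M) = mat2_one R \<and> mat2_mult R (hat R \<sigma> M) M = mat2_one R}"


section \<open>Quaternion algebras\<close>

lemma vector_4_nth [simp]:
  "(vector [x, y, z, t] :: ('a::zero)^4) $ 1 = x"
  "(vector [x, y, z, t] :: ('a::zero)^4) $ 2 = y"
  "(vector [x, y, z, t] :: ('a::zero)^4) $ 3 = z"
  "(vector [x, y, z, t] :: ('a::zero)^4) $ 4 = t"
  unfolding vector_def by simp_all

text \<open>\<open>quat_alg a b\<close> is the algebra with basis \<open>1, i, j, k\<close>, where \<open>i\<^sup>2 = a\<close>, \<open>j\<^sup>2 = b\<close> and
  \<open>k = i j = - j i\<close>; the vector \<open>(x, y, z, t)\<close> stands for \<open>x + y i + z j + t k\<close>.\<close>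

definition quat_mult :: "'a::field \<Rightarrow> 'a \<Rightarrow> 'a^4 \<Rightarrow> 'a^4 \<Rightarrow> 'a^4" where
  "quat_mult a b p q = vector
     [p$1 * q$1 + a * p$2 * q$2 + b * p$3 * q$3 - a * b * p$4 * q$4,
      p$1 * q$2 + p$2 * q$1 - b * p$3 * q$4 + b * p$4 * q$3,
      p$1 * q$3 + p$3 * q$1 + a * p$2 * q$4 - a * p$4 * q$2,
      p$1 * q$4 + p$4 * q$1 + p$2 * q$3 - p$3 * q$2]"

definition quat_alg :: "'a::field \<Rightarrow> 'a \<Rightarrow> ('a^4) ring" where
  "quat_alg a b = \<lparr>carrier = UNIV, mult = quat_mult a b, one = vector [1, 0, 0, 0],
     zero = 0, add = (+)\<rparr>"

definition quat_conj :: "'a::field^4 \<Rightarrow> 'a^4" where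
  "quat_conj p = vector [p$1, - p$2, - p$3, - p$4]"

lemma ring_quat_alg: "ring (quat_alg a b)"
proof (rule ringI)
  show "abelian_group (quat_alg a b)"
  proof (rule abelian_groupI)
    fix x :: "'a^4"
    show "\<exists>y\<in>carrier (quat_alg a b). y \<oplus>\<^bsub>quat_alg a b\<^esub> x = \<zero>\<^bsub>quat_alg a b\<^esub>"
      by (intro bexI[of _ "- x"]) (simp_all add: quat_alg_def)
  qed (simp_all add: quat_alg_def add.assoc add.commute)
  show "monoid (quat_alg a b)"
    by (rule monoidI)
      (simp_all add: quat_alg_def quat_mult_def vec_eq_iff forall_4 algebra_simps)
qed (simp_all add: quat_alg_def quat_mult_def vec_eq_iff forall_4 algebra_simps)

text \<open>The scalar extension to the reals of the rational quaternion algebra with parameters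
  \<open>a, b\<close> is the real algebra with the same parameters.\<close>

definition definite :: "rat \<Rightarrow> rat \<Rightarrow> bool" where
  "definite a b \<longleftrightarrow>
     (let HR = quat_alg (of_rat a :: real) (of_rat b) in Units HR = carrier HR - {\<zero>\<^bsub>HR\<^esub>})"

definition orthogonal_involution :: "rat \<Rightarrow> rat \<Rightarrow> (rat^4 \<Rightarrow> rat^4) \<Rightarrow> bool" where
  "orthogonal_involution a b \<sigma> \<longleftrightarrow>
     involution (quat_alg a b) \<sigma> \<and> Vector_Spaces.linear (*s) (*s) \<sigma> \<and> \<sigma> \<noteq> quat_conj"

definition quat_order :: "rat \<Rightarrow> rat \<Rightarrow> (rat^4) set \<Rightarrow> bool" where
  "quat_order a b \<O> \<longleftrightarrow> subring \<O> (quat_alg a b) \<and>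
     (\<exists>B. finite B \<and> generate (add_monoid (quat_alg a b)) B = \<O>) \<and> vec.span \<O> = UNIV"


section \<open>Hyperbolic 4-space and Dirichlet domains\<close>

abbreviation Ham :: "(real^4) ring" where
  "Ham \<equiv> quat_alg (- 1) (- 1)"

definition ddag :: "real^4 \<Rightarrow> real^4" where
  "ddag p = vector [p$1, p$2, p$3, - p$4]"

definition nrm :: "real^4 \<Rightarrow> real" where
  "nrm z = (z \<otimes>\<^bsub>Ham\<^esub> quat_conj z) $ 1"

definition H4 :: "(real^4) set" where
  "H4 = {z. z $ 4 > 0}"

definition hyp_dist :: "real^4 \<Rightarrow> real^4 \<Rightarrow> real" where
  "hyp_dist p q = arcosh (1 + nrm (p - q) / (2 * p $ 4 * q $ 4))"

fun moebius :: "(real^4) mat2 \<Rightarrow> real^4 \<Rightarrow> real^4" where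
  "moebius (Mat2 a b c d) z =
     (a \<otimes>\<^bsub>Ham\<^esub> z \<oplus>\<^bsub>Ham\<^esub> b) \<otimes>\<^bsub>Ham\<^esub> inv\<^bsub>Ham\<^esub> (c \<otimes>\<^bsub>Ham\<^esub> z \<oplus>\<^bsub>Ham\<^esub> d)"

definition dirichlet_domain ::
    "'m set \<Rightarrow> ('m \<Rightarrow> 'm \<Rightarrow> real) \<Rightarrow> 'g set \<Rightarrow> ('g \<Rightarrow> 'm \<Rightarrow> 'm) \<Rightarrow> 'm \<Rightarrow> 'm set" where
  "dirichlet_domain X dst \<Gamma> act z = {w \<in> X. \<forall>\<gamma>\<in>\<Gamma>. dst w z \<le> dst w (act \<gamma> z)}"

definition involution_embedding ::
    "rat \<Rightarrow> rat \<Rightarrow> (rat^4 \<Rightarrow> rat^4) \<Rightarrow> (rat^4 \<Rightarrow> real^4) \<Rightarrow> bool" where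
  "involution_embedding a b \<sigma> \<iota> \<longleftrightarrow>
     \<iota> \<in> ring_hom (quat_alg a b) Ham \<and> inj \<iota> \<and>
     (\<forall>(r::rat) x. \<iota> (r *s x) = of_rat r *s \<iota> x) \<and>
     (\<forall>x. \<iota> (\<sigma> x) = ddag (\<iota> x))"


section \<open>Cusps\<close>

text \<open>The sphere at infinity is \<open>{z. \<pi>\<^sub>k(z) = 0} \<union> {\<infinity>}\<close>, with \<open>None\<close> for \<open>\<infinity>\<close>.
  The cusps of the quotient by a discrete group \<open>G\<close> are the \<open>G\<close>-orbits of the fixed points of
  its parabolic elements; an isometry is parabolic if it has no fixed point in \<open>H4\<close> and
  exactly one at infinity.\<close>

definition bdry :: "(real^4) option set" where
  "bdry = insert None (Some ` {z. z $ 4 = 0})"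

fun moebius_bdry :: "(real^4) mat2 \<Rightarrow> (real^4) option \<Rightarrow> (real^4) option" where
  "moebius_bdry (Mat2 a b c d) None =
     (if c = \<zero>\<^bsub>Ham\<^esub> then None else Some (a \<otimes>\<^bsub>Ham\<^esub> inv\<^bsub>Ham\<^esub> c))"
| "moebius_bdry (Mat2 a b c d) (Some z) =
     (if c \<otimes>\<^bsub>Ham\<^esub> z \<oplus>\<^bsub>Ham\<^esub> d = \<zero>\<^bsub>Ham\<^esub> then None else Some (moebius (Mat2 a b c d) z))"

definition parabolic :: "(real^4) mat2 \<Rightarrow> bool" where
  "parabolic M \<longleftrightarrow> (\<forall>z\<in>H4. moebius M z \<noteq> z) \<and> (\<exists>!p. p \<in> bdry \<and> moebius_bdry M p = p)"

definition cusp_points :: "(real^4) mat2 set \<Rightarrow> (real^4) option set" where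
  "cusp_points G = {p \<in> bdry. \<exists>M\<in>G. parabolic M \<and> moebius_bdry M p = p}"

definition cusps :: "(real^4) mat2 set \<Rightarrow> (real^4) option set set" where
  "cusps G = (\<lambda>p. (\<lambda>M. moebius_bdry M p) ` G) ` cusp_points G"


section \<open>Algorithms\<close>

text \<open>Algorithms are partial recursive functions, in Kleene's presentation.
  \<open>rec_eval f xs y\<close> means that \<open>f\<close> halts on the arguments \<open>xs\<close> with value \<open>y\<close>.\<close>

datatype recf =
    Zero
  | Succ
  | Proj nat
  | Comp recf "recf list"
  | PrimRec recf recf
  | Mu recf

inductive rec_eval :: "recf \<Rightarrow> nat list \<Rightarrow> nat \<Rightarrow> bool" where
  zero: "rec_eval Zero xs 0"
| succ: "rec_eval Succ (x # xs) (Suc x)"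
| proj: "i < length xs \<Longrightarrow> rec_eval (Proj i) xs (xs ! i)"
| comp: "list_all2 (\<lambda>g y. rec_eval g xs y) gs ys \<Longrightarrow> rec_eval f ys z \<Longrightarrow>
    rec_eval (Comp f gs) xs z"
| prim_0: "rec_eval f xs y \<Longrightarrow> rec_eval (PrimRec f g) (0 # xs) y"
| prim_Suc: "rec_eval (PrimRec f g) (n # xs) y \<Longrightarrow> rec_eval g (n # y # xs) z \<Longrightarrow>
    rec_eval (PrimRec f g) (Suc n # xs) z"
| mu: "rec_eval f (n # xs) 0 \<Longrightarrow> (\<forall>m<n. \<exists>y>0. rec_eval f (m # xs) y) \<Longrightarrow>
    rec_eval (Mu f) xs n"

inductive_cases rec_eval_elims:
  "rec_eval Zero xs y" "rec_eval Succ xs y" "rec_eval (Proj i) xs y" "rec_eval (Comp f gs) xs y"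
  "rec_eval (PrimRec f g) (0 # xs) y" "rec_eval (PrimRec f g) (Suc n # xs) y"
  "rec_eval (Mu f) xs y"

lemma rec_eval_deterministic: "rec_eval f xs y \<Longrightarrow> rec_eval f xs y' \<Longrightarrow> y = y'"
proof (induction arbitrary: y' rule: rec_eval.induct)
  case (comp xs gs ys f z)
  from comp.prems obtain ys' where ys': "list_all2 (\<lambda>g y. rec_eval g xs y) gs ys'"
    and z: "rec_eval f ys' y'" by (auto elim: rec_eval_elims)
  have "ys = ys'"
    using comp.IH(1) ys' by (auto simp: list_all2_conv_all_nth intro: nth_equalityI)
  then show ?case using comp.IH(2) z by blast
next
  case (mu f n xs)
  from mu.prems have *: "rec_eval f (y' # xs) 0" "\<forall>m<y'. \<exists>y>0. rec_eval f (m # xs) y"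
    by (auto elim: rec_eval_elims)
  have "\<not> y' < n" using mu.IH(2) *(1) by fastforce
  moreover have "\<not> n < y'" using mu.IH(1) *(2) by fastforce
  ultimately show ?case by simp
next
  case (prim_Suc f g n xs y z)
  from prim_Suc.prems obtain w where "rec_eval (PrimRec f g) (n # xs) w"
    "rec_eval g (n # w # xs) y'" by (auto elim: rec_eval_elims)
  then show ?case using prim_Suc.IH by blast
qed (blast elim: rec_eval_elims)+

definition rat_code :: "rat \<Rightarrow> nat" where
  "rat_code r = (case quotient_of r of (p, q) \<Rightarrow> prod_encode (int_encode p, int_encode q))"

definition quat_code :: "rat^4 \<Rightarrow> nat" where
  "quat_code x = list_encode [rat_code (x$1), rat_code (x$2), rat_code (x$3), rat_code (x$4)]"

fun mat2_code :: "(rat^4) mat2 \<Rightarrow> nat" where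
  "mat2_code (Mat2 a b c d) =
     list_encode [quat_code a, quat_code b, quat_code c, quat_code d]"

text \<open>The input presents the algebra by its parameters \<open>a, b\<close>, the involution by its matrix
  (the images of \<open>1, i, j, k\<close>), and the order by a list of generators of its additive group.
  The element \<open>u\<close> tells the algorithm which side of the 3-space \<open>\<pi>\<^sub>k = 0\<close> the fixed
  embedding into the Hamilton quaternions maps to the upper half-space: \<open>u\<close> is an arbitrary
  element mapped into it. Two embeddings of algebras with involution that agree in this respect
  differ by a rotation about the \<open>k\<close>-axis, which is an isometry.\<close>

definition input_code ::
    "rat \<Rightarrow> rat \<Rightarrow> (rat^4 \<Rightarrow> rat^4) \<Rightarrow> (rat^4) list \<Rightarrow> rat^4 \<Rightarrow> nat" where
  "input_code a b \<sigma> gs u = list_encode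
     [rat_code a, rat_code b,
      list_encode (map (\<lambda>e. quat_code (\<sigma> e))
        [vector [1,0,0,0], vector [0,1,0,0], vector [0,0,1,0], vector [0,0,0,1]]),
      list_encode (map quat_code gs), quat_code u]"

definition output_code :: "rat^4 \<Rightarrow> (rat^4) mat2 list \<Rightarrow> nat" where
  "output_code z Ms = prod_encode (quat_code z, list_encode (map mat2_code Ms))"

text \<open>A centre \<open>z\<close>, given by an element of the rational algebra, together with finitely many
  group elements describes a Dirichlet domain if \<open>z\<close> has trivial stabilizer modulo
  \<open>\<plusminus>1\<close> and the half-spaces of the listed elements already cut out the Dirichlet domain
  centred at \<open>z\<close>. As \<open>\<plusminus>1\<close> acts trivially, the domain may be formed over the group of
  matrices itself.\<close>

definition describes_dirichlet_domain ::
    "rat \<Rightarrow> rat \<Rightarrow> (rat^4 \<Rightarrow> rat^4) \<Rightarrow> (rat^4) set \<Rightarrow> (rat^4 \<Rightarrow> real^4) \<Rightarrow>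
     rat^4 \<Rightarrow> (rat^4) mat2 list \<Rightarrow> bool" where
  "describes_dirichlet_domain a b \<sigma> \<O> \<iota> z Ms \<longleftrightarrow>
     (let R = (quat_alg a b)\<lparr>carrier := \<O>\<rparr>; \<Gamma> = SL_sigma R \<sigma>;
          act = (\<lambda>M. moebius (map_mat2 \<iota> M)) in
        \<iota> z \<in> H4 \<and>
        (\<forall>M\<in>\<Gamma>. act M (\<iota> z) = \<iota> z \<longrightarrow> M \<in> {mat2_one R, mat2_minus_one R}) \<and>
        set Ms \<subseteq> \<Gamma> \<and>
        dirichlet_domain H4 hyp_dist \<Gamma> act (\<iota> z) =
          {w \<in> H4. \<forall>M\<in>set Ms. hyp_dist w (\<iota> z) \<le> hyp_dist w (act M (\<iota> z))})"

end

theory Submission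
  imports Defs
begin

text \<open>
  \<^emph>\<open>One cusp.\<close> A row \<open>(c, d)\<close> over the order with \<open>c \<sigma>(d) \<in> \<O>\<^sup>+\<close> is isotropic for the skew-Hermitian form
  preserved by the group, and the Euclidean algorithm writes it as \<open>g\<close> times the bottom row of a group
  element. A fixed point \<open>p\<close> of a parabolic element is annihilated by such a row, because the
  denominator \<open>c p + d\<close> has norm 1 and rational trace. So \<open>p\<close> is equivalent to \<open>\<infinity>\<close>.

  \<^emph>\<open>Finiteness.\<close> By the pigeonhole principle, for \<open>p\<close> in the boundary and small \<open>t\<close> there is a nonzero row
  \<open>(c, d)\<close> with \<open>t |c|\<^sup>2 + |c p + d|\<^sup>2 / t\<close> either so small that the row is isotropic, or bounded and
  accompanied by an independent one; finitely many Gram matrices of such pairs occur and each yields an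
  isotropic combination of bounded size. Hence \<open>|c p + d|\<close> is arbitrarily small for suitable group
  elements, and the Dirichlet domain of a high centre stays above a positive height over a compact set.

  \<^emph>\<open>The algorithm\<close> searches for a certificate: a centre with trivial stabilizer, all group elements
  with entries in a finite list containing a ball of the order, and a grid of boxes each of which violates
  one of the corresponding inequalities at all corners, hence, by convexity, everywhere. This confines the
  intersection of the half-spaces to a region on which an explicit bound shows every
  group element with larger entries to be irrelevant.
\<close>

section \<open>Computable functions on codes\<close>

text \<open>Distances would bring in arcosh, denominators and an irrational embedding. Every
  inequality d(w, z) <= d(w, Mz) is therefore replaced by the sign of the polynomial
  \<open>gdist\<close>, which also makes sense on the boundary and takes rational values on rational
  data. For a centre of height at least 1 all denominators n = nrm (c z + d) are at least 1, and
  \<open>gdist\<close> is quadratic in w with leading coefficient n - 1; this is the source of the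
  convexity. Low points are the obstacle, since infinitely many elements matter near the boundary.
  Boxes touching height 0 exclude them, and enough such boxes exist because every boundary point
  strictly violates some inequality, so that compactness applies. The plain pigeonhole principle
  does not show this, as a short row need not be isotropic; hence the detour through independent
  pairs. The algorithm never sees the embedding: heights and orthogonality are expressed by the
  rational norm form and the involution, and the element u only fixes the sign of the
  k-component.\<close>

definition computable :: "(nat \<Rightarrow> nat) \<Rightarrow> bool" where
  "computable f \<longleftrightarrow> (\<exists>F. \<forall>x. rec_eval F [x] (f x))"

text \<open>Bootstraps arithmetic and pairing; afterwards further arguments are packed into a single
  code.\<close>

definition computable2 :: "(nat \<Rightarrow> nat \<Rightarrow> nat) \<Rightarrow> bool" where
  "computable2 f \<longleftrightarrow> (\<exists>F. \<forall>x y. rec_eval F [x, y] (f x y))"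

lemma rec_eval_comp1: "rec_eval G xs y \<Longrightarrow> rec_eval F [y] z \<Longrightarrow> rec_eval (Comp F [G]) xs z"
  by (rule rec_eval.comp[where ys = "[y]"]) auto

lemma rec_eval_comp2:
  "rec_eval G xs y \<Longrightarrow> rec_eval G' xs y' \<Longrightarrow> rec_eval F [y, y'] z \<Longrightarrow> rec_eval (Comp F [G, G']) xs z"
  by (rule rec_eval.comp[where ys = "[y, y']"]) auto

lemma rec_eval_Proj:
  "rec_eval (Proj 0) (x # xs) x" "rec_eval (Proj 1) (x # y # xs) y"
  "rec_eval (Proj 2) (x # y # z # xs) z"
  using rec_eval.proj[of 0 "x # xs"] rec_eval.proj[of 1 "x # y # xs"]
    rec_eval.proj[of 2 "x # y # z # xs"] by simp_all

lemma rec_eval_PrimRec: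
  assumes "rec_eval F xs f" "\<And>n y. rec_eval G (n # y # xs) (g n y)"
  shows "rec_eval (PrimRec F G) (n # xs) (rec_nat f g n)"
  by (induction n) (auto intro: rec_eval.intros assms)

lemma rec_eval_Mu_LEAST:
  assumes "\<And>m. rec_eval F (m # xs) (f m)" "f m = 0"
  shows "rec_eval (Mu F) xs (LEAST m. f m = 0)"
proof (rule rec_eval.mu)
  show "rec_eval F ((LEAST m. f m = 0) # xs) 0"
    using assms(1)[of "LEAST m. f m = 0"] LeastI[of "\<lambda>m. f m = 0", OF assms(2)] by simp
  show "\<forall>k<LEAST m. f m = 0. \<exists>y>0. rec_eval F (k # xs) y"
    using assms(1) not_less_Least by blast
qed

lemma computable_id: "computable (\<lambda>x. x)"
  unfolding computable_def using rec_eval_Proj(1) by blast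

lemma computable_compose: "computable g \<Longrightarrow> computable f \<Longrightarrow> computable (\<lambda>x. g (f x))"
  unfolding computable_def using rec_eval_comp1 by blast

lemma computable_compose2:
  "computable2 h \<Longrightarrow> computable f \<Longrightarrow> computable g \<Longrightarrow> computable (\<lambda>x. h (f x) (g x))"
  unfolding computable_def computable2_def using rec_eval_comp2 by blast

lemma computable_const: "computable (\<lambda>_. n)"
proof (induction n)
  case 0
  then show ?case unfolding computable_def using rec_eval.zero by blast
next
  case (Suc n)
  then show ?case unfolding computable_def using rec_eval_comp1 rec_eval.succ by meson
qed

lemma computable_Suc: "computable f \<Longrightarrow> computable (\<lambda>x. Suc (f x))"
  unfolding computable_def using rec_eval_comp1 rec_eval.succ by meson

lemma computable2_add: "computable2 (+)"
proof -
  have "rec_eval (PrimRec (Proj 0) (Comp Succ [Proj 1])) [x, y] (x + y)" for x y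
  proof -
    have "rec_nat y (\<lambda>n. Suc) x = x + y" by (induction x) auto
    then show ?thesis
      using rec_eval_PrimRec[of "Proj 0" "[y]" y "Comp Succ [Proj 1]" "\<lambda>n. Suc" x]
      by (simp add: rec_eval_Proj rec_eval_comp1[OF rec_eval_Proj(2) rec_eval.succ, unfolded One_nat_def])
  qed
  then show ?thesis unfolding computable2_def by blast
qed

lemma computable2_mult: "computable2 (*)"
proof -
  obtain A where A: "\<And>x y. rec_eval A [x, y] (x + y)"
    using computable2_add unfolding computable2_def by blast
  have "rec_eval (PrimRec Zero (Comp A [Proj 2, Proj 1])) [x, y] (x * y)" for x y
  proof -
    have "rec_nat 0 (\<lambda>n z. y + z) x = x * y" by (induction x) auto
    then show ?thesis
      using rec_eval_PrimRec[of Zero "[y]" 0 "Comp A [Proj 2, Proj 1]" "\<lambda>n z. y + z" x]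
      by (simp add: rec_eval.zero rec_eval_comp2[OF rec_eval_Proj(3) rec_eval_Proj(2) A, unfolded One_nat_def])
  qed
  then show ?thesis unfolding computable2_def by blast
qed

lemma computable2_diff: "computable2 (-)"
proof -
  have P: "rec_eval (PrimRec Zero (Proj 0)) [x] (x - 1)" for x
  proof -
    have "rec_nat 0 (\<lambda>n z. n) x = x - 1" by (cases x) auto
    then show ?thesis
      using rec_eval_PrimRec[of Zero "[]" 0 "Proj 0" "\<lambda>n z. n" x]
      by (auto intro: rec_eval_Proj rec_eval.zero)
  qed
  \<comment> \<open>\<open>PrimRec\<close> recurses on the first argument, here the subtrahend; the
    arguments are exchanged at the end.\<close>
  have D: "rec_eval (PrimRec (Proj 0) (Comp (PrimRec Zero (Proj 0)) [Proj 1])) [x, y] (y - x)" for x y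
  proof -
    have "rec_nat y (\<lambda>n z. z - 1) x = y - x" by (induction x) auto
    then show ?thesis
      using rec_eval_PrimRec[of "Proj 0" "[y]" y "Comp (PrimRec Zero (Proj 0)) [Proj 1]" "\<lambda>n z. z - 1" x]
      by (simp add: rec_eval_Proj rec_eval_comp1[OF rec_eval_Proj(2) P, unfolded One_nat_def])
  qed
  show ?thesis unfolding computable2_def
    using rec_eval_comp2[OF rec_eval_Proj(2) rec_eval_Proj(1) D] by blast
qed

lemmas computable_add = computable_compose2[OF computable2_add]
lemmas computable_mult = computable_compose2[OF computable2_mult]
lemmas computable_diff = computable_compose2[OF computable2_diff]

lemma computable2_compose2:
  assumes "computable2 h" "computable2 f" "computable2 g"
  shows "computable2 (\<lambda>x y. h (f x y) (g x y))"
  using assms unfolding computable2_def using rec_eval_comp2 by blast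

lemma computable2_fst: "computable f \<Longrightarrow> computable2 (\<lambda>x y. f x)"
  unfolding computable_def computable2_def using rec_eval_comp1 rec_eval_Proj(1) by blast

lemma computable2_snd: "computable f \<Longrightarrow> computable2 (\<lambda>x y. f y)"
  unfolding computable_def computable2_def using rec_eval_comp1 rec_eval_Proj(2) by blast

lemma computable_triangle: "computable triangle"
proof -
  obtain A where A: "\<And>x y. rec_eval A [x, y] (x + y)"
    using computable2_add unfolding computable2_def by blast
  have "rec_eval (PrimRec Zero (Comp A [Proj 1, Comp Succ [Proj 0]])) [x] (triangle x)" for x
  proof -
    have "rec_nat 0 (\<lambda>n z. z + Suc n) x = triangle x" by (induction x) auto
    then show ?thesis
      using rec_eval_PrimRec[of Zero "[]" 0 "Comp A [Proj 1, Comp Succ [Proj 0]]" "\<lambda>n z. z + Suc n" x]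
        rec_eval_comp2[OF rec_eval_Proj(2) rec_eval_comp1[OF rec_eval_Proj(1) rec_eval.succ] A]
      by (auto intro: rec_eval.zero)
  qed
  then show ?thesis unfolding computable_def by blast
qed

lemma computable2_prod_encode: "computable2 (\<lambda>x y. prod_encode (x, y))"
proof -
  have "computable2 (\<lambda>x y. triangle (x + y))"
    using computable_triangle computable2_add unfolding computable_def computable2_def
    using rec_eval_comp1 by blast
  then show ?thesis
    using computable2_compose2[OF computable2_add _ computable2_fst[OF computable_id]]
    by (simp add: prod_encode_def)
qed

abbreviation pfst :: "nat \<Rightarrow> nat" where "pfst n \<equiv> fst (prod_decode n)"
abbreviation psnd :: "nat \<Rightarrow> nat" where "psnd n \<equiv> snd (prod_decode n)"

lemma triangle_mono: "m \<le> n \<Longrightarrow> triangle m \<le> triangle n"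
  by (induction n) (auto simp: le_Suc_eq)

text \<open>Undoes the Cantor pairing: the diagonal \<open>a + b\<close> of \<open>n\<close> is the
  least \<open>s\<close> with \<open>n < triangle (Suc s)\<close>, which \<open>Mu\<close> finds.
  Both components follow by subtraction.\<close>

lemma
  shows computable_pfst: "computable pfst" and computable_psnd: "computable psnd"
proof -
  define s where "s n = (LEAST s. Suc n - triangle (Suc s) = 0)" for n
  have s: "s n = pfst n + psnd n" for n
  proof -
    obtain a b where ab: "prod_decode n = (a, b)" by fastforce
    then have n: "n = triangle (a + b) + a"
      using prod_decode_inverse[of n] by (simp add: prod_encode_def)
    show ?thesis unfolding s_def ab fst_conv snd_conv
    proof (rule Least_equality)
      show "Suc n - triangle (Suc (a + b)) = 0" using n by simp
      fix y assume "Suc n - triangle (Suc y) = 0"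
      then have *: "n < triangle (Suc y)" by simp
      show "a + b \<le> y"
      proof (rule ccontr)
        assume "\<not> a + b \<le> y"
        then have "triangle (Suc y) \<le> triangle (a + b)" by (intro triangle_mono) simp
        with * n show False by simp
      qed
    qed
  qed
  have "computable2 (\<lambda>m n. Suc n - triangle (Suc m))"
    by (intro computable2_compose2[OF computable2_diff] computable2_snd computable2_fst
        computable_Suc computable_id computable_compose[OF computable_triangle])
  then obtain F where F: "\<And>m n. rec_eval F [m, n] (Suc n - triangle (Suc m))"
    unfolding computable2_def by blast
  have ex: "Suc n - triangle (Suc n) = 0" for n by simp
  have cs: "computable s"
    unfolding computable_def s_def
    using rec_eval_Mu_LEAST[of F _ "\<lambda>m. Suc n - triangle (Suc m)" for n, OF F ex] by blast
  have f: "pfst n = n - triangle (s n)" for n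
    unfolding s using prod_decode_inverse[of n] by (simp add: prod_encode_def split: prod.splits)
  have g: "psnd n = s n - pfst n" for n unfolding s by simp
  show 1: "computable pfst"
    unfolding f by (intro computable_diff computable_id computable_compose[OF computable_triangle] cs)
  show "computable psnd"
    unfolding g by (intro computable_diff cs 1)
qed

text \<open>The step function may depend on the parameter \<open>x\<close>; it takes the code of the
  triple of \<open>x\<close>, the index and the previous value.\<close>

lemma computable_prim_rec:
  assumes "computable b" "computable f"
    and g: "computable (\<lambda>e. g (pfst e) (pfst (psnd e)) (psnd (psnd e)))"
  shows "computable (\<lambda>x. rec_nat (f x) (g x) (b x))"
proof -
  obtain B F G P where BF: "\<And>x. rec_eval B [x] (b x)" "\<And>x. rec_eval F [x] (f x)"
    and G: "\<And>e. rec_eval G [e] (g (pfst e) (pfst (psnd e)) (psnd (psnd e)))"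
    and P: "\<And>x y. rec_eval P [x, y] (prod_encode (x, y))"
    using assms computable2_prod_encode unfolding computable_def computable2_def by blast
  let ?G = "Comp G [Comp P [Proj 2, Comp P [Proj 0, Proj 1]]]"
  have "rec_eval ?G [n, y, x] (g x n y)" for n y x
    using rec_eval_comp1[OF rec_eval_comp2[OF rec_eval_Proj(3)
          rec_eval_comp2[OF rec_eval_Proj(1,2) P] P] G] by simp
  then have "rec_eval (PrimRec F ?G) [b x, x] (rec_nat (f x) (g x) (b x))" for x
    by (intro rec_eval_PrimRec BF)
  then show ?thesis unfolding computable_def
    using rec_eval_comp2[OF BF(1) rec_eval_Proj(1)] by blast
qed

section \<open>Decidable predicates\<close>

definition decidable :: "(nat \<Rightarrow> bool) \<Rightarrow> bool" where
  "decidable P \<longleftrightarrow> computable (\<lambda>x. if P x then 0 else 1)"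

lemma decidable_zero: "computable f \<Longrightarrow> decidable (\<lambda>x. f x = 0)"
  unfolding decidable_def
  by (rule ssubst[where P = computable and s = "\<lambda>x. 1 - (1 - f x)"])
    (auto intro!: computable_diff computable_const)

text \<open>Truth is coded by 0, the value at which \<open>Mu\<close> stops, so implication
  corresponds to the product \<open>(1 - p) * q\<close>. The other connectives are derived from
  it.\<close>

lemma decidable_imp: "decidable P \<Longrightarrow> decidable Q \<Longrightarrow> decidable (\<lambda>x. P x \<longrightarrow> Q x)"
  unfolding decidable_def[of P] decidable_def[of Q]
  by (drule decidable_zero[OF computable_mult[OF computable_diff[OF computable_const[of 1]]]],
      assumption) (simp add: if_distrib cong: if_cong, elim back_subst[of decidable], auto)

lemma decidable_const: "decidable (\<lambda>_. b)"
  unfolding decidable_def by (rule computable_const)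

lemma decidable_not: "decidable P \<Longrightarrow> decidable (\<lambda>x. \<not> P x)"
  using decidable_imp[OF _ decidable_const[of False]] by simp

lemma decidable_conj: "decidable P \<Longrightarrow> decidable Q \<Longrightarrow> decidable (\<lambda>x. P x \<and> Q x)"
  using decidable_not[OF decidable_imp[OF _ decidable_not[of Q], of P]] by simp

lemma decidable_disj: "decidable P \<Longrightarrow> decidable Q \<Longrightarrow> decidable (\<lambda>x. P x \<or> Q x)"
  using decidable_imp[OF decidable_not[of P], of Q] by (simp add: disj_imp)

lemma decidable_le: "computable f \<Longrightarrow> computable g \<Longrightarrow> decidable (\<lambda>x. f x \<le> g x)"
  using decidable_zero[OF computable_diff, of f g] by simp

lemma decidable_less: "computable f \<Longrightarrow> computable g \<Longrightarrow> decidable (\<lambda>x. f x < g x)"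
  using decidable_not[OF decidable_le, of g f] by (simp add: not_le)

lemma decidable_eq: "computable f \<Longrightarrow> computable g \<Longrightarrow> decidable (\<lambda>x. f x = (g x :: nat))"
  using decidable_conj[OF decidable_le[of f g] decidable_le[of g f]] by (simp add: eq_iff)

lemma computable_if:
  assumes "decidable P" "computable f" "computable g"
  shows "computable (\<lambda>x. if P x then f x else g x)"
proof -
  let ?c = "\<lambda>x. if P x then 0 else (1::nat)"
  have "computable (\<lambda>x. (1 - ?c x) * f x + ?c x * g x)"
    using assms unfolding decidable_def
    by (intro computable_add computable_mult computable_diff computable_const)
  then show ?thesis by (rule back_subst[of computable]) auto
qed

lemma decidable_compose: "decidable P \<Longrightarrow> computable f \<Longrightarrow> decidable (\<lambda>x. P (f x))"
  unfolding decidable_def using computable_compose by fastforce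

lemma decidable_all_less:
  assumes "computable b" "decidable (\<lambda>e. P (pfst e) (psnd e))"
  shows "decidable (\<lambda>x. \<forall>i<b x. P x i)"
proof -
  let ?c = "\<lambda>x i. if P x i then 0 else (1::nat)"
  \<comment> \<open>The recursion counts the failures below \<open>n\<close>.\<close>
  have "rec_nat 0 (\<lambda>i y. y + ?c x i) n = 0 \<longleftrightarrow> (\<forall>i<n. P x i)" for x n
    by (induction n) (auto simp: less_Suc_eq)
  moreover have "decidable (\<lambda>x. rec_nat 0 (\<lambda>i y. y + ?c x i) (b x) = 0)"
  proof (rule decidable_zero, rule computable_prim_rec)
    have "computable (\<lambda>e. ?c (pfst e) (psnd e))" using assms(2) by (simp add: decidable_def)
    from computable_compose[OF this, of "\<lambda>e. prod_encode (pfst e, pfst (psnd e))"]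
    have "computable (\<lambda>e. ?c (pfst e) (pfst (psnd e)))"
      using computable_compose2[OF computable2_prod_encode, of "\<lambda>e. pfst e" "\<lambda>e. pfst (psnd e)"]
        computable_pfst computable_compose[OF computable_pfst computable_psnd] by simp
    then show "computable (\<lambda>e. psnd (psnd e) + ?c (pfst e) (pfst (psnd e)))"
      by (intro computable_add computable_compose[OF computable_psnd computable_psnd])
  qed (auto intro: assms computable_const)
  ultimately show ?thesis by simp
qed

lemma decidable_ex_less:
  assumes "computable b" "decidable (\<lambda>e. P (pfst e) (psnd e))"
  shows "decidable (\<lambda>x. \<exists>i<b x. P x i)"
  using decidable_not[OF decidable_all_less[OF assms(1) decidable_not[OF assms(2)]]] by simp

lemma computable_div2:
  assumes "computable f" shows "computable (\<lambda>x. f x div 2)"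
proof -
  have "decidable (\<lambda>e. \<exists>k<Suc (psnd e). psnd e = 2 * k + 1)" 
    by (intro decidable_ex_less computable_Suc computable_psnd decidable_eq computable_add
        computable_mult computable_const computable_compose[OF computable_psnd computable_pfst])
  moreover have "(\<exists>k<Suc n. n = 2 * k + 1) \<longleftrightarrow> odd n" for n :: nat
    by (auto elim!: oddE)
  ultimately have od: "decidable (\<lambda>e. odd (psnd e))" by simp
  \<comment> \<open>Half of \<open>n\<close> is the number of odd numbers below \<open>n\<close>;
    parity has been decided by bounded search, so no division is presupposed.\<close>
  have "computable (\<lambda>n. rec_nat 0 (\<lambda>i y. if odd i then Suc y else y) n)"
  proof (rule computable_prim_rec)
    show "computable (\<lambda>e. if odd (pfst (psnd e)) then Suc (psnd (psnd e)) else psnd (psnd e))"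
      using decidable_compose[OF od, of "\<lambda>e. prod_encode (0, pfst (psnd e))"]
        computable_compose2[OF computable2_prod_encode computable_const computable_compose[OF computable_pfst computable_psnd], of 0]
      by (intro computable_if computable_Suc computable_compose[OF computable_psnd computable_psnd]) simp
  qed (auto intro: computable_id computable_const)
  moreover have "rec_nat 0 (\<lambda>i y. if odd i then Suc y else y) n = n div 2" for n
    by (induction n) (auto elim!: oddE evenE)
  ultimately show ?thesis using computable_compose[OF _ assms] by simp
qed

lemma decidable_odd:
  assumes "computable f" shows "decidable (\<lambda>x. odd (f x))"
proof -
  have "decidable (\<lambda>x. f x = 2 * (f x div 2) + 1)"
    by (intro decidable_eq computable_add computable_mult computable_const computable_div2 assms)
  moreover have "n = 2 * (n div 2) + 1 \<longleftrightarrow> odd n" for n :: nat by presburger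
  ultimately show ?thesis by simp
qed

section \<open>Codes of lists\<close>

definition code_tl :: "nat \<Rightarrow> nat" where "code_tl c = psnd (c - 1)"
definition code_hd :: "nat \<Rightarrow> nat" where "code_hd c = pfst (c - 1)"
definition code_drop :: "nat \<Rightarrow> nat \<Rightarrow> nat" where "code_drop i c = (code_tl ^^ i) c"

text \<open>Truncated subtraction together with \<open>prod_decode 0 = (0, 0)\<close> makes the tail
  of the code 0 again 0, in agreement with \<open>tl []\<close>.\<close>

lemma list_decode_tl: "list_decode (code_tl c) = tl (list_decode c)"
proof (cases c)
  case 0
  have "prod_decode 0 = (0, 0)" by (simp add: prod_decode_def prod_decode_aux.simps)
  then show ?thesis using 0 by (simp add: code_tl_def)
qed (simp add: code_tl_def split: prod.split)

lemma list_decode_drop: "list_decode (code_drop i c) = drop i (list_decode c)"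
  by (induction i) (simp_all add: code_drop_def list_decode_tl drop_Suc tl_drop)

lemma list_decode_hd: "c \<noteq> 0 \<Longrightarrow> code_hd c = hd (list_decode c)"
  by (cases c) (simp_all add: code_hd_def split: prod.split)

lemma list_decode_eq_Nil: "list_decode c = [] \<longleftrightarrow> c = 0"
  by (cases c) (simp_all split: prod.split)

lemma code_drop_eq_0: "code_drop i c = 0 \<longleftrightarrow> length (list_decode c) \<le> i"
  using list_decode_eq_Nil[of "code_drop i c"] by (simp add: list_decode_drop)

lemma code_nth: "i < length (list_decode c) \<Longrightarrow> code_hd (code_drop i c) = list_decode c ! i"
  using list_decode_hd[of "code_drop i c"] code_drop_eq_0[of i c]
  by (simp add: list_decode_drop hd_drop_conv_nth)

lemma length_list_decode_le: "length (list_decode c) \<le> c"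
proof (induction c rule: less_induct)
  case (less c)
  show ?case
  proof (cases c)
    case (Suc n)
    obtain a b where ab: "prod_decode n = (a, b)" by fastforce
    then have "b \<le> n" by (metis prod_decode_inverse le_prod_encode_2)
    then show ?thesis using less[of b] Suc ab by simp
  qed simp
qed

lemma computable_pfst': "computable f \<Longrightarrow> computable (\<lambda>x. pfst (f x))"
  and computable_psnd': "computable f \<Longrightarrow> computable (\<lambda>x. psnd (f x))"
  by (rule computable_compose[OF computable_pfst] computable_compose[OF computable_psnd], assumption)+

lemma computable_code_tl: "computable f \<Longrightarrow> computable (\<lambda>x. code_tl (f x))"
  unfolding code_tl_def by (intro computable_psnd' computable_diff computable_const)

lemma computable_code_hd: "computable f \<Longrightarrow> computable (\<lambda>x. code_hd (f x))"
  unfolding code_hd_def by (intro computable_pfst' computable_diff computable_const)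

lemma computable_code_drop:
  assumes "computable i" "computable f"
  shows "computable (\<lambda>x. code_drop (i x) (f x))"
proof -
  have "code_drop i c = rec_nat c (\<lambda>_ y. code_tl y) i" for i c
    by (induction i) (simp_all add: code_drop_def)
  then show ?thesis using assms
    by (auto intro!: computable_prim_rec computable_code_tl computable_psnd' computable_id)
qed

lemmas computable_intros = computable_id computable_const computable_Suc computable_add
  computable_mult computable_diff computable_pfst' computable_psnd' computable_if
  computable_div2 computable_code_tl computable_code_hd computable_code_drop

text \<open>The length is never computed: \<open>i\<close> is a valid position exactly when
  \<open>code_drop i\<close> gives a nonzero code, and the code itself bounds the length.\<close>

lemma decidable_all_nth:
  assumes "computable c" "decidable (\<lambda>e. P (pfst e) (psnd e))"
  shows "decidable (\<lambda>x. \<forall>i<length (list_decode (c x)). P x i)"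
proof -
  have "decidable (\<lambda>x. \<forall>i<c x. code_drop i (c x) \<noteq> 0 \<longrightarrow> P x i)"
    using assms computable_compose[OF assms(1) computable_pfst]
    by (intro decidable_all_less decidable_imp decidable_not decidable_eq computable_intros)
  moreover have "(\<forall>i<c x. code_drop i (c x) \<noteq> 0 \<longrightarrow> P x i) \<longleftrightarrow>
      (\<forall>i<length (list_decode (c x)). P x i)" for x
    using length_list_decode_le[of "c x"] by (force simp: code_drop_eq_0)
  ultimately show ?thesis by simp
qed

lemma decidable_Ball_list:
  assumes "computable c" "decidable (\<lambda>e. P (pfst e) (psnd e))"
  shows "decidable (\<lambda>x. \<forall>y\<in>set (list_decode (c x)). P x y)"
proof -
  have "computable (\<lambda>e. prod_encode (pfst e, code_hd (code_drop (psnd e) (c (pfst e)))))"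
    using computable_compose[OF assms(1) computable_pfst]
    by (intro computable_compose2[OF computable2_prod_encode] computable_intros)
  from decidable_compose[OF assms(2) this]
  have "decidable (\<lambda>x. \<forall>i<length (list_decode (c x)). P x (code_hd (code_drop i (c x))))"
    by (intro decidable_all_nth assms) simp
  moreover have "(\<forall>i<length (list_decode (c x)). P x (code_hd (code_drop i (c x)))) \<longleftrightarrow>
      (\<forall>y\<in>set (list_decode (c x)). P x y)" for x
    by (simp add: code_nth all_set_conv_all_nth)
  ultimately show ?thesis by simp
qed

lemma decidable_Bex_list:
  assumes "computable c" "decidable (\<lambda>e. P (pfst e) (psnd e))"
  shows "decidable (\<lambda>x. \<exists>y\<in>set (list_decode (c x)). P x y)"
  using decidable_not[OF decidable_Ball_list[OF assms(1) decidable_not[OF assms(2)]]] by simp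

lemma decidable_search:
  assumes "decidable (\<lambda>e. P (pfst e) (psnd e))" "computable out"
  shows "\<exists>F. \<forall>x. (\<exists>y. P x y) \<longrightarrow> (\<exists>y. P x y \<and> rec_eval F [x] (out y))"
proof -
  let ?c = "\<lambda>x y. if P x y then 0 else (1::nat)"
  obtain C E H where C: "\<And>e. rec_eval C [e] (?c (pfst e) (psnd e))"
    and E: "\<And>x y. rec_eval E [x, y] (prod_encode (x, y))" and H: "\<And>y. rec_eval H [y] (out y)"
    using assms computable2_prod_encode unfolding decidable_def computable_def computable2_def by blast
  let ?F = "Comp C [Comp E [Proj 1, Proj 0]]"
  have F: "rec_eval ?F [y, x] (?c x y)" for x y
    using rec_eval_comp1[OF rec_eval_comp2[OF rec_eval_Proj(2) rec_eval_Proj(1) E] C] by simp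
  have "P x (LEAST y. ?c x y = 0) \<and> rec_eval (Comp H [Mu ?F]) [x] (out (LEAST y. ?c x y = 0))"
    if "P x y" for x y
  proof
    show "rec_eval (Comp H [Mu ?F]) [x] (out (LEAST y. ?c x y = 0))"
      using rec_eval_comp1[OF rec_eval_Mu_LEAST[of ?F "[x]" "?c x" y, OF F] H] that by simp
    show "P x (LEAST y. ?c x y = 0)"
      using LeastI[of "\<lambda>y. ?c x y = 0" y] that by (auto split: if_splits)
  qed
  then show ?thesis by blast
qed

section \<open>The Hamilton quaternions\<close>

abbreviation qm :: "real^4 \<Rightarrow> real^4 \<Rightarrow> real^4" (infixl "\<cdot>" 70) where
  "x \<cdot> y \<equiv> quat_mult (- 1) (- 1) x y"

abbreviation q1 :: "real^4" where "q1 \<equiv> vector [1, 0, 0, 0]"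
abbreviation qk :: "real^4" where "qk \<equiv> vector [0, 0, 0, 1]"

definition qinv :: "real^4 \<Rightarrow> real^4" where "qinv x = (1 / nrm x) *\<^sub>R quat_conj x"

lemma qm_nth:
  "(x \<cdot> y)$1 = x$1 * y$1 - x$2 * y$2 - x$3 * y$3 - x$4 * y$4"
  "(x \<cdot> y)$2 = x$1 * y$2 + x$2 * y$1 + x$3 * y$4 - x$4 * y$3"
  "(x \<cdot> y)$3 = x$1 * y$3 + x$3 * y$1 - x$2 * y$4 + x$4 * y$2"
  "(x \<cdot> y)$4 = x$1 * y$4 + x$4 * y$1 + x$2 * y$3 - x$3 * y$2"
  by (simp_all add: quat_mult_def)

lemma quat_conj_nth [simp]:
  "quat_conj x $ 1 = x$1" "quat_conj x $ 2 = - x$2" "quat_conj x $ 3 = - x$3" "quat_conj x $ 4 = - x$4"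
  by (simp_all add: quat_conj_def)

lemma ddag_nth [simp]:
  "ddag x $ 1 = x$1" "ddag x $ 2 = x$2" "ddag x $ 3 = x$3" "ddag x $ 4 = - x$4"
  by (simp_all add: ddag_def)

lemma nrm_eq: "nrm x = (x$1)\<^sup>2 + (x$2)\<^sup>2 + (x$3)\<^sup>2 + (x$4)\<^sup>2"
  by (simp add: nrm_def quat_alg_def qm_nth power2_eq_square)

lemma nrm_norm: "nrm x = (norm x)\<^sup>2"
  by (simp add: nrm_eq norm_vec_def L2_set_def sum_4)

lemma nrm_inner: "nrm x = inner x x"
  by (simp add: nrm_norm power2_norm_eq_inner)

lemmas q_eq_iff = vec_eq_iff forall_4

lemma qm_assoc: "x \<cdot> y \<cdot> z = x \<cdot> (y \<cdot> z)"
  by (simp add: q_eq_iff qm_nth algebra_simps)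

lemma qm_add_left: "(x + y) \<cdot> z = x \<cdot> z + y \<cdot> z"
  and qm_add_right: "z \<cdot> (x + y) = z \<cdot> x + z \<cdot> y"
  and qm_diff_left: "(x - y) \<cdot> z = x \<cdot> z - y \<cdot> z"
  and qm_diff_right: "z \<cdot> (x - y) = z \<cdot> x - z \<cdot> y"
  by (simp_all add: q_eq_iff qm_nth algebra_simps)

lemma qm_minus_left [simp]: "(- x) \<cdot> z = - (x \<cdot> z)"
  and qm_minus_right [simp]: "z \<cdot> (- x) = - (z \<cdot> x)"
  and qm_scaleR_left [simp]: "(r *\<^sub>R x) \<cdot> z = r *\<^sub>R (x \<cdot> z)"
  and qm_scaleR_right [simp]: "z \<cdot> (r *\<^sub>R x) = r *\<^sub>R (z \<cdot> x)"
  and qm_zero_left [simp]: "0 \<cdot> z = 0"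
  and qm_zero_right [simp]: "z \<cdot> 0 = 0"
  and qm_one_left [simp]: "q1 \<cdot> z = z"
  and qm_one_right [simp]: "z \<cdot> q1 = z"
  by (simp_all add: q_eq_iff qm_nth algebra_simps)

lemmas qm_simps = qm_assoc qm_add_left qm_add_right qm_diff_left qm_diff_right

lemma ddag_qm: "ddag (x \<cdot> y) = ddag y \<cdot> ddag x"
  and ddag_add: "ddag (x + y) = ddag x + ddag y"
  and ddag_diff: "ddag (x - y) = ddag x - ddag y"
  and ddag_minus: "ddag (- x) = - ddag x"
  and ddag_scaleR: "ddag (r *\<^sub>R x) = r *\<^sub>R ddag x"
  and ddag_zero [simp]: "ddag 0 = 0"
  and ddag_one [simp]: "ddag q1 = q1"
  and ddag_ddag [simp]: "ddag (ddag x) = x"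
  by (simp_all add: q_eq_iff qm_nth algebra_simps)

lemmas ddag_simps = ddag_qm ddag_add ddag_diff ddag_minus ddag_scaleR

lemma quat_conj_qm: "quat_conj (x \<cdot> y) = quat_conj y \<cdot> quat_conj x"
  by (simp add: q_eq_iff qm_nth algebra_simps)

lemma ddag_fixed_iff: "ddag x = x \<longleftrightarrow> x$4 = 0"
  by (auto simp: q_eq_iff)

lemma nrm_ddag [simp]: "nrm (ddag x) = nrm x"
  and nrm_quat_conj [simp]: "nrm (quat_conj x) = nrm x"
  and nrm_minus [simp]: "nrm (- x) = nrm x"
  and nrm_zero [simp]: "nrm 0 = 0"
  and nrm_one [simp]: "nrm q1 = 1"
  by (simp_all add: nrm_eq)

lemma nrm_qm: "nrm (x \<cdot> y) = nrm x * nrm y"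
  by (simp add: nrm_eq qm_nth power2_eq_square algebra_simps)

lemma nrm_scaleR: "nrm (r *\<^sub>R x) = r\<^sup>2 * nrm x"
  by (simp add: nrm_norm power_mult_distrib)

lemma nrm_nonneg [simp]: "0 \<le> nrm x"
  by (simp add: nrm_norm)

lemma nrm_eq_0 [simp]: "nrm x = 0 \<longleftrightarrow> x = 0"
  by (simp add: nrm_norm)

lemma nrm_pos [simp]: "0 < nrm x \<longleftrightarrow> x \<noteq> 0"
  by (simp add: nrm_norm)

lemma nrm_add_le: "nrm (x + y) \<le> 2 * nrm x + 2 * nrm y"
proof -
  have "nrm (x + y) + nrm (x - y) = 2 * nrm x + 2 * nrm y"
    by (simp add: nrm_eq power2_eq_square algebra_simps)
  then show ?thesis using nrm_nonneg[of "x - y"] by linarith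
qed

lemma nrm_diff_le: "nrm (x - y) \<le> 2 * nrm x + 2 * nrm y"
  using nrm_add_le[of x "- y"] by simp

lemma qm_conj: "x \<cdot> quat_conj x = nrm x *\<^sub>R q1" "quat_conj x \<cdot> x = nrm x *\<^sub>R q1"
  by (simp_all add: nrm_eq q_eq_iff qm_nth power2_eq_square algebra_simps)

lemma norm_qm: "norm (x \<cdot> y) = norm x * norm y"
  using nrm_qm[of x y] by (simp add: nrm_norm flip: power_mult_distrib)

lemma qm_eq_0_iff [simp]: "x \<cdot> y = 0 \<longleftrightarrow> x = 0 \<or> y = 0"
  using norm_qm[of x y] by (metis mult_eq_0_iff norm_eq_zero)

lemma qinv_right: "x \<noteq> 0 \<Longrightarrow> x \<cdot> qinv x = q1"
  and qinv_left: "x \<noteq> 0 \<Longrightarrow> qinv x \<cdot> x = q1"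
  by (simp_all add: qinv_def qm_conj)

lemma qinv_right': "x \<noteq> 0 \<Longrightarrow> x \<cdot> (qinv x \<cdot> y) = y"
  and qinv_left': "x \<noteq> 0 \<Longrightarrow> qinv x \<cdot> (x \<cdot> y) = y"
  by (simp_all flip: qm_assoc add: qinv_right qinv_left)

lemma qinv_eq_0_iff [simp]: "qinv x = 0 \<longleftrightarrow> x = 0"
  by (metis qinv_def qinv_right nrm_one nrm_zero qm_zero_right zero_neq_one scaleR_zero_left div_by_0)

lemma q1_neq_0 [simp]: "q1 \<noteq> 0"
  by (simp add: q_eq_iff)

lemma qinv_one [simp]: "qinv q1 = q1"
  using qinv_right[of q1] by simp

lemma qm_right_cancel: "y \<noteq> 0 \<Longrightarrow> x \<cdot> y = x' \<cdot> y \<longleftrightarrow> x = x'"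
  by (metis qinv_right qm_assoc qm_one_right)

lemma qinv_qm: "qinv (x \<cdot> y) = qinv y \<cdot> qinv x"
  by (simp add: qinv_def nrm_qm quat_conj_qm)

lemma bounded_bilinear_qm: "bounded_bilinear (quat_mult (- 1) (- 1) :: real^4 \<Rightarrow> real^4 \<Rightarrow> real^4)"
  by unfold_locales (auto simp: qm_add_left qm_add_right norm_qm intro!: exI[of _ 1])

lemmas continuous_on_qm [continuous_intros] = bounded_bilinear.continuous_on[OF bounded_bilinear_qm]

lemma Ham_simps [simp]:
  "carrier Ham = UNIV" "(x \<otimes>\<^bsub>Ham\<^esub> y) = (x \<cdot> y)" "(x \<oplus>\<^bsub>Ham\<^esub> y) = (x + y)" "\<zero>\<^bsub>Ham\<^esub> = 0"
  "\<one>\<^bsub>Ham\<^esub> = q1"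
  by (simp_all add: quat_alg_def)

lemma Ham_a_inv [simp]: "\<ominus>\<^bsub>Ham\<^esub> x = - x"
proof -
  interpret ring Ham by (rule ring_quat_alg)
  have "x \<oplus>\<^bsub>Ham\<^esub> (- x) = \<zero>\<^bsub>Ham\<^esub>" by simp
  then show ?thesis using minus_equality[of "- x" x] by (simp del: minus_equality add: add.commute)
qed

lemma Ham_inv [simp]: "x \<noteq> 0 \<Longrightarrow> inv\<^bsub>Ham\<^esub> x = qinv x"
proof -
  interpret ring Ham by (rule ring_quat_alg)
  assume "x \<noteq> 0"
  then show ?thesis using inv_char[of x "qinv x"] by (simp add: qinv_left qinv_right)
qed

section \<open>The group over the Hamilton quaternions and its action on upper half-space\<close>

abbreviation SLH :: "(real^4) mat2 set" where "SLH \<equiv> SL_sigma Ham ddag"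

abbreviation mm :: "(real^4) mat2 \<Rightarrow> (real^4) mat2 \<Rightarrow> (real^4) mat2" where
  "mm \<equiv> mat2_mult Ham"

lemma SLH_iff:
  "Mat2 a b c d \<in> SLH \<longleftrightarrow>
     a \<cdot> ddag d - b \<cdot> ddag c = q1 \<and> b \<cdot> ddag a = a \<cdot> ddag b \<and>
     c \<cdot> ddag d = d \<cdot> ddag c \<and> d \<cdot> ddag a - c \<cdot> ddag b = q1 \<and>
     ddag d \<cdot> a - ddag b \<cdot> c = q1 \<and> ddag d \<cdot> b = ddag b \<cdot> d \<and>
     ddag a \<cdot> c = ddag c \<cdot> a \<and> ddag a \<cdot> d - ddag c \<cdot> b = q1"
  by (simp only: SL_sigma_def mem_Collect_eq mat2.set hat.simps mat2_mult.simps mat2_one_def Ham_simps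
      Ham_a_inv mat2.inject qm_minus_left qm_minus_right uminus_add_conv_diff add_uminus_conv_diff
      right_minus_eq subset_UNIV simp_thms conj_assoc)

lemma mm_assoc: "mm (mm L M) N = mm L (mm M N)"
  by (cases L; cases M; cases N) (simp add: qm_simps algebra_simps)

lemma mm_one [simp]: "mm (mat2_one Ham) M = M" "mm M (mat2_one Ham) = M"
  by (cases M; simp add: mat2_one_def)+

lemma hat_mm: "hat Ham ddag (mm M N) = mm (hat Ham ddag N) (hat Ham ddag M)"
  by (cases M; cases N) (simp add: ddag_simps algebra_simps)

lemma SLH_mult: "M \<in> SLH \<Longrightarrow> N \<in> SLH \<Longrightarrow> mm M N \<in> SLH"
proof -
  assume M: "M \<in> SLH" and N: "N \<in> SLH"
  have "mm (mm M N) (hat Ham ddag (mm M N)) = mm M (mm (mm N (hat Ham ddag N)) (hat Ham ddag M))"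
    "mm (hat Ham ddag (mm M N)) (mm M N) = mm (hat Ham ddag N) (mm (mm (hat Ham ddag M) M) N)"
    by (simp_all only: hat_mm mm_assoc)
  with M N show ?thesis by (simp add: SL_sigma_def)
qed

lemma hat_hat [simp]: "hat Ham ddag (hat Ham ddag M) = M"
  by (cases M) (simp add: ddag_minus)

lemma SLH_hat: "M \<in> SLH \<Longrightarrow> hat Ham ddag M \<in> SLH"
  by (simp add: SL_sigma_def)

lemma SLH_shift: "x$4 = 0 \<Longrightarrow> Mat2 q1 x 0 q1 \<in> SLH"
  by (simp add: SLH_iff ddag_fixed_iff flip: ddag_fixed_iff)

definition hor :: "real^4 \<Rightarrow> real^4" where "hor z = vector [z$1, z$2, z$3, 0]"

lemma hor_nth [simp]: "hor z $ 1 = z$1" "hor z $ 2 = z$2" "hor z $ 3 = z$3" "hor z $ 4 = 0"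
  by (simp_all add: hor_def)

text \<open>Invariance of the skew-Hermitian form, evaluated on the columns (w, 1) and (z, 1). The
  case w = z gives both the nonvanishing of the denominator and the height formula.\<close>

lemma SLH_cocycle:
  assumes "Mat2 a b c d \<in> SLH"
  shows "ddag (c \<cdot> w + d) \<cdot> (a \<cdot> z + b) - ddag (a \<cdot> w + b) \<cdot> (c \<cdot> z + d) = z - ddag w"
proof -
  have 1: "ddag d \<cdot> a = q1 + ddag b \<cdot> c" "ddag d \<cdot> b = ddag b \<cdot> d" "ddag a \<cdot> c = ddag c \<cdot> a"
    "ddag a \<cdot> d = q1 + ddag c \<cdot> b"
    using assms by (simp_all add: SLH_iff algebra_simps)
  have "ddag (c \<cdot> w + d) \<cdot> (a \<cdot> z + b) - ddag (a \<cdot> w + b) \<cdot> (c \<cdot> z + d) =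
      ddag w \<cdot> (ddag c \<cdot> a) \<cdot> z + ddag w \<cdot> (ddag c \<cdot> b) + (ddag d \<cdot> a) \<cdot> z + ddag d \<cdot> b
      - ddag w \<cdot> (ddag a \<cdot> c) \<cdot> z - ddag w \<cdot> (ddag a \<cdot> d) - (ddag b \<cdot> c) \<cdot> z - ddag b \<cdot> d"
    by (simp add: qm_simps ddag_simps)
  also have "\<dots> = z - ddag w" unfolding 1 by (simp add: qm_simps)
  finally show ?thesis .
qed

lemma SLH_denom_nonzero:
  assumes "Mat2 a b c d \<in> SLH" "z \<in> H4"
  shows "c \<cdot> z + d \<noteq> 0"
proof
  assume "c \<cdot> z + d = 0"
  with SLH_cocycle[OF assms(1), of z z] have "(z - ddag z) $ 4 = 0" by simp
  then show False using assms(2) by (simp add: H4_def)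
qed

lemma moebius_eq: "c \<cdot> z + d \<noteq> 0 \<Longrightarrow> moebius (Mat2 a b c d) z = (a \<cdot> z + b) \<cdot> qinv (c \<cdot> z + d)"
  by simp

declare moebius.simps [simp del]

lemma moebius_mult_denom:
  "c \<cdot> z + d \<noteq> 0 \<Longrightarrow> moebius (Mat2 a b c d) z \<cdot> (c \<cdot> z + d) = a \<cdot> z + b"
  by (simp add: moebius_eq qm_assoc qinv_left)

lemma ddag_qk_qm: "(ddag x \<cdot> (y \<cdot> x)) $ 4 = nrm x * y $ 4"
  by (simp add: nrm_eq qm_nth power2_eq_square algebra_simps)

lemma moebius_height:
  assumes "Mat2 a b c d \<in> SLH" "c \<cdot> z + d \<noteq> 0"
  shows "moebius (Mat2 a b c d) z $ 4 = z $ 4 / nrm (c \<cdot> z + d)"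
proof -
  let ?w = "moebius (Mat2 a b c d) z" and ?y = "c \<cdot> z + d"
  have "ddag ?y \<cdot> ?w \<cdot> ?y - ddag (?w \<cdot> ?y) \<cdot> ?y = z - ddag z"
    using SLH_cocycle[OF assms(1), of z z] assms(2) by (simp add: moebius_mult_denom qm_assoc)
  then have "(ddag ?y \<cdot> (?w \<cdot> ?y) - ddag ?y \<cdot> (ddag ?w \<cdot> ?y)) $ 4 = (z - ddag z) $ 4"
    by (simp add: ddag_qm qm_assoc)
  then have "nrm ?y * ?w $ 4 = z $ 4"
    by (simp add: ddag_qk_qm)
  with assms(2) show ?thesis by (simp add: field_simps)
qed

lemma moebius_H4: "Mat2 a b c d \<in> SLH \<Longrightarrow> z \<in> H4 \<Longrightarrow> moebius (Mat2 a b c d) z \<in> H4"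
  using moebius_height[of a b c d z] SLH_denom_nonzero[of a b c d z] by (simp add: H4_def)

text \<open>The two terms on the right come from the components orthogonal and parallel to \<open>c k\<close>.\<close>

lemma nrm_row:
  assumes "c \<cdot> ddag d = d \<cdot> ddag c"
  shows "nrm (c \<cdot> z + d) = nrm (c \<cdot> hor z + d) + (z$4)\<^sup>2 * nrm c"
proof -
  have "ddag (d \<cdot> ddag c) = d \<cdot> ddag c" using assms by (simp add: ddag_qm)
  then have "(d \<cdot> ddag c) $ 4 = 0" by (simp add: ddag_fixed_iff)
  moreover have "nrm (c \<cdot> z + d) =
      nrm (c \<cdot> hor z + d) + (z$4)\<^sup>2 * nrm c + 2 * z$4 * (d \<cdot> ddag c) $ 4"
    by (simp add: nrm_eq qm_nth power2_eq_square algebra_simps)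
  ultimately show ?thesis by simp
qed

text \<open>With n = nrm (c z + d) this is n nrm (w - Mz) - nrm (w - z): the comparison of distances
  with its denominators cleared.\<close>

definition gdist :: "real^4 \<Rightarrow> (real^4) mat2 \<Rightarrow> real^4 \<Rightarrow> real" where
  "gdist z M w = (case M of Mat2 a b c d \<Rightarrow>
     nrm (w \<cdot> (c \<cdot> z + d) - (a \<cdot> z + b)) - nrm (w - z))"

lemma hyp_dist_le_iff:
  assumes "w \<in> H4" "z \<in> H4" "z' \<in> H4"
  shows "hyp_dist w z \<le> hyp_dist w z' \<longleftrightarrow> nrm (w - z) / z$4 \<le> nrm (w - z') / z'$4"
proof -
  have *: "hyp_dist w y = arcosh (1 + nrm (w - y) / y$4 / (2 * w$4))"
    "0 \<le> nrm (w - y) / y$4 / (2 * w$4)" if "y \<in> H4" for y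
    using that assms(1) by (auto simp: hyp_dist_def H4_def field_simps)
  have mono: "arcosh (1 + u) \<le> arcosh (1 + v) \<longleftrightarrow> u \<le> v" if "0 \<le> u" "0 \<le> v" for u v :: real
    using arcosh_less_iff_real[of "1 + v" "1 + u"] that by linarith
  have "0 < 2 * w$4" using assms(1) by (simp add: H4_def)
  then show ?thesis
    unfolding *(1)[OF assms(2)] *(1)[OF assms(3)] mono[OF *(2)[OF assms(2)] *(2)[OF assms(3)]]
    by (simp only: divide_le_cancel) auto
qed

lemma hyp_dist_moebius_le_iff:
  assumes "M \<in> SLH" "w \<in> H4" "z \<in> H4"
  shows "hyp_dist w z \<le> hyp_dist w (moebius M z) \<longleftrightarrow> 0 \<le> gdist z M w"
proof -
  obtain a b c d where M: "M = Mat2 a b c d" by (cases M)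
  let ?y = "c \<cdot> z + d"
  have y: "?y \<noteq> 0" using SLH_denom_nonzero assms M by blast
  have "w \<cdot> ?y - (a \<cdot> z + b) = (w - moebius M z) \<cdot> ?y"
    unfolding M using moebius_mult_denom[OF y] by (simp only: qm_diff_left)
  then have "gdist z M w = nrm (w - moebius M z) * nrm ?y - nrm (w - z)"
    by (simp add: gdist_def M nrm_qm)
  moreover have "moebius M z $ 4 = z$4 / nrm ?y" using moebius_height assms(1) y M by blast
  moreover have "moebius M z \<in> H4" using moebius_H4 assms M by blast
  moreover have "0 < z$4" using assms(3) by (simp add: H4_def)
  ultimately show ?thesis using assms y
    by (simp add: hyp_dist_le_iff divide_le_cancel)
qed

lemma nrm_convex_combination:
  "nrm ((1 - t) *\<^sub>R u + t *\<^sub>R v - q) =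
     (1 - t) * nrm (u - q) + t * nrm (v - q) - t * (1 - t) * nrm (u - v)"
  by (simp add: nrm_eq power2_eq_square algebra_simps)

text \<open>The square terms of \<open>gdist\<close> add up to (n - 1) nrm w, so it is convex in w
  once n is at least 1. This is why the centre is later taken at height at least 1.\<close>

lemma gdist_segment:
  assumes "M = Mat2 a b c d" "1 \<le> nrm (c \<cdot> z + d)" "gdist z M u < 0" "gdist z M v < 0"
    and t: "0 \<le> t" "t \<le> 1"
  shows "gdist z M ((1 - t) *\<^sub>R u + t *\<^sub>R v) < 0"
proof -
  let ?y = "c \<cdot> z + d" and ?q = "(a \<cdot> z + b) \<cdot> qinv (c \<cdot> z + d)"
  have y: "?y \<noteq> 0" using assms(2) by (metis nrm_zero not_one_le_zero)
  have g: "gdist z M w = nrm ?y * nrm (w - ?q) - nrm (w - z)" for w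
  proof -
    have "w \<cdot> ?y - (a \<cdot> z + b) = (w - ?q) \<cdot> ?y" using y
      by (simp add: qm_diff_left qm_assoc qinv_left)
    then show ?thesis by (simp add: gdist_def assms(1) nrm_qm)
  qed
  have "gdist z M ((1 - t) *\<^sub>R u + t *\<^sub>R v) =
      (1 - t) * gdist z M u + t * gdist z M v - t * (1 - t) * (nrm ?y - 1) * nrm (u - v)"
    unfolding g nrm_convex_combination by (simp add: algebra_simps)
  also have "\<dots> \<le> (1 - t) * gdist z M u + t * gdist z M v"
    using t assms(2) by simp
  also have "\<dots> < 0"
  proof (cases "t = 0")
    case False
    then have "t * gdist z M v < 0" using t assms(4) by (simp add: mult_pos_neg)
    moreover have "(1 - t) * gdist z M u \<le> 0" using t assms(3) by (simp add: mult_nonneg_nonpos)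
    ultimately show ?thesis by linarith
  qed (use assms in simp)
  finally show ?thesis .
qed

subsection \<open>The action on the boundary\<close>

text \<open>Homogeneous coordinates up to right multiplication. They spare case distinctions at
  infinity when maps are composed.\<close>

definition proj_point :: "real^4 \<Rightarrow> real^4 \<Rightarrow> (real^4) option" where
  "proj_point x y = (if y = 0 then None else Some (x \<cdot> qinv y))"

lemma proj_point_scale: "s \<noteq> 0 \<Longrightarrow> proj_point (x \<cdot> s) (y \<cdot> s) = proj_point x y"
  by (simp add: proj_point_def qinv_qm qm_assoc qinv_right')

lemma moebius_bdry_None [simp]: "moebius_bdry (Mat2 a b c d) None = proj_point a c"
  by (simp add: proj_point_def)

lemma moebius_bdry_Some [simp]:
  "moebius_bdry (Mat2 a b c d) (Some z) = proj_point (a \<cdot> z + b) (c \<cdot> z + d)"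
  by (simp add: proj_point_def moebius_eq)

declare moebius_bdry.simps [simp del]

lemma moebius_bdry_proj_point:
  assumes "x \<noteq> 0 \<or> y \<noteq> 0"
  shows "moebius_bdry (Mat2 a b c d) (proj_point x y) = proj_point (a \<cdot> x + b \<cdot> y) (c \<cdot> x + d \<cdot> y)"
proof (cases "y = 0")
  case True
  then have "proj_point (a \<cdot> x + b \<cdot> y) (c \<cdot> x + d \<cdot> y) = proj_point (a \<cdot> x) (c \<cdot> x)" by simp
  also have "\<dots> = proj_point a c" using proj_point_scale[of x a c] assms True by simp
  finally show ?thesis using True by (simp add: proj_point_def[of x 0])
next
  case False
  have "proj_point (a \<cdot> (x \<cdot> qinv y) + b) (c \<cdot> (x \<cdot> qinv y) + d) =
      proj_point ((a \<cdot> (x \<cdot> qinv y) + b) \<cdot> y) ((c \<cdot> (x \<cdot> qinv y) + d) \<cdot> y)"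
    using proj_point_scale[OF False] by simp
  also have "\<dots> = proj_point (a \<cdot> x + b \<cdot> y) (c \<cdot> x + d \<cdot> y)"
    using False by (simp add: qm_simps qinv_left)
  finally show ?thesis using False by (simp add: proj_point_def[of x y])
qed

lemma SLH_column_nonzero:
  assumes "Mat2 a b c d \<in> SLH" "x \<noteq> 0 \<or> y \<noteq> 0"
  shows "a \<cdot> x + b \<cdot> y \<noteq> 0 \<or> c \<cdot> x + d \<cdot> y \<noteq> 0"
proof (rule ccontr)
  assume "\<not> ?thesis"
  then have 0: "a \<cdot> x + b \<cdot> y = 0" "c \<cdot> x + d \<cdot> y = 0" by auto
  \<comment> \<open>The rows of the inverse matrix, applied to the image column, recover
    \<open>x\<close> and \<open>y\<close>.\<close>
  have "ddag d \<cdot> (a \<cdot> x + b \<cdot> y) - ddag b \<cdot> (c \<cdot> x + d \<cdot> y) =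
      (ddag d \<cdot> a - ddag b \<cdot> c) \<cdot> x + (ddag d \<cdot> b - ddag b \<cdot> d) \<cdot> y"
    "ddag a \<cdot> (c \<cdot> x + d \<cdot> y) - ddag c \<cdot> (a \<cdot> x + b \<cdot> y) =
      (ddag a \<cdot> c - ddag c \<cdot> a) \<cdot> x + (ddag a \<cdot> d - ddag c \<cdot> b) \<cdot> y"
    by (simp_all add: qm_simps)
  then show False using 0 assms by (simp add: SLH_iff)
qed

lemma moebius_bdry_mm:
  assumes "N \<in> SLH"
  shows "moebius_bdry (mm M N) p = moebius_bdry M (moebius_bdry N p)"
proof -
  obtain a b c d a' b' c' d' where MN: "M = Mat2 a b c d" "N = Mat2 a' b' c' d'"
    by (cases M; cases N)
  obtain x y where p: "p = proj_point x y" "x \<noteq> 0 \<or> y \<noteq> 0"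
  proof (cases p)
    case None
    then show thesis using that[of q1 0] by (simp add: proj_point_def)
  next
    case (Some z)
    then show thesis using that[of z q1] by (simp add: proj_point_def)
  qed
  have nz: "a' \<cdot> x + b' \<cdot> y \<noteq> 0 \<or> c' \<cdot> x + d' \<cdot> y \<noteq> 0"
    using SLH_column_nonzero assms p(2) MN by blast
  then show ?thesis unfolding p(1) MN
    by (simp add: moebius_bdry_proj_point[OF p(2)] moebius_bdry_proj_point[OF nz])
      (simp add: qm_simps algebra_simps)
qed

section \<open>Euclidean orders in the Hamilton quaternions\<close>

lemma floor_eq_nrm_less_1:
  fixes x y :: "real^4"
  assumes "\<And>i. \<lfloor>2 * x$i\<rfloor> = \<lfloor>2 * y$i\<rfloor>"
  shows "nrm (x - y) < 1"
proof -
  have *: "((x - y)$i)\<^sup>2 < 1/4" for i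
  proof -
    have "\<bar>2 * x$i - 2 * y$i\<bar> < 1" using assms[of i] by linarith
    then have "\<bar>(x - y)$i\<bar> < 1/2" unfolding vector_minus_component by linarith
    then have "\<bar>(x - y)$i\<bar>\<^sup>2 < (1/2)\<^sup>2" by (intro power_strict_mono) auto
    then show ?thesis by (simp add: power_divide)
  qed
  show ?thesis using *[of 1] *[of 2] *[of 3] *[of 4] unfolding nrm_eq by linarith
qed

text \<open>A half-open cube of side 1/2 contains at most one of the points. The explicit count
  matters: \<open>short_rows\<close> plays it off against a larger fourth power.\<close>

lemma finite_separated:
  fixes X :: "(real^4) set" and r :: nat
  assumes sep: "\<And>x y. x \<in> X \<Longrightarrow> y \<in> X \<Longrightarrow> x \<noteq> y \<Longrightarrow> 1 \<le> nrm (x - y)"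
    and bd: "\<And>x. x \<in> X \<Longrightarrow> 4 * nrm x \<le> (real r)\<^sup>2"
  shows "finite X" "card X \<le> (2 * r + 2) ^ 4"
proof -
  define h where "h x = (\<lfloor>2 * x$1\<rfloor>, \<lfloor>2 * x$2\<rfloor>, \<lfloor>2 * x$3\<rfloor>, \<lfloor>2 * x$4\<rfloor>)" for x :: "real^4"
  let ?I = "{- int r - 1..int r}"
  have inj: "inj_on h X"
  proof (rule inj_onI, rule ccontr)
    fix x y assume "x \<in> X" "y \<in> X" "h x = h y" "x \<noteq> y"
    then have "\<lfloor>2 * x$i\<rfloor> = \<lfloor>2 * y$i\<rfloor>" for i :: 4 
      using exhaust_4[of i] by (auto simp: h_def)
    with sep[OF \<open>x \<in> X\<close> \<open>y \<in> X\<close> \<open>x \<noteq> y\<close>] floor_eq_nrm_less_1[of x y] show False by simp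
  qed
  have "\<lfloor>2 * x$i\<rfloor> \<in> ?I" if "x \<in> X" for x i
  proof -
    have "(x$i)\<^sup>2 \<le> nrm x" using exhaust_4[of i] by (auto simp: nrm_eq)
    with bd[OF that] have "(2 * x$i)\<^sup>2 \<le> (real r)\<^sup>2" by (simp add: power_mult_distrib)
    then have "\<bar>2 * x$i\<bar> \<le> real r" by (metis abs_le_square_iff abs_of_nat)
    then show ?thesis by (auto simp: le_floor_iff floor_le_iff)
  qed
  then have sub: "h ` X \<subseteq> ?I \<times> ?I \<times> ?I \<times> ?I" by (auto simp: h_def)
  have fin: "finite (?I \<times> ?I \<times> ?I \<times> ?I)" by simp
  then show "finite X" using sub inj finite_subset finite_imageD by blast
  have "card X = card (h ` X)" using inj by (simp add: card_image)
  also have "\<dots> \<le> card (?I \<times> ?I \<times> ?I \<times> ?I)" using card_mono[OF fin sub] .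
  also have "\<dots> = (2 * r + 2) ^ 4"
  proof -
    have "card ?I = 2 * r + 2" by simp
    then show ?thesis by (simp only: card_cartesian_product) (simp add: power4_eq_xxxx)
  qed
  finally show "card X \<le> (2 * r + 2) ^ 4" .
qed

lemma finite_uniform_bound:
  assumes "finite A" "\<And>x. x \<in> A \<Longrightarrow> \<exists>b::real. P x b"
    and mono: "\<And>x b c. P x b \<Longrightarrow> b \<le> c \<Longrightarrow> P x c"
  shows "\<exists>b. \<forall>x\<in>A. P x b"
  using assms(1,2)
proof (induction A)
  case (insert x A)
  then obtain b where "\<forall>y\<in>A. P y b" by auto
  moreover obtain b' where "P x b'" using insert.prems by auto
  ultimately show ?case by (intro exI[of _ "max b b'"]) (auto intro: mono)
qed simp

lemma pigeonhole_card:
  assumes "finite C" "h ` A \<subseteq> C" "card C * l \<le> card A" "finite A" "0 < l" "C \<noteq> {}"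
  shows "\<exists>y\<in>C. l \<le> card {x\<in>A. h x = y}"
proof (rule ccontr)
  assume "\<not> ?thesis"
  then have *: "card {x\<in>A. h x = y} < l" if "y \<in> C" for y using that by force
  have "card A = card (\<Union>y\<in>C. {x\<in>A. h x = y})" using assms(2) by (intro arg_cong[of _ _ card]) auto
  also have "\<dots> \<le> (\<Sum>y\<in>C. card {x\<in>A. h x = y})" using assms(1) by (rule card_UN_le)
  also have "\<dots> < (\<Sum>y\<in>C. l)" using assms(1,6) * by (intro sum_strict_mono) auto
  finally show False using assms(3) by simp
qed

section \<open>The skew-Hermitian form on rows and the size of a row\<close>

definition rform :: "real^4 \<Rightarrow> real^4 \<Rightarrow> real^4 \<Rightarrow> real^4 \<Rightarrow> real^4" where
  "rform c d c' d' = c \<cdot> ddag d' - d \<cdot> ddag c'"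

text \<open>For an isotropic row and the point z above \<open>p\<close> at height \<open>t\<close>
  this is nrm (c z + d) / t, by \<open>nrm_row\<close>. For the bottom row of a group element it is
  the reciprocal height of the image of z.\<close>

definition rquad :: "real^4 \<Rightarrow> real \<Rightarrow> real^4 \<Rightarrow> real^4 \<Rightarrow> real" where
  "rquad p t c d = t * nrm c + nrm (c \<cdot> p + d) / t"

lemma isotropic_iff: "rform c d c d = 0 \<longleftrightarrow> c \<cdot> ddag d = d \<cdot> ddag c"
  by (simp add: rform_def)

text \<open>Translation by a \<open>ddag\<close>-fixed point preserves the form, so it can be
  computed from \<open>c\<close> and c p + d, the two quantities that \<open>rquad\<close>
  controls.\<close>

lemma rform_shift:
  assumes "p$4 = 0"
  shows "rform c d c' d' = c \<cdot> ddag (c' \<cdot> p + d') - (c \<cdot> p + d) \<cdot> ddag c'"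
proof -
  have "ddag p = p" using assms by (simp add: ddag_fixed_iff)
  then show ?thesis by (simp add: rform_def ddag_simps qm_simps)
qed

text \<open>In each product one factor has norm at most K / t and the other at most K t, so
  \<open>t\<close> cancels. The uniformity in \<open>p\<close> and \<open>t\<close> is what makes
  the set of Gram matrices finite.\<close>

lemma nrm_rform_le:
  assumes "p$4 = 0" "0 < t" "rquad p t c d \<le> K" "rquad p t c' d' \<le> K"
  shows "nrm (rform c d c' d') \<le> 4 * K\<^sup>2"
proof -
  have *: "nrm c \<le> K / t" "nrm (c \<cdot> p + d) \<le> K * t" if "rquad p t c d \<le> K" for c d
  proof -
    have "t * nrm c \<le> K" "nrm (c \<cdot> p + d) / t \<le> K"
      using that assms(2) unfolding rquad_def
      by (smt (verit) divide_nonneg_pos nrm_nonneg mult_nonneg_nonneg)+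
    then show "nrm c \<le> K / t" "nrm (c \<cdot> p + d) \<le> K * t" 
      using assms(2) by (simp_all add: field_simps)
  qed
  note 1 = *[OF assms(3)] and 2 = *[OF assms(4)]
  have K: "0 \<le> K / t" "0 \<le> K * t" using 1 by (meson nrm_nonneg order_trans)+
  have "nrm (rform c d c' d') \<le> 2 * (nrm c * nrm (c' \<cdot> p + d')) + 2 * (nrm (c \<cdot> p + d) * nrm c')"
    unfolding rform_shift[OF assms(1)] using nrm_diff_le by (metis nrm_ddag nrm_qm)
  also have "\<dots> \<le> 2 * (K / t * (K * t)) + 2 * (K * t * (K / t))"
    using 1 2 K by (intro add_mono mult_left_mono mult_mono) auto
  also have "\<dots> = 4 * K\<^sup>2" using assms(2) by (simp add: power2_eq_square)
  finally show ?thesis .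
qed

text \<open>By the inequality between arithmetic and geometric mean. In an order, where nonzero
  norms are at least 1, the conclusion means that the row is isotropic.\<close>

lemma rquad_small_isotropic:
  assumes "p$4 = 0" "0 < t" "rquad p t c d < 1"
  shows "nrm (rform c d c d) < 1"
proof -
  let ?x = "t * nrm c" and ?y = "nrm (c \<cdot> p + d) / t"
  have "nrm (rform c d c d) \<le> 2 * (nrm c * nrm (c \<cdot> p + d)) + 2 * (nrm (c \<cdot> p + d) * nrm c)"
    unfolding rform_shift[OF assms(1)] using nrm_diff_le by (metis nrm_ddag nrm_qm)
  also have "\<dots> = 4 * (?x * ?y)" using assms(2) by simp
  also have "\<dots> \<le> (?x + ?y)\<^sup>2" using zero_le_power2[of "?x - ?y"]
    by (simp add: power2_eq_square algebra_simps)
  also have "\<dots> < 1" using assms(2,3) abs_square_less_1[of "?x + ?y"]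
    unfolding rquad_def by (simp add: abs_of_nonneg)
  finally show ?thesis .
qed

lemma rquad_add:
  assumes "0 < t"
  shows "rquad p t (x \<cdot> c + y \<cdot> c') (x \<cdot> d + y \<cdot> d') \<le> 2 * nrm x * rquad p t c d + 2 * nrm y * rquad p t c' d'"
proof -
  have "(x \<cdot> c + y \<cdot> c') \<cdot> p + (x \<cdot> d + y \<cdot> d') = x \<cdot> (c \<cdot> p + d) + y \<cdot> (c' \<cdot> p + d')"
    by (simp add: qm_simps)
  then have "nrm ((x \<cdot> c + y \<cdot> c') \<cdot> p + (x \<cdot> d + y \<cdot> d')) \<le>
      2 * (nrm x * nrm (c \<cdot> p + d)) + 2 * (nrm y * nrm (c' \<cdot> p + d'))"
    using nrm_add_le by (metis nrm_qm)
  moreover have "nrm (x \<cdot> c + y \<cdot> c') \<le> 2 * (nrm x * nrm c) + 2 * (nrm y * nrm c')"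
    using nrm_add_le by (metis nrm_qm)
  ultimately have "t * nrm (x \<cdot> c + y \<cdot> c') + nrm ((x \<cdot> c + y \<cdot> c') \<cdot> p + (x \<cdot> d + y \<cdot> d')) / t \<le>
    t * (2 * (nrm x * nrm c) + 2 * (nrm y * nrm c')) +
    (2 * (nrm x * nrm (c \<cdot> p + d)) + 2 * (nrm y * nrm (c' \<cdot> p + d'))) / t"
    using assms by (intro add_mono mult_left_mono divide_right_mono) auto
  also have "\<dots> = 2 * nrm x * rquad p t c d + 2 * nrm y * rquad p t c' d'"
    by (simp add: rquad_def algebra_simps add_divide_distrib)
  finally show ?thesis by (simp add: rquad_def)
qed

lemma rquad_scale: "rquad p t (x \<cdot> c) (x \<cdot> d) = nrm x * rquad p t c d"
proof -
  have "x \<cdot> c \<cdot> p + x \<cdot> d = x \<cdot> (c \<cdot> p + d)" by (simp add: qm_simps)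
  then show ?thesis by (simp add: rquad_def nrm_qm algebra_simps)
qed

lemma rquad_nonneg: "0 < t \<Longrightarrow> 0 \<le> rquad p t c d"
  by (simp add: rquad_def)

text \<open>What the geometry uses of the embedded order. The spanning condition is condensed into
  two nonvanishing clauses, from which four orthogonal lattice vectors will be built, and the
  Euclidean function into a well-founded relation.\<close>

locale euclidean_order =
  fixes \<Lambda> :: "(real^4) set"
  assumes one_mem: "q1 \<in> \<Lambda>"
    and add_mem: "x \<in> \<Lambda> \<Longrightarrow> y \<in> \<Lambda> \<Longrightarrow> x + y \<in> \<Lambda>"
    and minus_mem: "x \<in> \<Lambda> \<Longrightarrow> - x \<in> \<Lambda>"
    and mult_mem: "x \<in> \<Lambda> \<Longrightarrow> y \<in> \<Lambda> \<Longrightarrow> x \<cdot> y \<in> \<Lambda>"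
    and ddag_mem: "x \<in> \<Lambda> \<Longrightarrow> ddag x \<in> \<Lambda>"
    and nrm_Ints: "x \<in> \<Lambda> \<Longrightarrow> nrm x \<in> \<int>"
    and ex_fourth: "\<exists>x\<in>\<Lambda>. x$4 \<noteq> 0"
    and ex_second_third: "\<exists>x\<in>\<Lambda>. x$2 \<noteq> 0 \<or> x$3 \<noteq> 0"
    and euclid: "\<exists>r. wf r \<and> (\<forall>a\<in>\<Lambda>. \<forall>b\<in>\<Lambda>. b \<noteq> 0 \<and> ddag (a \<cdot> ddag b) = a \<cdot> ddag b \<longrightarrow>
      (\<exists>q\<in>\<Lambda>. ddag q = q \<and> (a - b \<cdot> q, b) \<in> r))"
begin

lemma diff_mem: "x \<in> \<Lambda> \<Longrightarrow> y \<in> \<Lambda> \<Longrightarrow> x - y \<in> \<Lambda>"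
  using add_mem[of x "- y"] minus_mem[of y] by simp

lemma zero_mem: "0 \<in> \<Lambda>"
  using diff_mem[OF one_mem one_mem] by simp

lemma int_scale_mem:
  assumes "r \<in> \<int>" "x \<in> \<Lambda>" shows "r *\<^sub>R x \<in> \<Lambda>"
proof -
  have nat: "real n *\<^sub>R x \<in> \<Lambda>" for n
    by (induction n) (simp_all add: zero_mem scaleR_left_distrib add_mem assms(2))
  from assms(1) obtain m where m: "r = of_int m" by (elim Ints_cases)
  show ?thesis
  proof (cases "m \<ge> 0")
    case True then show ?thesis using nat[of "nat m"] m by simp
  next
    case False then show ?thesis using minus_mem[OF nat[of "nat (- m)"]] m by simp
  qed
qed

lemma nrm_ge_1:
  assumes "x \<in> \<Lambda>" "x \<noteq> 0" shows "1 \<le> nrm x"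
proof -
  obtain m where m: "nrm x = of_int m" using nrm_Ints[OF assms(1)] by (elim Ints_cases)
  then have "0 < m" using assms(2) nrm_pos[of x] by simp
  then show ?thesis using m by simp
qed

lemma inner_Ints:
  assumes "x \<in> \<Lambda>" "y \<in> \<Lambda>" shows "2 * inner x y \<in> \<int>"
proof -
  have "2 * inner x y = nrm (x + y) - nrm x - nrm y"
    by (simp add: nrm_inner inner_add_left inner_add_right inner_commute)
  then show ?thesis using assms by (simp add: nrm_Ints add_mem)
qed

lemma trace_Ints: "x \<in> \<Lambda> \<Longrightarrow> 2 * x$1 \<in> \<int>"
  using inner_Ints[OF _ one_mem, of x] by (simp add: inner_vec_def sum_4)

lemma conj_mem:
  assumes "x \<in> \<Lambda>" shows "quat_conj x \<in> \<Lambda>"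
proof -
  have "quat_conj x = (2 * x$1) *\<^sub>R q1 - x" by (simp add: q_eq_iff)
  then show ?thesis using assms by (simp add: diff_mem int_scale_mem trace_Ints one_mem)
qed

lemma finite_ball: "finite {x\<in>\<Lambda>. nrm x \<le> K}"
proof -
  obtain r :: nat where r: "max 1 (4 * K) \<le> real r" using real_arch_simple by blast
  then have "real r \<le> (real r)\<^sup>2" by (intro self_le_power) auto
  then have "4 * K \<le> (real r)\<^sup>2" using r by linarith
  then show ?thesis
    by (intro finite_separated(1)[of _ r]) (auto intro!: nrm_ge_1 diff_mem)
qed

lemma ex_axis: "\<exists>\<kappa>\<in>\<Lambda>. hor \<kappa> = 0 \<and> 0 < \<kappa>$4"
proof -
  obtain x where x: "x \<in> \<Lambda>" "x$4 \<noteq> 0" using ex_fourth by blast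
  define y where "y = x - ddag x"
  have y: "y \<in> \<Lambda>" "- y \<in> \<Lambda>" "hor y = 0" "hor (- y) = 0" "y$4 = 2 * x$4"
    using x by (auto simp: y_def diff_mem ddag_mem minus_mem q_eq_iff)
  show ?thesis
  proof (cases "0 < x$4")
    case True then show ?thesis using y by (intro bexI[of _ y]) auto
  next
    case False then show ?thesis using y x(2) by (intro bexI[of _ "- y"]) auto
  qed
qed

text \<open>Combining x with its conjugate and applying \<open>ddag\<close> leaves a nonzero vector
  of the i,j-plane; right multiplication by a multiple of k rotates it, up to scaling, by a right
  angle.\<close>

lemma ex_orthogonal:
  "\<exists>e2\<in>\<Lambda>. \<exists>e3\<in>\<Lambda>. e2 \<noteq> 0 \<and> e3 \<noteq> 0 \<and> e2$1 = 0 \<and> e2$4 = 0 \<and> e3$1 = 0 \<and> e3$4 = 0 \<and> inner e2 e3 = 0"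
proof -
  obtain \<kappa> where k: "\<kappa> \<in> \<Lambda>" "hor \<kappa> = 0" "0 < \<kappa>$4" using ex_axis by blast
  obtain x where x: "x \<in> \<Lambda>" "x$2 \<noteq> 0 \<or> x$3 \<noteq> 0" using ex_second_third by blast
  define e where "e = (x - quat_conj x) + ddag (x - quat_conj x)"
  have e: "e \<in> \<Lambda>" "e \<noteq> 0" "e$1 = 0" "e$4 = 0"
    using x by (auto simp: e_def diff_mem conj_mem add_mem ddag_mem q_eq_iff)
  have k': "\<kappa>$1 = 0" "\<kappa>$2 = 0" "\<kappa>$3 = 0" using k(2) by (auto simp: q_eq_iff)
  have "e \<cdot> \<kappa> \<noteq> 0" using e(2) k(3) by auto
  moreover have "(e \<cdot> \<kappa>)$1 = 0" "(e \<cdot> \<kappa>)$4 = 0" "inner e (e \<cdot> \<kappa>) = 0"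
    using e k' by (simp_all add: qm_nth inner_vec_def sum_4)
  ultimately show ?thesis using e mult_mem[OF e(1) k(1)] by blast
qed

definition G :: "(real^4) mat2 set" where "G = {M \<in> SLH. set_mat2 M \<subseteq> \<Lambda>}"

lemma G_iff: "Mat2 a b c d \<in> G \<longleftrightarrow> Mat2 a b c d \<in> SLH \<and> a \<in> \<Lambda> \<and> b \<in> \<Lambda> \<and> c \<in> \<Lambda> \<and> d \<in> \<Lambda>"
  by (auto simp: G_def)

lemma G_SLH: "M \<in> G \<Longrightarrow> M \<in> SLH"
  by (simp add: G_def)

lemma G_mult: "M \<in> G \<Longrightarrow> N \<in> G \<Longrightarrow> mm M N \<in> G"
  by (cases M; cases N) (auto simp: G_def SLH_mult[where M = "Mat2 _ _ _ _" and N = "Mat2 _ _ _ _", simplified]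
      add_mem mult_mem)

lemma G_hat: "M \<in> G \<Longrightarrow> hat Ham ddag M \<in> G"
  using SLH_hat[of M] by (cases M) (auto simp: G_def minus_mem ddag_mem)

lemma G_shift: "x \<in> \<Lambda> \<Longrightarrow> x$4 = 0 \<Longrightarrow> Mat2 q1 x 0 q1 \<in> G"
  by (simp add: G_iff SLH_shift one_mem zero_mem)

lemma G_flip: "Mat2 0 (- q1) q1 0 \<in> G"
  by (simp add: G_iff one_mem zero_mem minus_mem SLH_iff ddag_minus)

text \<open>Isotropy is exactly the hypothesis of division with remainder. As the quotient q is
  fixed by \<open>ddag\<close>, the step from (c, d) to (- d, c - d q) is right multiplication by a
  group element, composed of a translation and the flip, and keeps the row isotropic. It ends at d =
  0 with g = c.\<close>

lemma isotropic_row: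
  assumes "c \<in> \<Lambda>" "d \<in> \<Lambda>" "c \<noteq> 0 \<or> d \<noteq> 0" "c \<cdot> ddag d = d \<cdot> ddag c"
  shows "\<exists>g a' b' c' d'. g \<in> \<Lambda> \<and> g \<noteq> 0 \<and> Mat2 a' b' c' d' \<in> G \<and> c = g \<cdot> c' \<and> d = g \<cdot> d'"
proof -
  obtain r where r: "wf r" and step: "\<And>a b. a \<in> \<Lambda> \<Longrightarrow> b \<in> \<Lambda> \<Longrightarrow> b \<noteq> 0 \<Longrightarrow> ddag (a \<cdot> ddag b) = a \<cdot> ddag b \<Longrightarrow>
      \<exists>q\<in>\<Lambda>. ddag q = q \<and> (a - b \<cdot> q, b) \<in> r"
    using euclid by blast
  show ?thesis using r assms
  proof (induction d arbitrary: c rule: wf_induct_rule)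
    case (less d)
    show ?case
    proof (cases "d = 0")
      case True
      with less.prems G_flip show ?thesis
        by (intro exI[of _ c] exI[of _ 0] exI[of _ "- q1"] exI[of _ q1]) simp
    next
      case False
      have "ddag (c \<cdot> ddag d) = c \<cdot> ddag d" using less.prems(4) by (simp add: ddag_qm)
      then obtain q where q: "q \<in> \<Lambda>" "ddag q = q" "(c - d \<cdot> q, d) \<in> r"
        using step less.prems False by blast
      let ?c = "c - d \<cdot> q"
      have "\<exists>g a' b' c' d'. g \<in> \<Lambda> \<and> g \<noteq> 0 \<and> Mat2 a' b' c' d' \<in> G \<and> - d = g \<cdot> c' \<and> ?c = g \<cdot> d'"
      proof (rule less.IH[OF q(3)])
        show "- d \<cdot> ddag ?c = ?c \<cdot> ddag (- d)"
          using less.prems(4) q(2) by (simp add: ddag_simps qm_simps)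
      qed (use less.prems q False in \<open>auto simp: minus_mem diff_mem mult_mem\<close>)
      then obtain g a' b' c' d' where g: "g \<in> \<Lambda>" "g \<noteq> 0" "Mat2 a' b' c' d' \<in> G"
        "- d = g \<cdot> c'" "?c = g \<cdot> d'" by blast
      have "mm (Mat2 a' b' c' d') (mm (Mat2 q1 (- q) 0 q1) (Mat2 0 (- q1) q1 0)) \<in> G"
        using q g(3) by (intro G_mult G_shift G_flip) (auto simp: minus_mem simp flip: ddag_fixed_iff)
      then have "Mat2 (b' - a' \<cdot> q) (- a') (d' - c' \<cdot> q) (- c') \<in> G" by simp
      moreover have "d = g \<cdot> (- c')" using g(4) by (metis minus_minus qm_minus_right)
      moreover have "c = g \<cdot> (d' - c' \<cdot> q)"
        using g(4,5) by (simp add: qm_diff_right algebra_simps flip: qm_assoc g(4))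
      ultimately show ?thesis using g(1,2) by blast
    qed
  qed
qed

end

text \<open>A combination of the rows whose first entry vanishes is isotropic; if c1 = 0, the first
  row already is one.\<close>

lemma isotropic_combination:
  fixes c1 d1 c2 d2 :: "real^4"
  assumes "c1 \<noteq> 0 \<or> d1 \<noteq> 0"
  defines "y1 \<equiv> if c1 = 0 then q1 else - (c2 \<cdot> quat_conj c1)"
    and "y2 \<equiv> if c1 = 0 then 0 else nrm c1 *\<^sub>R q1"
  shows "y1 \<noteq> 0 \<or> y2 \<noteq> 0"
    "y1 \<cdot> rform c1 d1 c1 d1 \<cdot> ddag y1 + y1 \<cdot> rform c1 d1 c2 d2 \<cdot> ddag y2 +
     y2 \<cdot> rform c2 d2 c1 d1 \<cdot> ddag y1 + y2 \<cdot> rform c2 d2 c2 d2 \<cdot> ddag y2 = 0" (is "?F = 0")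
proof -
  show "y1 \<noteq> 0 \<or> y2 \<noteq> 0" by (auto simp: y1_def y2_def)
  have "y1 \<cdot> c1 + y2 \<cdot> c2 = 0"
    by (simp add: y1_def y2_def qm_assoc qm_conj)
  moreover have "?F = rform (y1 \<cdot> c1 + y2 \<cdot> c2) (y1 \<cdot> d1 + y2 \<cdot> d2) (y1 \<cdot> c1 + y2 \<cdot> c2) (y1 \<cdot> d1 + y2 \<cdot> d2)"
    by (simp add: rform_def ddag_simps qm_simps algebra_simps)
  ultimately show "?F = 0" by (simp add: rform_def)
qed

section \<open>Short isotropic rows and approximation of boundary points\<close>

context euclidean_order
begin

definition short_isotropic :: "real^4 \<Rightarrow> real \<Rightarrow> real \<Rightarrow> bool" where
  "short_isotropic p t K \<longleftrightarrow> (\<exists>c\<in>\<Lambda>. \<exists>d\<in>\<Lambda>. (c \<noteq> 0 \<or> d \<noteq> 0) \<and>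
     c \<cdot> ddag d = d \<cdot> ddag c \<and> rquad p t c d \<le> K)"

definition short_independent :: "real^4 \<Rightarrow> real \<Rightarrow> real \<Rightarrow> bool" where
  "short_independent p t K \<longleftrightarrow> (\<exists>c\<in>\<Lambda>. \<exists>d\<in>\<Lambda>. \<exists>c'\<in>\<Lambda>. \<exists>d'\<in>\<Lambda>. (c \<noteq> 0 \<or> d \<noteq> 0) \<and>
     (\<nexists>x. c' = x \<cdot> c \<and> d' = x \<cdot> d) \<and> rquad p t c d \<le> K \<and> rquad p t c' d' \<le> K)"

text \<open>Only finitely many Gram matrices of the skew-Hermitian form occur for independent pairs of
  short rows, and the coefficients of an isotropic combination depend only on the Gram matrix.\<close>

lemma short_independent_imp_isotropic:
  "\<exists>K'. \<forall>p t. p$4 = 0 \<longrightarrow> 0 < t \<longrightarrow> short_independent p t K \<longrightarrow> short_isotropic p t K'"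
proof -
  define A where "A = {x\<in>\<Lambda>. nrm x \<le> 4 * K\<^sup>2}"
  \<comment> \<open>An isotropic combination is at hand only for Gram matrices of actual rows of the
    order, so these are singled out.\<close>
  define realized where "realized f11 f12 f21 f22 \<longleftrightarrow> (\<exists>c1\<in>\<Lambda>. \<exists>d1\<in>\<Lambda>. \<exists>c2\<in>\<Lambda>. \<exists>d2\<in>\<Lambda>. (c1 \<noteq> 0 \<or> d1 \<noteq> 0) \<and>
    f11 = rform c1 d1 c1 d1 \<and> f12 = rform c1 d1 c2 d2 \<and> f21 = rform c2 d2 c1 d1 \<and> f22 = rform c2 d2 c2 d2)"
    for f11 f12 f21 f22
  define iso where "iso f11 f12 f21 f22 b \<longleftrightarrow> (\<exists>y1\<in>\<Lambda>. \<exists>y2\<in>\<Lambda>. (y1 \<noteq> 0 \<or> y2 \<noteq> 0) \<and> nrm y1 \<le> b \<and> nrm y2 \<le> b \<and>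
     y1 \<cdot> f11 \<cdot> ddag y1 + y1 \<cdot> f12 \<cdot> ddag y2 + y2 \<cdot> f21 \<cdot> ddag y1 + y2 \<cdot> f22 \<cdot> ddag y2 = 0)"
    for f11 f12 f21 f22 and b :: real
  have isomono: "iso f11 f12 f21 f22 c" if "iso f11 f12 f21 f22 b" "b \<le> c" for f11 f12 f21 f22 b c
    using that unfolding iso_def by (meson order_trans)
  have ex: "\<exists>b. iso f11 f12 f21 f22 b" if R: "realized f11 f12 f21 f22" for f11 f12 f21 f22
  proof -
    obtain c1 d1 c2 d2 where cd: "c1 \<in> \<Lambda>" "d1 \<in> \<Lambda>" "c2 \<in> \<Lambda>" "d2 \<in> \<Lambda>" "c1 \<noteq> 0 \<or> d1 \<noteq> 0"
      and f: "f11 = rform c1 d1 c1 d1" "f12 = rform c1 d1 c2 d2" "f21 = rform c2 d2 c1 d1" "f22 = rform c2 d2 c2 d2"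
      using R unfolding realized_def by blast
    let ?y1 = "if c1 = 0 then q1 else - (c2 \<cdot> quat_conj c1)"
    let ?y2 = "if c1 = 0 then 0 else nrm c1 *\<^sub>R q1"
    have "?y1 \<in> \<Lambda>" "?y2 \<in> \<Lambda>"
      using cd by (auto intro: one_mem zero_mem minus_mem mult_mem conj_mem int_scale_mem nrm_Ints)
    then show ?thesis unfolding iso_def f 
      using isotropic_combination(1)[OF cd(5), of c2] isotropic_combination(2)[OF cd(5), of c2 d2]
      by (intro exI[of _ "max (nrm ?y1) (nrm ?y2)"] bexI[of _ ?y1] bexI[of _ ?y2]) auto
  qed
  let ?S = "{(f11, f12, f21, f22). f11 \<in> A \<and> f12 \<in> A \<and> f21 \<in> A \<and> f22 \<in> A \<and> realized f11 f12 f21 f22}"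
  have "?S \<subseteq> A \<times> A \<times> A \<times> A" by auto
  moreover have "finite A" unfolding A_def by (rule finite_ball)
  ultimately have "finite ?S" by (auto intro: finite_subset)
  then have "\<exists>b. \<forall>f\<in>?S. case f of (f11, f12, f21, f22) \<Rightarrow> iso f11 f12 f21 f22 b"
  proof (rule finite_uniform_bound)
    show "\<exists>b. case f of (f11, f12, f21, f22) \<Rightarrow> iso f11 f12 f21 f22 b" if "f \<in> ?S" for f
      using that ex by auto
    show "case f of (f11, f12, f21, f22) \<Rightarrow> iso f11 f12 f21 f22 c"
      if "case f of (f11, f12, f21, f22) \<Rightarrow> iso f11 f12 f21 f22 b" "b \<le> c" for f b c
      using that isomono by (auto split: prod.splits)
  qed
  then obtain b where b: "\<And>f11 f12 f21 f22. f11 \<in> A \<Longrightarrow> f12 \<in> A \<Longrightarrow> f21 \<in> A \<Longrightarrow> f22 \<in> A \<Longrightarrow>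
      realized f11 f12 f21 f22 \<Longrightarrow> iso f11 f12 f21 f22 b" by blast
  have "short_isotropic p t (2 * b * K + 2 * b * K)"
    if pt: "p$4 = 0" "0 < t" and si: "short_independent p t K" for p t
  proof -
    obtain c1 d1 c2 d2 where cd: "c1 \<in> \<Lambda>" "d1 \<in> \<Lambda>" "c2 \<in> \<Lambda>" "d2 \<in> \<Lambda>" "c1 \<noteq> 0 \<or> d1 \<noteq> 0"
      and ind: "\<nexists>x. c2 = x \<cdot> c1 \<and> d2 = x \<cdot> d1" and Q: "rquad p t c1 d1 \<le> K" "rquad p t c2 d2 \<le> K"
      using si unfolding short_independent_def by blast
    have mem: "rform c d c' d' \<in> A" if "c \<in> \<Lambda>" "d \<in> \<Lambda>" "c' \<in> \<Lambda>" "d' \<in> \<Lambda>" "rquad p t c d \<le> K" "rquad p t c' d' \<le> K"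
      for c d c' d'
      using that nrm_rform_le[OF pt, of c d K c' d'] unfolding A_def
      by (auto simp: rform_def intro!: diff_mem mult_mem ddag_mem)
    have "iso (rform c1 d1 c1 d1) (rform c1 d1 c2 d2) (rform c2 d2 c1 d1) (rform c2 d2 c2 d2) b"
      by (rule b) (use cd Q in \<open>auto intro!: mem simp: realized_def\<close>)
    then obtain y1 y2 where y: "y1 \<in> \<Lambda>" "y2 \<in> \<Lambda>" "y1 \<noteq> 0 \<or> y2 \<noteq> 0" "nrm y1 \<le> b" "nrm y2 \<le> b"
      and 0: "y1 \<cdot> rform c1 d1 c1 d1 \<cdot> ddag y1 + y1 \<cdot> rform c1 d1 c2 d2 \<cdot> ddag y2 +
         y2 \<cdot> rform c2 d2 c1 d1 \<cdot> ddag y1 + y2 \<cdot> rform c2 d2 c2 d2 \<cdot> ddag y2 = 0"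
      unfolding iso_def by blast
    let ?c = "y1 \<cdot> c1 + y2 \<cdot> c2" and ?d = "y1 \<cdot> d1 + y2 \<cdot> d2"
    have "rform ?c ?d ?c ?d = 0"
      using 0 by (simp add: rform_def ddag_simps qm_simps algebra_simps)
    then have iso: "?c \<cdot> ddag ?d = ?d \<cdot> ddag ?c" by (simp only: isotropic_iff)
    \<comment> \<open>A vanishing combination would make the second row a multiple of the first,
      against independence.\<close>
    have nz: "?c \<noteq> 0 \<or> ?d \<noteq> 0"
    proof (rule ccontr)
      assume "\<not> ?thesis"
      then have 0: "?c = 0" "?d = 0" by auto
      show False
      proof (cases "y2 = 0")
        case True then show ?thesis using 0 y(3) cd(5) by auto
      next
        case False
        have "c2 = (- (qinv y2 \<cdot> y1)) \<cdot> c1"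
          using arg_cong[OF 0(1), of "\<lambda>x. qinv y2 \<cdot> x"] False
          by (simp add: qm_add_right qinv_left' qm_assoc eq_neg_iff_add_eq_0 add.commute)
        moreover have "d2 = (- (qinv y2 \<cdot> y1)) \<cdot> d1"
          using arg_cong[OF 0(2), of "\<lambda>x. qinv y2 \<cdot> x"] False
          by (simp add: qm_add_right qinv_left' qm_assoc eq_neg_iff_add_eq_0 add.commute)
        ultimately show ?thesis using ind by blast
      qed
    qed
    have K: "0 \<le> K" using Q(1) rquad_nonneg[OF pt(2), of p c1 d1] by linarith
    have b: "0 \<le> b" using y(4) nrm_nonneg[of y1] by linarith
    have "rquad p t ?c ?d \<le> 2 * nrm y1 * rquad p t c1 d1 + 2 * nrm y2 * rquad p t c2 d2"
      by (rule rquad_add[OF pt(2)])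
    also have "\<dots> \<le> 2 * b * K + 2 * b * K"
      using y Q K b rquad_nonneg[OF pt(2)] by (intro add_mono mult_mono) auto
    finally show ?thesis unfolding short_isotropic_def
      using cd y iso nz by (meson add_mem mult_mem)
  qed
  then show ?thesis by blast
qed

text \<open>Orthogonal vectors 1, e2, e3 and \<kappa> span a sublattice of full rank, possibly
  smaller than the order. Rounding coordinates in this basis is enough for the pigeonhole argument,
  at the price of the distortion \<open>C\<close>.\<close>

lemma ex_lattice_map:
  "\<exists>L C. linear L \<and> (\<forall>y. \<exists>x. L x = (y :: real^4)) \<and> (\<forall>x. L x = 0 \<longrightarrow> x = 0) \<and>
     (\<forall>x. (\<forall>i. x$i \<in> \<int>) \<longrightarrow> L x \<in> \<Lambda>) \<and> 1 \<le> C \<and> (\<forall>x. nrm (L x) \<le> C * nrm (x :: real^4))"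
proof -
  obtain \<kappa> where k: "\<kappa> \<in> \<Lambda>" "hor \<kappa> = 0" "0 < \<kappa>$4" using ex_axis by blast
  obtain e2 e3 where e: "e2 \<in> \<Lambda>" "e3 \<in> \<Lambda>" "e2 \<noteq> 0" "e3 \<noteq> 0" "e2$1 = 0" "e2$4 = 0" "e3$1 = 0" "e3$4 = 0"
    "inner e2 e3 = 0" using ex_orthogonal by blast
  have k': "\<kappa>$1 = 0" "\<kappa>$2 = 0" "\<kappa>$3 = 0" using k(2) by (auto simp: q_eq_iff)
  define L where "L x = x$1 *\<^sub>R q1 + x$2 *\<^sub>R e2 + x$3 *\<^sub>R e3 + x$4 *\<^sub>R \<kappa>" for x :: "real^4"
  have lin: "linear L" by (rule linearI) (simp_all add: L_def scaleR_left_distrib scaleR_right_distrib)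
  have nL: "nrm (L x) = (x$1)\<^sup>2 + (x$2)\<^sup>2 * nrm e2 + (x$3)\<^sup>2 * nrm e3 + (x$4)\<^sup>2 * nrm \<kappa>" for x
  proof -
    have i: "inner q1 q1 = 1" "inner q1 e2 = 0" "inner q1 e3 = 0" "inner q1 \<kappa> = 0" "inner e2 \<kappa> = 0" "inner e3 \<kappa> = 0"
      "inner e2 q1 = 0" "inner e3 q1 = 0" "inner \<kappa> q1 = 0" "inner \<kappa> e2 = 0" "inner \<kappa> e3 = 0"
      "inner e3 e2 = 0"
      using e k' by (simp_all add: inner_vec_def sum_4 mult.commute)
    show ?thesis unfolding L_def nrm_inner
      by (simp add: inner_add_left inner_add_right i e(9) power2_eq_square algebra_simps)
  qed
  have nz: "x = 0" if "L x = 0" for x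
  proof -
    have "(x$1)\<^sup>2 + (x$2)\<^sup>2 * nrm e2 + (x$3)\<^sup>2 * nrm e3 + (x$4)\<^sup>2 * nrm \<kappa> = 0"
      using nL[of x] that by simp
    moreover have "0 < nrm e2" "0 < nrm e3" "0 < nrm \<kappa>" using e k by auto
    ultimately have "(x$1)\<^sup>2 = 0 \<and> (x$2)\<^sup>2 * nrm e2 = 0 \<and> (x$3)\<^sup>2 * nrm e3 = 0 \<and> (x$4)\<^sup>2 * nrm \<kappa> = 0"
      by (smt (verit) mult_nonneg_nonneg zero_le_power2)
    then have "x$1 = 0" "x$2 = 0" "x$3 = 0" "x$4 = 0"
      using \<open>0 < nrm e2\<close> \<open>0 < nrm e3\<close> \<open>0 < nrm \<kappa>\<close> by auto
    then show ?thesis by (simp add: q_eq_iff)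
  qed
  have "inj L" using linear_injective_0[OF lin] nz by blast
  then have surj: "surj L" using linear_injective_imp_surjective[OF lin] by simp
  let ?C = "1 + nrm e2 + nrm e3 + nrm \<kappa>"
  have C: "nrm (L x) \<le> ?C * nrm x" for x
  proof -
    have "nrm (L x) \<le> (x$1)\<^sup>2 * ?C + (x$2)\<^sup>2 * ?C + (x$3)\<^sup>2 * ?C + (x$4)\<^sup>2 * ?C"
      unfolding nL by (intro add_mono mult_left_mono) (auto simp: mult_le_cancel_left1)
    also have "\<dots> = ?C * nrm x" by (simp add: nrm_eq algebra_simps)
    finally show ?thesis .
  qed
  have "L x \<in> \<Lambda>" if "\<forall>i. x$i \<in> \<int>" for x
    unfolding L_def using that e k by (intro add_mem int_scale_mem one_mem) auto
  moreover have "\<exists>x. L x = y" for y using surj by (metis surjD)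
  ultimately show ?thesis using lin nz C by (intro exI[of _ L] exI[of _ ?C]) auto
qed


text \<open>The pigeonhole principle puts l^4 rows, not just two, into one box. All their
  differences are short. If no two were independent, they would be multiples X of a shortest one,
  with the factors X separated by 1 and of norm at most K, since a row of size below 1 is isotropic.
  Packing allows at most (2 r + 2)^4 such factors, fewer than l^4.\<close>

lemma short_rows:
  "\<exists>K l. 0 < l \<and> (\<forall>p t. p$4 = 0 \<longrightarrow> 0 < t \<longrightarrow> l * t \<le> 1 \<longrightarrow>
     short_isotropic p t K \<or> short_independent p t K)"
proof -
  obtain L C where L: "linear L" "\<And>y. \<exists>x. L x = (y :: real^4)" "\<And>x. L x = 0 \<Longrightarrow> x = 0"
    "\<And>x. (\<And>i. x$i \<in> \<int>) \<Longrightarrow> L x \<in> \<Lambda>" and C: "1 \<le> C" "\<And>x. nrm (L x) \<le> C * nrm (x :: real^4)"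
    using ex_lattice_map by metis
  have CL: "nrm (L x) \<le> C * B" if "nrm x \<le> B" for x B
    using C(2)[of x] mult_left_mono[OF that, of C] C(1) by linarith
  obtain r :: nat where r: "max 2 (320 * C) \<le> real r" using real_arch_simple by blast
  \<comment> \<open>The conditions to meet are 2 r + 2 < l and 4 K <= r^2 with K = 20 C l. With l =
    4 r they amount to r >= 2 and r >= 320 C.\<close>
  define l where "l = 4 * r"
  define K where "K = 20 * C * real l"
  have r2: "2 \<le> r" using r by auto
  have l: "0 < l" "2 * r + 2 < l" using r2 by (auto simp: l_def)
  have K1: "1 \<le> K" using mult_mono[of 1 C 1 "real l"] C(1) l by (simp add: K_def)
  have K4: "4 * K \<le> (real r)\<^sup>2"
  proof -
    have "4 * K = 320 * C * real r" by (simp add: K_def l_def)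
    also have "\<dots> \<le> real r * real r" using r by (intro mult_right_mono) auto
    finally show ?thesis by (simp add: power2_eq_square)
  qed
  obtain L' where L': "\<And>y. L (L' y) = y" using L(2) by metis
  have "short_isotropic p t K \<or> short_independent p t K"
    if p: "p$4 = 0" and t: "0 < t" and lt: "real l * t \<le> 1" for p t
  proof (rule ccontr)
    assume "\<not> ?thesis"
    then have ni: "\<not> short_isotropic p t K" and nind: "\<not> short_independent p t K" by auto
    have big: "1 \<le> rquad p t c d" if "c \<in> \<Lambda>" "d \<in> \<Lambda>" "c \<noteq> 0 \<or> d \<noteq> 0" for c d
    proof (rule ccontr)
      assume "\<not> ?thesis"
      then have s: "rquad p t c d < 1" by simp
      have "rform c d c d \<in> \<Lambda>" using that by (simp add: rform_def diff_mem mult_mem ddag_mem)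
      with rquad_small_isotropic[OF p t s] have "rform c d c d = 0" using nrm_ge_1 by force
      then have "short_isotropic p t K" unfolding short_isotropic_def isotropic_iff
        using that s K1 by (meson less_imp_le order_trans)
      with ni show False by simp
    qed
    define s where "s = 1 / sqrt (real l * t)"
    have lt0: "0 < real l * t" using l t by simp
    \<comment> \<open>The size 1 / sqrt (l t) for \<open>q\<close> balances the two terms of
      \<open>rquad\<close>: both t n^2 and 1 / (q^2 t) become at most a multiple of l.\<close>
    have s: "1 \<le> s" "s\<^sup>2 * (real l * t) = 1"
      using lt lt0 l t by (simp_all add: s_def power_divide)
    define q where "q = nat \<lceil>s\<rceil>"
    have q: "s \<le> real q" "real q \<le> 2 * s" using s(1) unfolding q_def by linarith+
    have q0: "0 < q" using q s by (metis gr0I not_one_le_zero of_nat_0 order_trans)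
    define n where "n = q * l"
    have tn: "t * (real n)\<^sup>2 \<le> 4 * real l"
    proof -
      have "t * (real n)\<^sup>2 = (real q)\<^sup>2 * (real l * t) * real l" by (simp add: n_def power2_eq_square)
      also have "\<dots> \<le> (2 * s)\<^sup>2 * (real l * t) * real l"
        using q s lt0 by (intro mult_right_mono power_mono) auto
      also have "\<dots> = 4 * (s\<^sup>2 * (real l * t)) * real l" by (simp add: power_mult_distrib)
      finally show ?thesis using s by simp
    qed
    have tq: "1 / (real q)\<^sup>2 / t \<le> real l"
    proof -
      have "1 = s\<^sup>2 * (real l * t)" using s by simp
      also have "\<dots> \<le> (real q)\<^sup>2 * (real l * t)" using q s lt0 by (intro mult_right_mono power_mono) auto
      finally show ?thesis using t q0 by (simp add: field_simps)
    qed
    define mv :: "nat \<times> nat \<times> nat \<times> nat \<Rightarrow> real^4" where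
      "mv m = (case m of (a, b, c, d) \<Rightarrow> vector [real a, real b, real c, real d])" for m
    define c where "c m = L (mv m)" for m
    define y where "y m = L' (c m \<cdot> p)" for m
    \<comment> \<open>Subtracting the lattice point with the rounded coordinates makes c p + d the
      image under \<open>L\<close> of a vector of fractional parts.\<close>
    define fl :: "_ \<Rightarrow> real^4" where "fl m = (\<chi> i. of_int \<lfloor>y m $ i\<rfloor>)" for m
    define d where "d m = - L (fl m)" for m
    have cd: "c m \<in> \<Lambda>" "d m \<in> \<Lambda>" for m
    proof -
      have "mv m $ i \<in> \<int>" for i using exhaust_4[of i] by (auto simp: mv_def split: prod.splits)
      then show "c m \<in> \<Lambda>" unfolding c_def by (rule L(4))
      have "L (fl m) \<in> \<Lambda>" by (rule L(4)) (simp add: fl_def)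
      then show "d m \<in> \<Lambda>" unfolding d_def by (rule minus_mem)
    qed
    have beta: "c m \<cdot> p + d m = L (y m - fl m)" for m
      using L' by (simp add: d_def y_def linear_diff[OF L(1)])
    have frac: "(y m - fl m) $ i = frac (y m $ i)" for m i by (simp add: fl_def frac_def)
    have inj: "m = m'" if "c m = c m'" for m m'
    proof -
      have "L (mv m - mv m') = 0" using that by (simp add: c_def linear_diff[OF L(1)])
      then have "mv m - mv m' = 0" by (rule L(3))
      then show ?thesis by (auto simp: mv_def q_eq_iff split: prod.splits)
    qed
    let ?N = "{..<n} \<times> {..<n} \<times> {..<n} \<times> {..<n}" and ?Q = "{..<q} \<times> {..<q} \<times> {..<q} \<times> {..<q}"
    define g where "g m i = nat \<lfloor>real q * frac (y m $ i)\<rfloor>" for m i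
    define h where "h m = (g m 1, g m 2, g m 3, g m 4)" for m
    have "g m i < q" for m i
    proof -
      have "real q * frac (y m $ i) < real q * 1"
        using frac_lt_1 q0 by (intro mult_strict_left_mono) auto
      then show ?thesis using frac_ge_0[of "y m $ i"] q0 unfolding g_def
        by (simp add: nat_less_iff floor_less_iff)
    qed
    then have "h ` ?N \<subseteq> ?Q" by (auto simp: h_def)
    moreover have "card ?Q * l ^ 4 \<le> card ?N"
      by (simp add: n_def power4_eq_xxxx)
    moreover have "?Q \<noteq> {}" using q0 by auto
    ultimately obtain u where u: "l ^ 4 \<le> card {m\<in>?N. h m = u}"
      using pigeonhole_card[of ?Q h ?N "l ^ 4"] l by auto
    define T where "T = {m\<in>?N. h m = u}"
    have finT: "finite T" by (simp add: T_def)
    \<comment> \<open>The two terms contribute 16 C l and 4 C l, whence the constant 20 in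
      \<open>K\<close>.\<close>
    have QT: "rquad p t (c m - c m') (d m - d m') \<le> K" if m: "m \<in> T" "m' \<in> T" for m m'
    proof -
      have 1: "\<bar>(mv m - mv m') $ i\<bar> \<le> real n" for i
        using m exhaust_4[of i] by (auto simp: T_def mv_def)
      then have "((mv m - mv m') $ i)\<^sup>2 \<le> (real n)\<^sup>2" for i
        by (metis abs_le_square_iff abs_of_nat)
      from this[of 1] this[of 2] this[of 3] this[of 4]
      have "nrm (mv m - mv m') \<le> 4 * (real n)\<^sup>2" unfolding nrm_eq by linarith
      then have A: "nrm (c m - c m') \<le> C * (4 * (real n)\<^sup>2)"
        using CL[of "mv m - mv m'"] by (simp add: c_def linear_diff[OF L(1)])
      let ?w = "(y m - fl m) - (y m' - fl m')"
      have "\<bar>?w $ i\<bar> \<le> 1 / real q" for i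
      proof -
        have "g m i = g m' i" using m exhaust_4[of i] by (auto simp: T_def h_def)
        then have "\<lfloor>real q * frac (y m $ i)\<rfloor> = \<lfloor>real q * frac (y m' $ i)\<rfloor>"
          using q0 unfolding g_def by (subst (asm) nat_eq_iff) auto
        then have "\<bar>real q * frac (y m $ i) - real q * frac (y m' $ i)\<bar> \<le> 1" by linarith
        then have "real q * \<bar>frac (y m $ i) - frac (y m' $ i)\<bar> \<le> 1"
          by (simp add: abs_mult flip: right_diff_distrib)
        then show ?thesis using q0 frac[of m i] frac[of m' i]
          by (simp only: vector_minus_component[of "y m - fl m"]) (simp add: field_simps)
      qed
      then have "(?w $ i)\<^sup>2 \<le> (1 / real q)\<^sup>2" for i
        by (metis abs_le_square_iff abs_of_nonneg of_nat_0_le_iff zero_le_divide_1_iff)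
      from this[of 1] this[of 2] this[of 3] this[of 4]
      have "nrm ?w \<le> 4 * (1 / real q)\<^sup>2" unfolding nrm_eq by linarith
      moreover have "(c m - c m') \<cdot> p + (d m - d m') = L ?w"
        unfolding linear_diff[OF L(1), of "y m - fl m"] beta[symmetric] by (simp add: qm_diff_left)
      ultimately have B: "nrm ((c m - c m') \<cdot> p + (d m - d m')) \<le> C * (4 * (1 / (real q)\<^sup>2))"
        using CL[of ?w "4 * (1 / real q)\<^sup>2"] by (simp add: power_divide)
      have "rquad p t (c m - c m') (d m - d m') \<le> t * (C * (4 * (real n)\<^sup>2)) + C * (4 * (1 / (real q)\<^sup>2)) / t"
        unfolding rquad_def using A B t by (intro add_mono mult_left_mono divide_right_mono) auto
      also have "\<dots> = 4 * C * (t * (real n)\<^sup>2) + 4 * C * (1 / (real q)\<^sup>2 / t)" by simp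
      also have "\<dots> \<le> 4 * C * (4 * real l) + 4 * C * real l"
        using tn tq C(1) by (intro add_mono mult_left_mono) auto
      finally show ?thesis by (simp add: K_def)
    qed
    let ?D = "{(m, m'). m \<in> T \<and> m' \<in> T \<and> m \<noteq> m'}"
    let ?f = "\<lambda>(m, m'). rquad p t (c m - c m') (d m - d m')"
    have cT: "l ^ 4 \<le> card T" using u by (simp add: T_def)
    have "\<not> card T \<le> 1"
    proof
      assume "card T \<le> 1"
      with cT have "l ^ 4 \<le> 1" by simp
      moreover have "l ^ 1 \<le> l ^ 4" using l by (intro power_increasing) auto
      ultimately show False using l by simp
    qed
    then obtain m0 m0' where "m0 \<in> T" "m0' \<in> T" "m0 \<noteq> m0'"
      by (metis card_le_Suc0_iff_eq finT One_nat_def)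
    then have "(m0, m0') \<in> ?D" by blast
    then have "?D \<noteq> {}" by blast
    moreover have "finite ?D" using finite_subset[of ?D "T \<times> T"] finT by auto
    \<comment> \<open>A shortest difference. The factors X need not lie in the order; their
      separation comes from this minimality.\<close>
    ultimately obtain mm where "is_arg_min ?f (\<lambda>x. x \<in> ?D) mm"
      using ex_is_arg_min_if_finite by blast
    then obtain m1 m2 where m12: "m1 \<in> T" "m2 \<in> T" "m1 \<noteq> m2" and
      min: "\<And>m m'. m \<in> T \<Longrightarrow> m' \<in> T \<Longrightarrow> m \<noteq> m' \<Longrightarrow>
        rquad p t (c m1 - c m2) (d m1 - d m2) \<le> rquad p t (c m - c m') (d m - d m')"
      by (cases mm) (force simp: is_arg_min_linorder)
    define c1 where "c1 = c m1 - c m2"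
    define d1 where "d1 = d m1 - d m2"
    have c1: "c1 \<in> \<Lambda>" "d1 \<in> \<Lambda>" "c1 \<noteq> 0"
      using cd inj[of m1 m2] m12(3) unfolding c1_def d1_def by (simp_all only: diff_mem right_minus_eq) blast
    have "\<exists>x. c m - c m2 = x \<cdot> c1 \<and> d m - d m2 = x \<cdot> d1" if "m \<in> T" for m
    proof (rule ccontr)
      assume "\<not> ?thesis"
      then have "short_independent p t K" unfolding short_independent_def
        using c1 cd QT[OF m12(1,2)] QT[OF that m12(2)] diff_mem unfolding c1_def d1_def by meson
      with nind show False by simp
    qed
    then obtain X where X: "\<And>m. m \<in> T \<Longrightarrow> c m - c m2 = X m \<cdot> c1" "\<And>m. m \<in> T \<Longrightarrow> d m - d m2 = X m \<cdot> d1"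
      by metis
    have X2: "rquad p t (c m - c m') (d m - d m') = nrm (X m - X m') * rquad p t c1 d1"
      if "m \<in> T" "m' \<in> T" for m m'
    proof -
      have "c m - c m' = (X m - X m') \<cdot> c1" "d m - d m' = (X m - X m') \<cdot> d1"
        using X[OF that(1)] X[OF that(2)] by (simp_all add: qm_diff_left algebra_simps)
      then show ?thesis by (simp add: rquad_scale)
    qed
    have Q1: "1 \<le> rquad p t c1 d1" using big c1 by blast
    have sep: "1 \<le> nrm (X m - X m')" if "m \<in> T" "m' \<in> T" "m \<noteq> m'" for m m'
      using min[OF that] X2[OF that(1,2)] Q1 unfolding c1_def[symmetric] d1_def[symmetric]
      by (metis mult_le_cancel_right1 not_one_le_zero less_le_not_le zero_less_one order_less_le_trans)
    have "inj_on X T"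
      using sep by (metis diff_self inj_onI nrm_zero not_one_le_zero)
    then have "card T = card (X ` T)" by (simp add: card_image)
    also have "\<dots> \<le> (2 * r + 2) ^ 4"
    proof (rule finite_separated(2))
      show "1 \<le> nrm (x - y)" if "x \<in> X ` T" "y \<in> X ` T" "x \<noteq> y" for x y
        using that sep by (metis imageE)
      show "4 * nrm x \<le> (real r)\<^sup>2" if "x \<in> X ` T" for x
      proof -
        obtain m where m: "m \<in> T" "x = X m" using \<open>x \<in> X ` T\<close> by auto
        have "X m2 \<cdot> c1 = 0" using X(1)[OF m12(2)] by simp
        then have "X m2 = 0" using c1(3) by simp
        then have "nrm x * rquad p t c1 d1 \<le> K"
          using X2[OF m(1) m12(2)] QT[OF m(1) m12(2)] m(2) by simp
        moreover have "nrm x * 1 \<le> nrm x * rquad p t c1 d1" using Q1 by (intro mult_left_mono) auto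
        ultimately show ?thesis using K4 by linarith
      qed
    qed
    also have "\<dots> < l ^ 4" using l by (intro power_strict_mono) auto
    finally show False using cT by simp
  qed
  then show ?thesis using l by (intro exI[of _ K] exI[of _ "real l"]) auto
qed

text \<open>A short isotropic row at height t has nrm (c p + d) at most t B, and t is free.
  Splitting off the common left factor, of norm at least 1, can only decrease it.\<close>

lemma approximation:
  assumes p: "p$4 = 0" and \<delta>: "0 < \<delta>"
  shows "\<exists>a b c d. Mat2 a b c d \<in> G \<and> nrm (c \<cdot> p + d) < \<delta>"
proof -
  obtain K l where l: "0 < l" and 1: "\<And>p t. p$4 = 0 \<Longrightarrow> 0 < t \<Longrightarrow> l * t \<le> 1 \<Longrightarrow>
     short_isotropic p t K \<or> short_independent p t K"
    using short_rows by metis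
  obtain K' where 2: "\<And>p t. p$4 = 0 \<Longrightarrow> 0 < t \<Longrightarrow> short_independent p t K \<Longrightarrow> short_isotropic p t K'"
    using short_independent_imp_isotropic by metis
  define B where "B = \<bar>K\<bar> + \<bar>K'\<bar> + 1"
  define t where "t = min (1 / l) (\<delta> / (2 * B))"
  have t: "0 < t" "l * t \<le> 1" "t * B < \<delta>"
  proof -
    have B: "0 < B" by (simp add: B_def)
    show "0 < t" using l \<delta> B by (simp add: t_def)
    have "l * t \<le> l * (1 / l)" using l by (intro mult_left_mono) (auto simp: t_def)
    then show "l * t \<le> 1" using l by simp
    have "t * B \<le> \<delta> / (2 * B) * B" using B by (intro mult_right_mono) (auto simp: t_def)
    then show "t * B < \<delta>" using B \<delta> by simp
  qed
  obtain c d where cd: "c \<in> \<Lambda>" "d \<in> \<Lambda>" "c \<noteq> 0 \<or> d \<noteq> 0" "c \<cdot> ddag d = d \<cdot> ddag c" "rquad p t c d \<le> B"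
    using 1[OF p t(1,2)] 2[OF p t(1)] unfolding short_isotropic_def B_def
    by (smt (verit) abs_ge_zero abs_ge_self)
  have "nrm (c \<cdot> p + d) / t \<le> B"
    using cd(5) t(1) unfolding rquad_def by (smt (verit) nrm_nonneg mult_nonneg_nonneg)
  then have "nrm (c \<cdot> p + d) < \<delta>" using t(1,3) by (simp add: field_simps)
  moreover obtain g a' b' c' d' where g: "g \<in> \<Lambda>" "g \<noteq> 0" "Mat2 a' b' c' d' \<in> G" "c = g \<cdot> c'" "d = g \<cdot> d'"
    using isotropic_row[OF cd(1-4)] by blast
  moreover have "nrm (c' \<cdot> p + d') \<le> nrm (c \<cdot> p + d)"
  proof -
    have "c \<cdot> p + d = g \<cdot> (c' \<cdot> p + d')" by (simp add: g qm_simps)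
    then have "nrm (c \<cdot> p + d) = nrm g * nrm (c' \<cdot> p + d')" by (simp add: nrm_qm)
    then show ?thesis using nrm_ge_1[OF g(1,2)] mult_right_mono[of 1 "nrm g" "nrm (c' \<cdot> p + d')"] by simp
  qed
  ultimately show ?thesis by fastforce
qed


subsection \<open>The cusps\<close>

text \<open>If \<open>u \<alpha>' - \<alpha> u = c\<close> has a solution \<open>u\<close>, it has one with \<open>ddag u = u\<close>, and then
  \<open>p + u\<^sup>-\<^sup>1\<close> is a second fixed point. Hence \<open>u \<mapsto> u \<alpha>' - \<alpha> u\<close> is not surjective for a
  parabolic element.\<close>

lemma parabolic_not_in_range:
  assumes "Mat2 \<alpha>' 0 c \<alpha> \<in> SLH" "c \<noteq> 0"
    and uniq: "\<And>x. x$4 = 0 \<Longrightarrow> c \<cdot> x + \<alpha> \<noteq> 0 \<Longrightarrow> \<alpha>' \<cdot> x = x \<cdot> (c \<cdot> x + \<alpha>) \<Longrightarrow> x = 0"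
  shows "u \<cdot> \<alpha>' - \<alpha> \<cdot> u \<noteq> c"
proof
  assume u: "u \<cdot> \<alpha>' - \<alpha> \<cdot> u = c"
  have r: "\<alpha>' \<cdot> ddag \<alpha> = q1" "c \<cdot> ddag \<alpha> = \<alpha> \<cdot> ddag c" "\<alpha> \<cdot> ddag \<alpha>' = q1" "ddag \<alpha> \<cdot> \<alpha>' = q1"
    "ddag \<alpha>' \<cdot> \<alpha> = q1"
    using assms(1) by (simp_all add: SLH_iff)
  \<comment> \<open>Applying \<open>ddag\<close> and multiplying by \<alpha> and \<alpha>' turns the
    equation into the same equation for \<open>ddag u\<close>, so that \<open>u\<close> may be
    averaged with \<open>ddag u\<close>.\<close>
  have "ddag c = ddag \<alpha>' \<cdot> ddag u - ddag u \<cdot> ddag \<alpha>"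
    using u by (auto simp: ddag_simps)
  then have "\<alpha> \<cdot> ddag c \<cdot> \<alpha>' = (\<alpha> \<cdot> ddag \<alpha>') \<cdot> ddag u \<cdot> \<alpha>' - \<alpha> \<cdot> ddag u \<cdot> (ddag \<alpha> \<cdot> \<alpha>')"
    by (simp add: qm_simps)
  moreover have "\<alpha> \<cdot> ddag c \<cdot> \<alpha>' = c" using r(2,4) by (metis qm_assoc qm_one_right)
  ultimately have u': "ddag u \<cdot> \<alpha>' - \<alpha> \<cdot> ddag u = c" using r by simp
  define v where "v = (1/2) *\<^sub>R (u + ddag u)"
  have "v \<cdot> \<alpha>' - \<alpha> \<cdot> v = (1/2) *\<^sub>R ((u \<cdot> \<alpha>' - \<alpha> \<cdot> u) + (ddag u \<cdot> \<alpha>' - \<alpha> \<cdot> ddag u))"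
    by (simp add: v_def qm_simps algebra_simps)
  also have "\<dots> = c" unfolding u u' by (simp flip: scaleR_2)
  finally have v: "v \<cdot> \<alpha>' = c + \<alpha> \<cdot> v" by (simp add: algebra_simps)
  have v4: "v$4 = 0" by (simp add: v_def)
  have v0: "v \<noteq> 0" using v assms(2) by auto
  define x where "x = qinv v"
  have x: "v \<cdot> x = q1" "x \<cdot> v = q1" using v0 by (simp_all add: x_def qinv_left qinv_right)
  have "(v \<cdot> \<alpha>') \<cdot> x = c \<cdot> x + \<alpha>" unfolding v by (simp add: qm_simps x)
  then have w: "c \<cdot> x + \<alpha> = v \<cdot> \<alpha>' \<cdot> x" by simp
  have "x = 0"
  proof (rule uniq)
    show "x$4 = 0" using v4 by (simp add: x_def qinv_def)
    have "\<alpha>' \<noteq> 0" using r(1) by auto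
    then show "c \<cdot> x + \<alpha> \<noteq> 0" unfolding w using v0 x(1) by auto
    show "\<alpha>' \<cdot> x = x \<cdot> (c \<cdot> x + \<alpha>)" unfolding w using x(2) by (metis qm_assoc qm_one_left)
  qed
  then show False using x by simp
qed

lemma quaternion_quadratic: "x \<cdot> x - (2 * x$1) *\<^sub>R x + nrm x *\<^sub>R q1 = 0"
  by (simp add: q_eq_iff qm_nth nrm_eq power2_eq_square algebra_simps)

text \<open>Moving the fixed point to 0 makes the matrix lower triangular with diagonal \<alpha>',
  \<alpha>. Uniqueness of the fixed point forbids solving u \<alpha>' - \<alpha> u = c. This forces
  nrm \<alpha> = 1, so that twice the quadratic equation of \<alpha> has integral coefficients.
  Rewriting \<alpha> \<alpha> by the fixed point equation makes it linear in z over the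
  order.\<close>

lemma parabolic_fixed_point:
  assumes M: "M \<in> G" "parabolic M" and p: "p \<in> bdry" "moebius_bdry M p = p"
  shows "\<exists>N\<in>G. moebius_bdry N p = None"
proof (cases p)
  case None
  have "Mat2 q1 q1 0 q1 \<in> G" by (simp add: G_shift one_mem)
  then show ?thesis using None by (intro bexI[of _ "Mat2 q1 q1 0 q1"]) (simp_all add: proj_point_def)
next
  case (Some z)
  obtain a b c d where Md: "M = Mat2 a b c d" by (cases M)
  have z4: "z$4 = 0" using p(1) Some by (auto simp: bdry_def)
  have uniq: "q = p" if "q \<in> bdry" "moebius_bdry M q = q" for q
    using M(2) p that unfolding parabolic_def by blast
  have mem: "a \<in> \<Lambda>" "b \<in> \<Lambda>" "c \<in> \<Lambda>" "d \<in> \<Lambda>" using M(1) by (simp_all add: Md G_iff)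
  have fixed: "c \<cdot> z + d \<noteq> 0" "a \<cdot> z + b = z \<cdot> (c \<cdot> z + d)"
  proof -
    have *: "proj_point (a \<cdot> z + b) (c \<cdot> z + d) = Some z" using p(2) by (simp add: Md Some)
    then show nz: "c \<cdot> z + d \<noteq> 0" by (auto simp: proj_point_def)
    with * have "(a \<cdot> z + b) \<cdot> qinv (c \<cdot> z + d) = z" by (simp add: proj_point_def)
    then show "a \<cdot> z + b = z \<cdot> (c \<cdot> z + d)"
      using nz by (metis qm_assoc qinv_left qm_one_right)
  qed
  have c0: "c \<noteq> 0"
  proof
    assume "c = 0"
    then have "moebius_bdry M None = None" by (simp add: Md proj_point_def)
    then show False using uniq[of None] Some by (auto simp: bdry_def)
  qed
  define \<alpha> where "\<alpha> = c \<cdot> z + d"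
  define \<alpha>' where "\<alpha>' = a - z \<cdot> c"
  have "mm (Mat2 q1 (- z) 0 q1) (mm M (Mat2 q1 z 0 q1)) \<in> SLH"
    using z4 M(1) by (intro SLH_mult SLH_shift) (auto simp: G_SLH)
  moreover have "mm (Mat2 q1 (- z) 0 q1) (mm M (Mat2 q1 z 0 q1)) = Mat2 \<alpha>' 0 c \<alpha>"
    using fixed(2) by (simp add: Md \<alpha>_def \<alpha>'_def)
  ultimately have conj: "Mat2 \<alpha>' 0 c \<alpha> \<in> SLH" by simp
  have notin: "u \<cdot> \<alpha>' - \<alpha> \<cdot> u \<noteq> c" for u
  proof (rule parabolic_not_in_range[OF conj c0])
    fix x assume x: "x$4 = 0" "c \<cdot> x + \<alpha> \<noteq> 0" "\<alpha>' \<cdot> x = x \<cdot> (c \<cdot> x + \<alpha>)"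
    have 1: "c \<cdot> (z + x) + d = c \<cdot> x + \<alpha>" by (simp add: \<alpha>_def qm_simps algebra_simps)
    have "a \<cdot> (z + x) + b = \<alpha>' \<cdot> x + z \<cdot> (c \<cdot> x) + (a \<cdot> z + b)"
      by (simp add: \<alpha>'_def qm_simps algebra_simps)
    also have "\<dots> = (z + x) \<cdot> (c \<cdot> x + \<alpha>)"
      unfolding x(3) fixed(2) by (simp add: \<alpha>_def qm_simps algebra_simps)
    finally have "moebius_bdry M (Some (z + x)) = Some (z + x)"
      using x(2) by (simp add: Md 1 proj_point_def qm_assoc qinv_right)
    then show "x = 0" using uniq[of "Some (z + x)"] Some x(1) z4 by (auto simp: bdry_def)
  qed
  have r: "\<alpha>' \<cdot> ddag \<alpha> = q1" using conj by (simp add: SLH_iff)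
  then have nn: "nrm \<alpha>' * nrm \<alpha> = 1" by (metis nrm_ddag nrm_one nrm_qm)
  \<comment> \<open>With different norms the linear map from u to u \<alpha>' - \<alpha> u is
    injective, hence surjective, and would reach c.\<close>
  have "nrm \<alpha>' = nrm \<alpha>"
  proof (rule ccontr)
    assume ne: "nrm \<alpha>' \<noteq> nrm \<alpha>"
    let ?T = "\<lambda>u. u \<cdot> \<alpha>' - \<alpha> \<cdot> u"
    have lin: "linear ?T" by (rule linearI) (simp_all add: qm_simps algebra_simps)
    have "u = 0" if "?T u = 0" for u
    proof -
      have "nrm (u \<cdot> \<alpha>') = nrm (\<alpha> \<cdot> u)" using that by simp
      then have "nrm u * (nrm \<alpha>' - nrm \<alpha>) = 0" by (simp add: nrm_qm algebra_simps)
      then show ?thesis using ne by simp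
    qed
    then have "inj ?T" using linear_injective_0[OF lin] by blast
    then have "surj ?T" using linear_injective_imp_surjective[OF lin] by simp
    from surjD[OF this, of c] obtain u where "c = ?T u" by blast
    then show False using notin[of u] by simp
  qed
  then have na: "nrm \<alpha> = 1" "nrm \<alpha>' = 1"
    using nn nrm_nonneg[of \<alpha>] by (auto simp: power2_eq_1_iff simp flip: power2_eq_square)
  have "\<alpha>' = quat_conj (ddag \<alpha>)"
  proof -
    have "\<alpha>' \<cdot> ddag \<alpha> = quat_conj (ddag \<alpha>) \<cdot> ddag \<alpha>" using r na by (simp add: qm_conj)
    moreover have "ddag \<alpha> \<noteq> 0" using r by auto
    ultimately show ?thesis using qm_right_cancel by blast
  qed
  then have re: "\<alpha>'$1 = \<alpha>$1" by simp
  \<comment> \<open>The trace of \<alpha> equals a$1 + d$1, in general only half an integer;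
    therefore the quadratic equation is doubled.\<close>
  define s where "s = 4 * \<alpha>$1"
  have tr: "\<alpha>'$1 + \<alpha>$1 = a$1 + d$1" by (simp add: \<alpha>'_def \<alpha>_def qm_nth)
  then have s: "s = 2 * a$1 + 2 * d$1" using re by (simp add: s_def)
  have sI: "s \<in> \<int>" unfolding s using trace_Ints mem by auto
  define n1 where "n1 = 2 *\<^sub>R (c \<cdot> a + d \<cdot> c) - s *\<^sub>R c"
  define n2 where "n2 = 2 *\<^sub>R (c \<cdot> b + d \<cdot> d) - s *\<^sub>R d + 2 *\<^sub>R q1"
  have nmem: "n1 \<in> \<Lambda>" "n2 \<in> \<Lambda>"
    unfolding n1_def n2_def using mem sI
    by (auto intro!: diff_mem add_mem mult_mem int_scale_mem one_mem)
  have rel: "n1 \<cdot> z + n2 = 0"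
  proof -
    have "n1 \<cdot> z + n2 = 2 *\<^sub>R (c \<cdot> (a \<cdot> z + b) + d \<cdot> (c \<cdot> z + d)) - s *\<^sub>R (c \<cdot> z + d) + 2 *\<^sub>R q1"
      by (simp add: n1_def n2_def qm_simps algebra_simps)
    also have "\<dots> = 2 *\<^sub>R ((c \<cdot> z + d) \<cdot> \<alpha>) - s *\<^sub>R \<alpha> + 2 *\<^sub>R q1"
      unfolding fixed(2) by (simp add: \<alpha>_def qm_simps)
    also have "\<dots> = 2 *\<^sub>R (\<alpha> \<cdot> \<alpha> - (2 * \<alpha>$1) *\<^sub>R \<alpha> + nrm \<alpha> *\<^sub>R q1)"
      using na by (simp add: \<alpha>_def s_def algebra_simps)
    also have "\<dots> = 0" unfolding quaternion_quadratic by simp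
    finally show ?thesis .
  qed
  have "\<exists>m1\<in>\<Lambda>. \<exists>m2\<in>\<Lambda>. m1 \<noteq> 0 \<and> m1 \<cdot> z + m2 = 0"
  proof (cases "n1 = 0")
    case False then show ?thesis using nmem rel by blast
  next
    \<comment> \<open>If the coefficient of z vanishes, c \<alpha>' + \<alpha> c is a real multiple
      of c, and dividing c by \<beta>, twice the pure part of \<alpha>', would solve the forbidden
      equation. So \<beta> = 0, \<alpha> is 1 or -1, and c z + (d - \<alpha>) = 0 is a relation over
      the order.\<close>
    case True
    have "2 *\<^sub>R (c \<cdot> \<alpha>' + \<alpha> \<cdot> c) - s *\<^sub>R c = n1"
      by (simp add: n1_def \<alpha>_def \<alpha>'_def qm_simps algebra_simps)
    then have "2 *\<^sub>R (c \<cdot> \<alpha>' + \<alpha> \<cdot> c - (2 * \<alpha>'$1) *\<^sub>R c) = 0"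
      using True re by (simp add: s_def scaleR_diff_right)
    then have "c \<cdot> \<alpha>' + \<alpha> \<cdot> c - (2 * \<alpha>'$1) *\<^sub>R c = 0" by simp
    then have eq: "\<alpha> \<cdot> c = (2 * \<alpha>'$1) *\<^sub>R c - c \<cdot> \<alpha>'" by (simp add: algebra_simps)
    define \<beta> where "\<beta> = \<alpha>' - quat_conj \<alpha>'"
    show ?thesis
    proof (cases "\<beta> = 0")
      case False
      have "\<alpha>' \<cdot> qinv \<beta> = qinv \<beta> \<cdot> \<alpha>'"
        by (simp add: qinv_def \<beta>_def q_eq_iff qm_nth algebra_simps)
      have "c \<cdot> qinv \<beta> \<cdot> \<alpha>' - \<alpha> \<cdot> (c \<cdot> qinv \<beta>) = c \<cdot> (\<alpha>' \<cdot> qinv \<beta>) - \<alpha> \<cdot> c \<cdot> qinv \<beta>"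
        using \<open>\<alpha>' \<cdot> qinv \<beta> = qinv \<beta> \<cdot> \<alpha>'\<close> by (simp add: qm_assoc)
      also have "\<dots> = c \<cdot> ((\<alpha>' + \<alpha>' - (2 * \<alpha>'$1) *\<^sub>R q1) \<cdot> qinv \<beta>)"
        unfolding eq by (simp only: qm_simps qm_scaleR_left qm_scaleR_right qm_one_left diff_diff_eq2)
      also have "\<alpha>' + \<alpha>' - (2 * \<alpha>'$1) *\<^sub>R q1 = \<beta>" by (simp add: \<beta>_def q_eq_iff)
      finally have "c \<cdot> qinv \<beta> \<cdot> \<alpha>' - \<alpha> \<cdot> (c \<cdot> qinv \<beta>) = c" using False by (simp add: qinv_right)
      then show ?thesis using notin by blast
    next
      case True
      then have "\<alpha>' = \<alpha>'$1 *\<^sub>R q1" by (simp add: \<beta>_def q_eq_iff)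
      then have "\<alpha>' = \<alpha>$1 *\<^sub>R q1" using re by simp
      moreover from this have "(\<alpha>$1)\<^sup>2 = 1" using na(2) by (simp add: nrm_scaleR)
      then have "\<alpha>$1 \<in> \<int>" by (auto simp: power2_eq_1_iff)
      moreover have "\<alpha> = quat_conj (ddag \<alpha>')" unfolding \<open>\<alpha>' = quat_conj (ddag \<alpha>)\<close> by (simp add: q_eq_iff)
      ultimately have "\<alpha> = \<alpha>$1 *\<^sub>R q1" "\<alpha>$1 *\<^sub>R q1 \<in> \<Lambda>"
        by (auto simp: q_eq_iff intro: int_scale_mem one_mem)
      then have "\<alpha> \<in> \<Lambda>" by metis
      moreover have "c \<cdot> z + (d - \<alpha>) = 0" by (simp add: \<alpha>_def)
      ultimately show ?thesis using c0 mem diff_mem by blast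
    qed
  qed
  then obtain m1 m2 where m: "m1 \<in> \<Lambda>" "m2 \<in> \<Lambda>" "m1 \<noteq> 0" "m1 \<cdot> z + m2 = 0" by blast
  have m2: "m2 = - (m1 \<cdot> z)" using m(4) by (simp add: eq_neg_iff_add_eq_0 add.commute)
  have "ddag z = z" using z4 by (simp add: ddag_fixed_iff)
  then have "m1 \<cdot> ddag m2 = m2 \<cdot> ddag m1" by (simp add: m2 ddag_simps qm_assoc)
  then obtain g a' b' c' d' where g: "g \<noteq> 0" "Mat2 a' b' c' d' \<in> G" "m1 = g \<cdot> c'" "m2 = g \<cdot> d'"
    using isotropic_row[OF m(1,2)] m(3) by blast
  have "g \<cdot> (c' \<cdot> z + d') = 0" using m(4) g by (simp add: qm_simps)
  then have "moebius_bdry (Mat2 a' b' c' d') p = None" using g(1) by (simp add: Some proj_point_def)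
  then show ?thesis using g(2) by blast
qed

lemma card_cusps: "card (cusps G) = 1"
proof -
  let ?orb = "\<lambda>p. (\<lambda>M. moebius_bdry M p) ` G"
  have one: "moebius_bdry (mat2_one Ham) p = p" for p
    by (cases p) (simp_all add: mat2_one_def proj_point_def)
  have "None \<in> cusp_points G"
  proof -
    let ?T = "Mat2 q1 q1 0 q1"
    have "parabolic ?T"
    proof -
      have "moebius ?T z \<noteq> z" for z by (simp add: moebius_eq)
      moreover have "q = None" if "moebius_bdry ?T q = q" for q
        using that by (cases q) (auto simp: proj_point_def)
      moreover have "None \<in> bdry" "moebius_bdry ?T None = None" by (simp_all add: bdry_def proj_point_def)
      ultimately show ?thesis unfolding parabolic_def by blast
    qed
    moreover have "?T \<in> G" by (simp add: G_shift one_mem)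
    ultimately show ?thesis by (auto simp: cusp_points_def bdry_def proj_point_def intro!: bexI[of _ ?T])
  qed
  moreover have "?orb p = ?orb None" if p: "p \<in> cusp_points G" for p
  proof -
    obtain N where N: "N \<in> G" "moebius_bdry N p = None"
      using p parabolic_fixed_point unfolding cusp_points_def by blast
    have inv: "mm (hat Ham ddag N) N = mat2_one Ham" using N(1) by (auto simp: G_def SL_sigma_def)
    have "moebius_bdry (mm (hat Ham ddag N) N) p = moebius_bdry (hat Ham ddag N) None"
      using moebius_bdry_mm[of N "hat Ham ddag N" p] N G_SLH by simp
    then have p: "p = moebius_bdry (hat Ham ddag N) None" by (simp add: inv one)
    have "moebius_bdry M p = moebius_bdry (mm M (hat Ham ddag N)) None" for M
      unfolding p using moebius_bdry_mm SLH_hat[OF G_SLH[OF N(1)]] by simp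
    moreover have "moebius_bdry M None = moebius_bdry (mm M N) p" for M
      using moebius_bdry_mm[OF G_SLH[OF N(1)]] N(2) by simp
    ultimately show ?thesis using N(1) by (auto intro!: image_eqI G_mult G_hat)
  qed
  ultimately have "cusps G = {?orb None}" unfolding cusps_def by blast
  then show ?thesis by simp
qed

end

section \<open>Dirichlet domains\<close>

text \<open>The third member of the triple is 1: the three form an orthogonal basis of the boundary
  3-space.\<close>

definition orthogonal_triple :: "real^4 \<Rightarrow> real^4 \<Rightarrow> bool" where
  "orthogonal_triple e2 e3 \<longleftrightarrow> e2 \<noteq> 0 \<and> e3 \<noteq> 0 \<and> e2$4 = 0 \<and> e3$4 = 0 \<and>
     inner q1 e2 = 0 \<and> inner q1 e3 = 0 \<and> inner e2 e3 = 0"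

lemma inner_q1 [simp]: "inner q1 x = x$1" "inner x q1 = x$1"
  by (simp_all add: inner_vec_def sum_4)

lemma orthogonal_triple_coords:
  assumes "orthogonal_triple e2 e3" "x$4 = 0"
  shows "x = x$1 *\<^sub>R q1 + (inner x e2 / nrm e2) *\<^sub>R e2 + (inner x e3 / nrm e3) *\<^sub>R e3"
proof -
  define a b c d where "a = e2$2" "b = e2$3" "c = e3$2" "d = e3$3"
  note ab = this
  have e: "e2$1 = 0" "e2$4 = 0" "e3$1 = 0" "e3$4 = 0" "a * c + b * d = 0"
    using assms(1) by (auto simp: orthogonal_triple_def ab inner_vec_def sum_4)
  have n: "nrm e2 = a\<^sup>2 + b\<^sup>2" "nrm e3 = c\<^sup>2 + d\<^sup>2" by (simp_all add: nrm_eq e ab)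
  have i: "inner x e2 = x$2 * a + x$3 * b" "inner x e3 = x$2 * c + x$3 * d"
    by (simp_all add: inner_vec_def sum_4 e ab)
  have pos: "0 < a\<^sup>2 + b\<^sup>2" "0 < c\<^sup>2 + d\<^sup>2"
    using assms(1) nrm_pos[of e2] nrm_pos[of e3] unfolding n by (simp_all add: orthogonal_triple_def)
  \<comment> \<open>In the i,j-plane e3 is orthogonal to e2 = (a, b), hence \<mu> times (- b,
    a).\<close>
  define \<mu> where "\<mu> = (a * d - b * c) / (a\<^sup>2 + b\<^sup>2)"
  have cd: "c = - (\<mu> * b)" "d = \<mu> * a"
  proof -
    have ac: "a * c = - (b * d)" and bd: "b * d = - (a * c)" using e(5) by auto
    have "c * (a\<^sup>2 + b\<^sup>2) = a * (a * c) + b\<^sup>2 * c" by (simp add: power2_eq_square algebra_simps)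
    also have "\<dots> = - ((a * d - b * c) * b)" unfolding ac by (simp add: power2_eq_square algebra_simps)
    finally have 1: "c * (a\<^sup>2 + b\<^sup>2) = - ((a * d - b * c) * b)" .
    have "d * (a\<^sup>2 + b\<^sup>2) = b * (b * d) + a\<^sup>2 * d" by (simp add: power2_eq_square algebra_simps)
    also have "\<dots> = (a * d - b * c) * a" unfolding bd by (simp add: power2_eq_square algebra_simps)
    finally have 2: "d * (a\<^sup>2 + b\<^sup>2) = (a * d - b * c) * a" .
    have S: "a\<^sup>2 + b\<^sup>2 \<noteq> 0" using pos(1) by linarith
    have "c = - ((a * d - b * c) * b) / (a\<^sup>2 + b\<^sup>2)" "d = (a * d - b * c) * a / (a\<^sup>2 + b\<^sup>2)"
      using 1 2 nonzero_eq_divide_eq[OF S] by blast+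
    then show "c = - (\<mu> * b)" "d = \<mu> * a" unfolding \<mu>_def by simp_all
  qed
  have mu: "\<mu> \<noteq> 0" using pos(2) cd by auto
  have n3: "c\<^sup>2 + d\<^sup>2 = \<mu>\<^sup>2 * (a\<^sup>2 + b\<^sup>2)" by (simp add: cd power_mult_distrib algebra_simps)
  have q: "(x$2 * c + x$3 * d) / (c\<^sup>2 + d\<^sup>2) = (x$3 * a - x$2 * b) / (\<mu> * (a\<^sup>2 + b\<^sup>2))"
  proof -
    have "x$2 * c + x$3 * d = \<mu> * (x$3 * a - x$2 * b)" by (simp add: cd algebra_simps)
    then show ?thesis using mu unfolding n3 by (simp add: power2_eq_square[of \<mu>])
  qed
  have "x$2 = (x$2 * a + x$3 * b) / (a\<^sup>2 + b\<^sup>2) * a + (x$3 * a - x$2 * b) / (\<mu> * (a\<^sup>2 + b\<^sup>2)) * c"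
    "x$3 = (x$2 * a + x$3 * b) / (a\<^sup>2 + b\<^sup>2) * b + (x$3 * a - x$2 * b) / (\<mu> * (a\<^sup>2 + b\<^sup>2)) * d"
    using pos(1) mu unfolding cd by (simp_all add: divide_simps) (auto simp: power2_eq_square algebra_simps)
  then show ?thesis unfolding n i q using assms(2) e by (simp add: q_eq_iff flip: ab)
qed

lemma orthogonal_triple_nrm:
  assumes "orthogonal_triple e2 e3"
  shows "nrm (y1 *\<^sub>R q1 + y2 *\<^sub>R e2 + y3 *\<^sub>R e3) = y1\<^sup>2 + y2\<^sup>2 * nrm e2 + y3\<^sup>2 * nrm e3"
proof -
  have "inner q1 e2 = 0" "inner q1 e3 = 0" "inner e2 e3 = 0" "inner e2 q1 = 0" "inner e3 q1 = 0" "inner e3 e2 = 0"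
    using assms inner_commute[of e2 q1] inner_commute[of e3 q1] inner_commute[of e3 e2]
    by (simp_all only: orthogonal_triple_def)
  moreover have "inner q1 q1 = 1" by simp
  ultimately show ?thesis unfolding nrm_inner
    by (simp only: inner_add_left inner_add_right inner_scaleR_left inner_scaleR_right)
      (simp add: power2_eq_square algebra_simps)
qed

text \<open>The bound is the squared half diagonal of the box with edges 1, e2, e3. It recurs as the
  constant C below.\<close>

lemma nrm_small_coords:
  assumes "orthogonal_triple e2 e3" "\<bar>y1\<bar> \<le> 1/2" "\<bar>y2\<bar> \<le> 1/2" "\<bar>y3\<bar> \<le> 1/2"
  shows "nrm (y1 *\<^sub>R q1 + y2 *\<^sub>R e2 + y3 *\<^sub>R e3) \<le> (1 + nrm e2 + nrm e3) / 4"
proof -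
  have sq: "y\<^sup>2 \<le> 1/4" if "\<bar>y\<bar> \<le> 1/2" for y :: real
    using that abs_le_square_iff[of y "1/2"] by (simp add: power_divide)
  have "y1\<^sup>2 + y2\<^sup>2 * nrm e2 + y3\<^sup>2 * nrm e3 \<le> 1/4 + 1/4 * nrm e2 + 1/4 * nrm e3"
    using assms sq by (intro add_mono mult_right_mono) auto
  then show ?thesis unfolding orthogonal_triple_nrm[OF assms(1)] by simp
qed

text \<open>Coordinates centred at \<open>hor z\<close>. The vertical unit is z - ddag z, that is 2
  z$4 k, because k itself need not come from the rational algebra. The boundary is s = 0, and s =
  1/2 is the height of \<open>z\<close>.\<close>

definition box_point :: "real^4 \<Rightarrow> real^4 \<Rightarrow> real^4 \<Rightarrow> real \<Rightarrow> real \<Rightarrow> real \<Rightarrow> real \<Rightarrow> real^4" where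
  "box_point z e2 e3 y1 y2 y3 s = hor z + y1 *\<^sub>R q1 + y2 *\<^sub>R e2 + y3 *\<^sub>R e3 + s *\<^sub>R (z - ddag z)"

lemma box_point_segment:
  assumes "M = Mat2 a b c d" "1 \<le> nrm (c \<cdot> z + d)" "lo < hi" "lo \<le> y" "y \<le> hi"
    "\<And>r t. P ((1 - t) * r + t * r') = (1 - t) *\<^sub>R P r + t *\<^sub>R P r'"
    "\<And>r r' t. P ((1 - t) * r + t * r') = (1 - t) *\<^sub>R P r + t *\<^sub>R P r'"
    "gdist z M (P lo) < 0" "gdist z M (P hi) < 0"
  shows "gdist z M (P y) < 0"
proof -
  define t where "t = (y - lo) / (hi - lo)"
  have t: "0 \<le> t" "t \<le> 1"
    using assms(3-5) by (simp_all add: t_def field_simps)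
  have "t * (hi - lo) = y - lo" using assms(3) by (simp add: t_def)
  then have t3: "(1 - t) * lo + t * hi = y" by (simp add: algebra_simps)
  show ?thesis using gdist_segment[OF assms(1,2,8,9) t(1,2)] assms(7)[of t lo hi] t3 by simp
qed

text \<open>Negativity spreads from the 16 corners by convexity along segments, one coordinate at a
  time.\<close>

lemma gdist_box:
  assumes M: "M = Mat2 a b c d" "1 \<le> nrm (c \<cdot> z + d)"
    and lh: "lo1 < hi1" "lo2 < hi2" "lo3 < hi3" "los < his"
    and y: "lo1 \<le> y1" "y1 \<le> hi1" "lo2 \<le> y2" "y2 \<le> hi2" "lo3 \<le> y3" "y3 \<le> hi3" "los \<le> s" "s \<le> his"
    and corner: "\<And>u1 u2 u3 u4. u1 \<in> {lo1, hi1} \<Longrightarrow> u2 \<in> {lo2, hi2} \<Longrightarrow> u3 \<in> {lo3, hi3} \<Longrightarrow> u4 \<in> {los, his} \<Longrightarrow>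
      gdist z M (box_point z e2 e3 u1 u2 u3 u4) < 0"
  shows "gdist z M (box_point z e2 e3 y1 y2 y3 s) < 0"
proof -
  let ?b = "box_point z e2 e3"
  have seg: "gdist z M (P y) < 0"
    if "lo < hi" "lo \<le> y" "y \<le> hi" "gdist z M (P lo) < 0" "gdist z M (P hi) < 0"
      "\<And>r r' t. P ((1 - t) * r + t * r') = (1 - t) *\<^sub>R P r + t *\<^sub>R P r'" for P :: "real \<Rightarrow> real^4" and lo hi y
    by (rule box_point_segment[OF M that(1-3) that(6) that(6) that(4,5)])
  have aff: "?b ((1 - t) * r + t * r') u2 u3 u4 = (1 - t) *\<^sub>R ?b r u2 u3 u4 + t *\<^sub>R ?b r' u2 u3 u4"
    "?b u1 ((1 - t) * r + t * r') u3 u4 = (1 - t) *\<^sub>R ?b u1 r u3 u4 + t *\<^sub>R ?b u1 r' u3 u4"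
    "?b u1 u2 ((1 - t) * r + t * r') u4 = (1 - t) *\<^sub>R ?b u1 u2 r u4 + t *\<^sub>R ?b u1 u2 r' u4"
    "?b u1 u2 u3 ((1 - t) * r + t * r') = (1 - t) *\<^sub>R ?b u1 u2 u3 r + t *\<^sub>R ?b u1 u2 u3 r'"
    for t r r' u1 u2 u3 u4
    by (simp_all add: box_point_def q_eq_iff algebra_simps)
  have 1: "gdist z M (?b y1 u2 u3 u4) < 0" if "u2 \<in> {lo2, hi2}" "u3 \<in> {lo3, hi3}" "u4 \<in> {los, his}" for u2 u3 u4
    by (rule seg[of lo1 hi1, OF lh(1) y(1,2) _ _ aff(1)]) (use corner that in auto)
  have 2: "gdist z M (?b y1 y2 u3 u4) < 0" if "u3 \<in> {lo3, hi3}" "u4 \<in> {los, his}" for u3 u4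
    by (rule seg[of lo2 hi2, OF lh(2) y(3,4) _ _ aff(2)]) (use 1 that in auto)
  have 3: "gdist z M (?b y1 y2 y3 u4) < 0" if "u4 \<in> {los, his}" for u4
    by (rule seg[of lo3 hi3, OF lh(3) y(5,6) _ _ aff(3)]) (use 2 that in auto)
  show ?thesis
    by (rule seg[of los his, OF lh(4) y(7,8) _ _ aff(4)]) (use 3 in auto)
qed

lemma nrm_hor: "nrm x = nrm (hor x) + (x$4)\<^sup>2"
  by (simp add: nrm_eq)

lemma hor_diff: "hor (x - y) = hor x - hor y"
  by (simp add: q_eq_iff)

lemma gdist_translation: "gdist z (Mat2 q1 e 0 q1) w = nrm e - 2 * inner (w - z) e"
  by (simp add: gdist_def nrm_eq inner_vec_def sum_4 power2_eq_square algebra_simps)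

text \<open>For a translation \<open>gdist\<close> is affine in w, so opposite translations cut out
  a slab one period wide.\<close>

lemma translation_slab:
  assumes "0 \<le> gdist z (Mat2 q1 e 0 q1) w" "0 \<le> gdist z (Mat2 q1 (- e) 0 q1) w" "e \<noteq> 0"
  shows "\<bar>inner (w - z) e / nrm e\<bar> \<le> 1 / 2"
proof -
  have "\<bar>2 * inner (w - z) e\<bar> \<le> nrm e"
    using assms(1,2) unfolding gdist_translation by simp
  then show ?thesis using assms(3) by (simp add: field_simps)
qed

text \<open>Collected from \<open>entries_bounded\<close>: 1 + N^2 (C + 1) / 4 bounds n = nrm (c z +
  d), the long factor bounds the norms of c z + d and a z + b, and 2 (1 + X) passes to single
  entries. The type is general because the bound is evaluated over the rationals and used over the
  reals.\<close>

definition entry_bound :: "'a::field_char_0 \<Rightarrow> 'a \<Rightarrow> 'a \<Rightarrow> 'a \<Rightarrow> 'a" where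
  "entry_bound X Z2 C N =
     2 * (1 + X) * ((1 + N\<^sup>2 * (C + 1) / 4) * (1 + 3 * (C + X)) + 3 * C + 4 * Z2)"

section \<open>Bounds for the group elements that can cut the domain\<close>

context euclidean_order
begin

text \<open>Nonzero entries have norm at least 1, and by \<open>nrm_row\<close> the height of z only
  enlarges the contribution of \<open>c\<close>. So no image of z is higher than z.\<close>

lemma denom_ge_1:
  assumes "Mat2 a b c d \<in> G" "1 \<le> z$4"
  shows "1 \<le> nrm (c \<cdot> z + d)" "nrm c \<le> nrm (c \<cdot> z + d)"
proof -
  have SL: "Mat2 a b c d \<in> SLH" and mem: "c \<in> \<Lambda>" "d \<in> \<Lambda>" using assms(1) by (simp_all add: G_iff)
  have "c \<cdot> ddag d = d \<cdot> ddag c" using SL by (simp add: SLH_iff)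
  then have n: "nrm (c \<cdot> z + d) = nrm (c \<cdot> hor z + d) + (z$4)\<^sup>2 * nrm c" by (rule nrm_row)
  have "1 * nrm c \<le> (z$4)\<^sup>2 * nrm c" using assms(2) by (intro mult_right_mono) (auto simp: power2_eq_square mult_ge1_I)
  then show 1: "nrm c \<le> nrm (c \<cdot> z + d)" unfolding n using nrm_nonneg[of "c \<cdot> hor z + d"] by linarith
  show "1 \<le> nrm (c \<cdot> z + d)"
  proof (cases "c = 0")
    case True
    then have "d \<noteq> 0" using SL by (auto simp: SLH_iff)
    then show ?thesis using True nrm_ge_1[OF mem(2)] by simp
  next
    case False
    then show ?thesis using 1 nrm_ge_1[OF mem(1)] by linarith
  qed
qed

text \<open>Separates horizontal and vertical parts. The term linear in w$4 cancels because the
  image of z has height z$4 / n.\<close>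

lemma gdist_eq:
  assumes "Mat2 a b c d \<in> G" "1 \<le> z$4"
  defines "n \<equiv> nrm (c \<cdot> z + d)" and "q \<equiv> moebius (Mat2 a b c d) z"
  shows "gdist z (Mat2 a b c d) w = n * nrm (hor w - hor q) + (n - 1) * (w$4)\<^sup>2 + (z$4)\<^sup>2 / n
      - nrm (hor w - hor z) - (z$4)\<^sup>2"
    "nrm (a \<cdot> z + b) = n * nrm (hor q) + (z$4)\<^sup>2 / n"
    "gdist z (Mat2 a b c d) w = n * nrm (w - q) - nrm (w - z)"
proof -
  have n1: "1 \<le> n" unfolding n_def using denom_ge_1(1)[OF assms(1,2)] .
  then have y: "c \<cdot> z + d \<noteq> 0" unfolding n_def by auto
  have SL: "Mat2 a b c d \<in> SLH" using assms(1) by (simp add: G_SLH)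
  have qy: "q \<cdot> (c \<cdot> z + d) = a \<cdot> z + b" unfolding q_def by (rule moebius_mult_denom[OF y])
  have q4: "q$4 = z$4 / n" unfolding q_def n_def by (rule moebius_height[OF SL y])
  have "w \<cdot> (c \<cdot> z + d) - (a \<cdot> z + b) = (w - q) \<cdot> (c \<cdot> z + d)" by (simp add: qm_diff_left qy)
  then show 3: "gdist z (Mat2 a b c d) w = n * nrm (w - q) - nrm (w - z)"
    by (simp add: gdist_def nrm_qm n_def)
  have w34: "nrm (w - q) = nrm (hor w - hor q) + (w$4 - z$4 / n)\<^sup>2" "nrm (w - z) = nrm (hor w - hor z) + (w$4 - z$4)\<^sup>2"
    by (subst nrm_hor, simp add: hor_diff q4)+
  then show "gdist z (Mat2 a b c d) w = n * nrm (hor w - hor q) + (n - 1) * (w$4)\<^sup>2 + (z$4)\<^sup>2 / n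
      - nrm (hor w - hor z) - (z$4)\<^sup>2"
  proof -
    have "n * (w$4 - z$4 / n)\<^sup>2 = n * (w$4)\<^sup>2 - 2 * w$4 * z$4 + (z$4)\<^sup>2 / n"
      using n1 by (simp add: power2_eq_square field_simps)
    moreover have "(w$4 - z$4)\<^sup>2 = (w$4)\<^sup>2 - 2 * w$4 * z$4 + (z$4)\<^sup>2"
      by (simp add: power2_eq_square algebra_simps)
    ultimately show ?thesis unfolding 3 w34 by (simp add: algebra_simps)
  qed
  have "nrm (a \<cdot> z + b) = n * nrm q" by (simp add: n_def nrm_qm flip: qy)
  also have "\<dots> = n * nrm (hor q) + (z$4)\<^sup>2 / n"
    using n1 by (subst nrm_hor) (simp add: q4 power2_eq_square field_simps)
  finally show "nrm (a \<cdot> z + b) = n * nrm (hor q) + (z$4)\<^sup>2 / n" .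
qed

lemma row_bounds:
  assumes "c \<cdot> ddag d = d \<cdot> ddag c" "1 \<le> z$4" "nrm (c \<cdot> z + d) \<le> B"
  shows "nrm c \<le> 2 * (1 + nrm (hor z)) * B" "nrm d \<le> 2 * (1 + nrm (hor z)) * B"
proof -
  let ?X = "nrm (hor z)"
  have n: "nrm (c \<cdot> z + d) = nrm (c \<cdot> hor z + d) + (z$4)\<^sup>2 * nrm c" by (rule nrm_row[OF assms(1)])
  have "1 * nrm c \<le> (z$4)\<^sup>2 * nrm c" using assms(2) by (intro mult_right_mono) (auto simp: power2_eq_square mult_ge1_I)
  then have c: "nrm c \<le> B" and p: "nrm (c \<cdot> hor z + d) \<le> B"
    using n assms(3) nrm_nonneg[of "c \<cdot> hor z + d"] nrm_nonneg[of c] by linarith+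
  then have B: "0 \<le> B" using nrm_nonneg[of c] by linarith
  have "1 * B \<le> 2 * (1 + ?X) * B" using B by (intro mult_right_mono) auto
  then show "nrm c \<le> 2 * (1 + ?X) * B" using c by linarith
  have "nrm d = nrm ((c \<cdot> hor z + d) - c \<cdot> hor z)" by simp
  also have "\<dots> \<le> 2 * nrm (c \<cdot> hor z + d) + 2 * (nrm c * ?X)" using nrm_diff_le by (metis nrm_qm)
  also have "\<dots> \<le> 2 * B + 2 * (B * ?X)" using p c by (intro add_mono mult_left_mono mult_right_mono) auto
  finally show "nrm d \<le> 2 * (1 + ?X) * B" by (simp add: algebra_simps)
qed

text \<open>If the inequality of the matrix is tight or violated at w, then n nrm (hor w - hor q) +
  (n - 1) (w$4)^2 is at most C + (z$4)^2. As w is not too low, this bounds n, then the image q of z,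
  then both rows.\<close>

lemma entries_bounded:
  assumes M: "Mat2 a b c d \<in> G" and z: "1 \<le> z$4" and N: "1 \<le> (N::real)"
    and w: "nrm (hor w - hor z) \<le> C" "2 * z$4 / N \<le> w$4" and g: "gdist z (Mat2 a b c d) w \<le> 0"
  shows "\<forall>x\<in>{a, b, c, d}. nrm x \<le> entry_bound (nrm (hor z)) ((z$4)\<^sup>2) C N"
proof -
  define n where "n = nrm (c \<cdot> z + d)"
  define q where "q = moebius (Mat2 a b c d) z"
  let ?X = "nrm (hor z)" and ?Z = "(z$4)\<^sup>2"
  define n0 where "n0 = 1 + N\<^sup>2 * (C + 1) / 4"
  have n1: "1 \<le> n" unfolding n_def using denom_ge_1(1)[OF M z] .
  have Z1: "1 \<le> ?Z" using z by (simp add: power2_eq_square mult_ge1_I)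
  have C0: "0 \<le> C" using w(1) nrm_nonneg[of "hor w - hor z"] by linarith
  have zn: "0 \<le> ?Z / n" "?Z / n \<le> ?Z" 
    using n1 mult_right_mono[of 1 n ?Z] by (simp_all add: field_simps)
  have main: "n * nrm (hor w - hor q) + (n - 1) * (w$4)\<^sup>2 \<le> C + ?Z"
    using g gdist_eq(1)[OF M z, of w] w(1) zn unfolding n_def q_def by linarith
  have h0: "0 \<le> n * nrm (hor w - hor q)" using n1 by simp
  have t0: "0 \<le> (n - 1) * (w$4)\<^sup>2" using n1 by simp
  have nn0: "n \<le> n0"
  proof -
    have "(2 * z$4 / N)\<^sup>2 \<le> (w$4)\<^sup>2" using w(2) z N by (intro power_mono) auto
    then have "(n - 1) * (2 * z$4 / N)\<^sup>2 \<le> (n - 1) * (w$4)\<^sup>2" using n1 by (intro mult_left_mono) auto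
    then have "(n - 1) * (4 * ?Z / N\<^sup>2) \<le> C + ?Z" using main h0 by (simp add: power_divide power_mult_distrib)
    also have "\<dots> \<le> (C + 1) * ?Z" using C0 Z1 mult_left_mono[of 1 ?Z C] by (simp add: algebra_simps)
    finally have "((n - 1) * 4 / N\<^sup>2) * ?Z \<le> (C + 1) * ?Z" by (simp add: field_simps)
    then have "(n - 1) * 4 / N\<^sup>2 \<le> C + 1" by (rule mult_right_le_imp_le) (use Z1 in linarith)
    then show ?thesis using N by (simp add: n0_def field_simps)
  qed
  have hq: "n * nrm (hor q) \<le> 3 * (C + ?Z) + 3 * n0 * (C + ?X)"
  proof -
    have "nrm (u + v + x) \<le> 3 * (nrm u + nrm v + nrm x)" for u v x
    proof -
      have "3 * (nrm u + nrm v + nrm x) - nrm (u + v + x) = nrm (u - v) + nrm (u - x) + nrm (v - x)"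
        by (simp add: nrm_eq power2_eq_square algebra_simps)
      then show ?thesis using nrm_nonneg[of "u - v"] nrm_nonneg[of "u - x"] nrm_nonneg[of "v - x"] by linarith
    qed
    from this[of "hor q - hor w" "hor w - hor z" "hor z"]
    have "nrm (hor q) \<le> 3 * (nrm (hor w - hor q) + C + ?X)"
      using w(1) nrm_minus[of "hor q - hor w"] by simp
    then have "n * nrm (hor q) \<le> n * (3 * (nrm (hor w - hor q) + C + ?X))" using n1 by (intro mult_left_mono) auto
    also have "\<dots> = 3 * (n * nrm (hor w - hor q)) + 3 * n * (C + ?X)" by (simp add: algebra_simps)
    also have "\<dots> \<le> 3 * (C + ?Z) + 3 * n0 * (C + ?X)"
      using main t0 nn0 C0 by (intro add_mono mult_left_mono mult_right_mono) auto
    finally show ?thesis .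
  qed
  let ?B = "n0 * (1 + 3 * (C + ?X)) + 3 * C + 4 * ?Z"
  have "0 \<le> n0 * (3 * (C + ?X))" using n1 nn0 C0 by simp
  then have nB: "nrm (c \<cdot> z + d) \<le> ?B"
    using nn0 C0 Z1 unfolding n_def by (simp add: algebra_simps)
  have "nrm (a \<cdot> z + b) \<le> 3 * (C + ?Z) + 3 * n0 * (C + ?X) + ?Z"
    using gdist_eq(2)[OF M z] hq zn unfolding n_def q_def by linarith
  also have "\<dots> \<le> ?B" using n1 nn0 by (simp add: algebra_simps)
  finally have aB: "nrm (a \<cdot> z + b) \<le> ?B" .
  have "c \<cdot> ddag d = d \<cdot> ddag c" "a \<cdot> ddag b = b \<cdot> ddag a"
    using G_SLH[OF M] by (simp_all add: SLH_iff)
  then show ?thesis using row_bounds[OF _ z nB] row_bounds[OF _ z aB]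
    by (simp add: entry_bound_def n0_def)
qed

text \<open>A stabilizing element has \<open>gdist\<close> 0 at z itself, so the bound applies with
  w = z; N >= 2 keeps z from lying below 2 z$4 / N. A list complete up to the bound thus contains
  the whole stabilizer.\<close>

lemma stabilizer_bounded:
  assumes M: "Mat2 a b c d \<in> G" and z: "1 \<le> z$4" and N: "2 \<le> (N::real)" and C: "0 \<le> C"
    and stab: "moebius (Mat2 a b c d) z = z"
  shows "\<forall>x\<in>{a, b, c, d}. nrm x \<le> entry_bound (nrm (hor z)) ((z$4)\<^sup>2) C N"
proof (rule entries_bounded[OF M z])
  show "gdist z (Mat2 a b c d) z \<le> 0" using gdist_eq(3)[OF M z, of z] stab by simp
  show "2 * z$4 / N \<le> z$4" using z N by (simp add: field_simps)
qed (use N C in auto)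

text \<open>The translations confine w horizontally, the grid forbids s <= 1 / N, and above that
  height \<open>entries_bounded\<close> puts every element that cuts at w into
  \<open>S\<close>.\<close>

lemma dirichlet_sound:
  assumes z: "1 \<le> z$4" and e: "orthogonal_triple e2 e3" and N: "2 \<le> (N::nat)"
    and S: "S \<subseteq> G" "\<And>a b c d. Mat2 a b c d \<in> G \<Longrightarrow> \<forall>x\<in>{a, b, c, d}. nrm x \<le> K \<Longrightarrow> Mat2 a b c d \<in> S"
    and K: "entry_bound (nrm (hor z)) ((z$4)\<^sup>2) ((1 + nrm e2 + nrm e3) / 4) (real N) \<le> K"
    and tr: "\<And>e. e \<in> {q1, e2, e3} \<Longrightarrow> Mat2 q1 e 0 q1 \<in> S \<and> Mat2 q1 (- e) 0 q1 \<in> S"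
    and grid: "\<And>m1 m2 m3. m1 < N \<Longrightarrow> m2 < N \<Longrightarrow> m3 < N \<Longrightarrow> \<exists>M\<in>S. \<forall>i1<2::nat. \<forall>i2<2::nat. \<forall>i3<2::nat. \<forall>h<2::nat.
      gdist z M (box_point z e2 e3 (real (m1 + i1) / N - 1/2) (real (m2 + i2) / N - 1/2) (real (m3 + i3) / N - 1/2) (real h / N)) < 0"
    and w: "w \<in> H4" "\<And>M. M \<in> S \<Longrightarrow> 0 \<le> gdist z M w" and M: "M \<in> G"
  shows "0 \<le> gdist z M w"
proof -
  have en: "e2 \<noteq> 0" "e3 \<noteq> 0" "e2$4 = 0" "e3$4 = 0" using e by (auto simp: orthogonal_triple_def)
  define y1 y2 y3 s where "y1 = (w - z)$1" "y2 = inner (w - z) e2 / nrm e2" "y3 = inner (w - z) e3 / nrm e3" "s = w$4 / (2 * z$4)"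
  note y_def = this
  have slab: "\<bar>inner (w - z) e / nrm e\<bar> \<le> 1 / 2" if "e \<in> {q1, e2, e3}" for e
    using tr[OF that] w(2) that en by (intro translation_slab) auto
  have y: "\<bar>y1\<bar> \<le> 1/2" "\<bar>y2\<bar> \<le> 1/2" "\<bar>y3\<bar> \<le> 1/2"
    using slab[of q1] slab[of e2] slab[of e3] by (simp_all add: y_def)
  have hor: "hor w - hor z = y1 *\<^sub>R q1 + y2 *\<^sub>R e2 + y3 *\<^sub>R e3"
  proof -
    have i: "inner (hor (w - z)) e = inner (w - z) e" if "e$4 = 0" for e
      using that by (simp add: inner_vec_def sum_4)
    show ?thesis
      using orthogonal_triple_coords[OF e hor_nth(4), of "w - z", unfolded i[OF en(3)] i[OF en(4)] hor_nth]
      unfolding hor_diff y_def .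
  qed
  have wb: "w = box_point z e2 e3 y1 y2 y3 s"
  proof -
    have "w = hor z + (hor w - hor z) + w$4 *\<^sub>R qk" by (simp add: q_eq_iff)
    moreover have "w$4 *\<^sub>R qk = s *\<^sub>R (z - ddag z)" using z by (simp add: y_def q_eq_iff)
    ultimately show ?thesis unfolding hor box_point_def by (simp only: add.assoc)
  qed
  have s0: "0 < s" using w(1) z by (simp add: y_def H4_def)
  have N0: "0 < real N" using N by simp
  have "1 / N \<le> s"
  proof (rule ccontr)
    assume "\<not> ?thesis"
    then have sN: "s \<le> 1 / N" by simp
    have cell: "\<exists>m<N. real m / N - 1/2 \<le> y \<and> y \<le> real (m + 1) / N - 1/2" if "\<bar>y\<bar> \<le> 1/2" for y :: real
    proof (cases "y = 1/2")
      \<comment> \<open>The right end 1/2 belongs to the last cell; the floor used below would give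
        m = N.\<close>
      case True
      have "real (N - 1 + 1) / N = 1" using N by simp
      moreover have "real (N - 1) / N \<le> 1" using N by simp
      ultimately have "real (N - 1) / N - 1/2 \<le> y" "y \<le> real (N - 1 + 1) / N - 1/2"
        using True by linarith+
      then show ?thesis using N by (intro exI[of _ "N - 1"] conjI) linarith+
    next
      case False
      define m where "m = nat \<lfloor>(y + 1/2) * N\<rfloor>"
      have b: "0 \<le> (y + 1/2) * N" "(y + 1/2) * N < 1 * N"
        using that False N0 by (auto intro!: mult_strict_right_mono)
      then have m: "real m \<le> (y + 1/2) * N" "(y + 1/2) * N \<le> real (m + 1)" "m < N"
        unfolding m_def by (auto simp: floor_less_iff nat_less_iff) linarith
      then show ?thesis using N0 by (intro exI[of _ m]) (auto simp: field_simps)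
    qed
    obtain m1 m2 m3 where m: "m1 < N" "m2 < N" "m3 < N"
      "real m1 / N - 1/2 \<le> y1" "y1 \<le> real (m1 + 1) / N - 1/2"
      "real m2 / N - 1/2 \<le> y2" "y2 \<le> real (m2 + 1) / N - 1/2"
      "real m3 / N - 1/2 \<le> y3" "y3 \<le> real (m3 + 1) / N - 1/2"
      using cell y by metis
    obtain M' where M': "M' \<in> S" and cor: "\<And>i1 i2 i3 h. i1 < (2::nat) \<Longrightarrow> i2 < (2::nat) \<Longrightarrow> i3 < (2::nat) \<Longrightarrow> h < (2::nat) \<Longrightarrow>
      gdist z M' (box_point z e2 e3 (real (m1 + i1) / N - 1/2) (real (m2 + i2) / N - 1/2) (real (m3 + i3) / N - 1/2) (real h / N)) < 0"
      using grid[OF m(1-3)] by blast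
    obtain a b c d where M'd: "M' = Mat2 a b c d" by (cases M')
    have "1 \<le> nrm (c \<cdot> z + d)" using M' S(1) M'd denom_ge_1(1)[OF _ z] by blast
    then have "gdist z M' (box_point z e2 e3 y1 y2 y3 s) < 0"
    proof (rule gdist_box[OF M'd, where los = 0 and his = "1 / N"])
      fix u1 u2 u3 u4
      assume "u1 \<in> {real m1 / N - 1/2, real (m1 + 1) / N - 1/2}" "u2 \<in> {real m2 / N - 1/2, real (m2 + 1) / N - 1/2}"
        "u3 \<in> {real m3 / N - 1/2, real (m3 + 1) / N - 1/2}" "u4 \<in> {0, 1 / real N}"
      moreover have "\<exists>i<2. u = real (m + i) / N - 1/2" if "u \<in> {real m / N - 1/2, real (m + 1) / N - 1/2}" for u m
        using that by (auto intro: exI[of _ "0::nat"] exI[of _ "1::nat"])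
      moreover have "\<exists>h<2. u4 = real h / N" if "u4 \<in> {0, 1 / real N}"
        using that by (auto intro: exI[of _ "0::nat"] exI[of _ "1::nat"])
      ultimately show "gdist z M' (box_point z e2 e3 u1 u2 u3 u4) < 0" using cor by metis
    qed (use m s0 sN N0 in \<open>auto simp: divide_strict_right_mono\<close>)
    then show False using w(2)[OF M'] wb by simp
  qed
  then have t: "2 * z$4 / N \<le> w$4" using z by (simp add: y_def field_simps)
  have C: "nrm (hor w - hor z) \<le> (1 + nrm e2 + nrm e3) / 4"
    unfolding hor by (rule nrm_small_coords[OF e y])
  obtain a b c d where Md: "M = Mat2 a b c d" by (cases M)
  show ?thesis
  proof (rule ccontr)
    assume neg: "\<not> 0 \<le> gdist z M w"
    then have g: "gdist z (Mat2 a b c d) w \<le> 0" by (simp add: Md)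
    have "\<forall>x\<in>{a, b, c, d}. nrm x \<le> K"
      using entries_bounded[OF _ z _ C t g] M Md K N by fastforce
    then have "M \<in> S" using S(2) M Md by blast
    then show False using w(2) neg by blast
  qed
qed

end

text \<open>The inequality of an inverse: w is as far from the inverse image of z as the image of w
  is from z. It is evaluated at boundary points p, where ddag p = p.\<close>

lemma gdist_hat:
  "gdist z (hat Ham ddag (Mat2 a b c d)) w =
     nrm ((a \<cdot> ddag w + b) - ddag z \<cdot> (c \<cdot> ddag w + d)) - nrm (w - z)"
proof -
  have "w \<cdot> (- ddag c \<cdot> z + ddag a) - (ddag d \<cdot> z - ddag b) =
      ddag ((a \<cdot> ddag w + b) - ddag z \<cdot> (c \<cdot> ddag w + d))"
    by (simp add: ddag_simps qm_simps)
  then show ?thesis by (simp add: gdist_def)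
qed

lemma finite_quadratic_roots:
  assumes "\<alpha> \<noteq> 0 \<or> \<beta> \<noteq> 0 \<or> \<gamma> \<noteq> (0::real)"
  shows "finite {s::nat. \<alpha> + real s * \<beta> + (real s)\<^sup>2 * \<gamma> = 0}"
proof -
  have "finite {x. poly [:\<alpha>, \<beta>, \<gamma>:] x = 0}" using assms by (intro poly_roots_finite) auto
  then have "finite (real -` {x. poly [:\<alpha>, \<beta>, \<gamma>:] x = 0})"
    by (rule finite_vimageI) (simp add: inj_on_def)
  moreover have "real -` {x. poly [:\<alpha>, \<beta>, \<gamma>:] x = 0} = {s::nat. \<alpha> + real s * \<beta> + (real s)\<^sup>2 * \<gamma> = 0}"
    by (auto simp: power2_eq_square algebra_simps)
  ultimately show ?thesis by simp
qed

section \<open>Existence of a centre and of a grid\<close>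

context euclidean_order
begin

text \<open>Equal heights force nrm (c z + d) = 1, which above height 1 leaves no room for c. The
  element is then determined by the unit d, and b is the displacement of \<open>hor z\<close> caused
  by d.\<close>

lemma stabilizer_upper:
  assumes M: "Mat2 a b c d \<in> G" and z: "1 < z$4" and stab: "moebius (Mat2 a b c d) z = z"
  shows "c = 0" "nrm d = 1" "a = ddag (quat_conj d)" "b = hor z \<cdot> d - ddag (quat_conj d) \<cdot> hor z"
proof -
  have SL: "Mat2 a b c d \<in> SLH" and mem: "c \<in> \<Lambda>" using M by (simp_all add: G_iff)
  have zH: "z \<in> H4" using z by (simp add: H4_def)
  have y: "c \<cdot> z + d \<noteq> 0" using SLH_denom_nonzero[OF SL zH] .
  have "z$4 = z$4 / nrm (c \<cdot> z + d)" using moebius_height[OF SL y] stab by simp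
  then have n: "nrm (c \<cdot> z + d) = 1" using z y by (simp add: field_simps)
  have "c \<cdot> ddag d = d \<cdot> ddag c" using SL by (simp add: SLH_iff)
  then have "nrm (c \<cdot> z + d) = nrm (c \<cdot> hor z + d) + (z$4)\<^sup>2 * nrm c" by (rule nrm_row)
  then have le: "(z$4)\<^sup>2 * nrm c \<le> 1" using n nrm_nonneg[of "c \<cdot> hor z + d"] by linarith
  show c: "c = 0"
  proof (rule ccontr)
    assume "c \<noteq> 0"
    then have "1 \<le> nrm c" using nrm_ge_1 mem by blast
    then have "(z$4)\<^sup>2 * 1 \<le> (z$4)\<^sup>2 * nrm c" by (intro mult_left_mono) auto
    moreover have "1 < (z$4)\<^sup>2" using z by (simp add: one_less_power)
    ultimately show False using le by linarith
  qed
  show d: "nrm d = 1" using n c by simp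
  have "a \<cdot> ddag d = q1" using SL c by (simp add: SLH_iff)
  moreover have "ddag (quat_conj d) \<cdot> ddag d = q1"
    using d qm_conj(1)[of d] by (metis ddag_one ddag_qm scaleR_one)
  moreover have "ddag d \<noteq> 0" using d by (metis nrm_ddag nrm_zero zero_neq_one)
  ultimately show a: "a = ddag (quat_conj d)" using qm_right_cancel by metis
  have "a \<cdot> z + b = z \<cdot> d" using moebius_mult_denom[OF y, of a b] stab c by simp
  then have "b = z \<cdot> d - a \<cdot> z" by (simp add: algebra_simps)
  also have "\<dots> = hor z \<cdot> d - a \<cdot> hor z" unfolding a by (simp add: q_eq_iff qm_nth algebra_simps)
  finally show "b = hor z \<cdot> d - ddag (quat_conj d) \<cdot> hor z" by (simp add: a)
qed

text \<open>Along the curve \<open>1 + s e\<^sub>2 + s\<^sup>2 e\<^sub>3\<close> only finitely many points are fixed by a nontrivial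
  unit, and after division by a large integer the displacement is too short to be a
  translation of the order.\<close>

lemma ex_center:
  assumes e: "orthogonal_triple e2 e3" "e2 \<in> \<Lambda>" "e3 \<in> \<Lambda>"
  shows "\<exists>z m::nat. 0 < m \<and> real m *\<^sub>R z \<in> \<Lambda> \<and> B \<le> z$4 \<and>
     (\<forall>M\<in>G. moebius M z = z \<longrightarrow> M = Mat2 q1 0 0 q1 \<or> M = Mat2 (- q1) 0 0 (- q1))"
proof -
  define D where "D d x = x \<cdot> d - ddag (quat_conj d) \<cdot> x" for d x
  have D_lin: "D d (x + y) = D d x + D d y" "D d (r *\<^sub>R x) = r *\<^sub>R D d x" for d x y r
    by (simp_all add: D_def qm_simps algebra_simps)
  define U where "U = {d\<in>\<Lambda>. nrm d = 1 \<and> d \<noteq> q1 \<and> d \<noteq> - q1}"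
  have "U \<subseteq> {d\<in>\<Lambda>. nrm d \<le> 1}" by (auto simp: U_def)
  then have fU: "finite U" using finite_ball finite_subset by blast
  define Y where "Y s = q1 + real s *\<^sub>R e2 + (real s)\<^sup>2 *\<^sub>R e3" for s :: nat
  have fin: "finite {s. D d (Y s) = 0}" if d: "d \<in> U" for d
  proof -
    \<comment> \<open>Vanishing at 1 and at e2 would already make d real, hence 1 or -1.\<close>
    have "\<exists>i. D d q1 $ i \<noteq> 0 \<or> D d e2 $ i \<noteq> 0 \<or> D d e3 $ i \<noteq> 0"
    proof (rule ccontr)
      assume "\<not> ?thesis"
      then have 0: "D d q1 = 0" "D d e2 = 0" by (simp_all add: vec_eq_iff)
      from 0(1) have d23: "d$2 = 0" "d$3 = 0" by (simp_all add: D_def q_eq_iff)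
      have e2: "e2$1 = 0" "e2$4 = 0" "e2$2 \<noteq> 0 \<or> e2$3 \<noteq> 0"
        using e(1) by (auto simp: orthogonal_triple_def q_eq_iff)
      from 0(2) have d4: "d$4 = 0" using e2 d23 by (auto simp: D_def q_eq_iff qm_nth)
      have "nrm d = 1" using d by (simp add: U_def)
      then have "(d$1)\<^sup>2 = 1" using d23 d4 by (simp add: nrm_eq)
      then have "d$1 = 1 \<or> d$1 = - 1" by (simp add: power2_eq_1_iff)
      then have "d = q1 \<or> d = - q1" using d23 d4 by (simp add: q_eq_iff)
      then show False using d by (simp add: U_def)
    qed
    then obtain i where i: "D d q1 $ i \<noteq> 0 \<or> D d e2 $ i \<noteq> 0 \<or> D d e3 $ i \<noteq> 0" by blast
    have "{s. D d (Y s) = 0} \<subseteq> {s. D d q1 $ i + real s * D d e2 $ i + (real s)\<^sup>2 * D d e3 $ i = 0}"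
      by (auto simp: Y_def D_lin dest!: arg_cong[of _ _ "\<lambda>v. v $ i"])
    then show ?thesis using finite_quadratic_roots[OF i] finite_subset by blast
  qed
  have "finite (\<Union>d\<in>U. {s. D d (Y s) = 0})" using fU fin by blast
  then obtain s where s: "s \<notin> (\<Union>d\<in>U. {s. D d (Y s) = 0})" using ex_new_if_finite[OF infinite_UNIV_nat] by blast
  have "\<exists>b. \<forall>d\<in>U. nrm (D d (Y s)) \<le> b" by (rule finite_uniform_bound[OF fU]) (auto intro: order_trans)
  then obtain b where b: "\<And>d. d \<in> U \<Longrightarrow> nrm (D d (Y s)) \<le> b" by blast
  \<comment> \<open>The displacement has norm at most b / m^2, which is below 1; a nonzero element
    of the order cannot be that short.\<close>
  obtain m :: nat where m: "max 1 b < real m" using reals_Archimedean2 by blast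
  have m0: "0 < m" using m by simp
  obtain \<kappa> where k: "\<kappa> \<in> \<Lambda>" "hor \<kappa> = 0" "0 < \<kappa>$4" using ex_axis by blast
  obtain l :: nat where l: "max 2 B / \<kappa>$4 \<le> real l" using real_arch_simple by blast
  define z where "z = (1 / real m) *\<^sub>R Y s + real l *\<^sub>R \<kappa>"
  have Ymem: "Y s \<in> \<Lambda>" unfolding Y_def using e by (intro add_mem int_scale_mem one_mem) auto
  have Y4: "Y s $ 4 = 0" using e(1) by (simp add: Y_def orthogonal_triple_def)
  have "real m *\<^sub>R z = Y s + (real m * real l) *\<^sub>R \<kappa>" using m0 by (simp add: z_def scaleR_add_right)
  then have zmem: "real m *\<^sub>R z \<in> \<Lambda>" using Ymem k by (auto intro!: add_mem int_scale_mem)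
  have "z$4 = real l * \<kappa>$4" using Y4 by (simp add: z_def)
  then have z4: "max 2 B \<le> z$4" using l k(3) by (simp add: pos_divide_le_eq)
  have hz: "hor z = (1 / real m) *\<^sub>R Y s" using Y4 k(2) by (simp add: z_def q_eq_iff)
  have "M = Mat2 q1 0 0 q1 \<or> M = Mat2 (- q1) 0 0 (- q1)" if M: "M \<in> G" "moebius M z = z" for M
  proof -
    obtain a b' c d where Md: "M = Mat2 a b' c d" by (cases M)
    have st: "c = 0" "nrm d = 1" "a = ddag (quat_conj d)" "b' = hor z \<cdot> d - ddag (quat_conj d) \<cdot> hor z"
      using stabilizer_upper[of a b' c d z] M Md z4 by auto
    have mem: "d \<in> \<Lambda>" "b' \<in> \<Lambda>" using M(1) by (simp_all add: Md G_iff)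
    have "d \<notin> U"
    proof
      assume d: "d \<in> U"
      have "b' = (1 / real m) *\<^sub>R D d (Y s)" unfolding st(4) hz by (simp add: D_def scaleR_diff_right)
      then have nb: "nrm b' = nrm (D d (Y s)) / (real m)\<^sup>2" by (simp add: nrm_scaleR power_divide)
      have "b' \<noteq> 0" using nb s d m0 by auto
      then have "1 \<le> nrm b'" using nrm_ge_1 mem by blast
      then have "(real m)\<^sup>2 \<le> nrm (D d (Y s))" unfolding nb using m0 by (simp add: field_simps)
      also have "\<dots> < real m" using b[OF d] m by linarith
      also have "real m \<le> (real m)\<^sup>2" using m0 by (intro self_le_power) auto
      finally show False by simp
    qed
    then have "d = q1 \<or> d = - q1" using mem st(2) by (auto simp: U_def)
    then show ?thesis
    proof
      assume "d = q1"
      moreover have "ddag (quat_conj q1) = q1" by (simp add: q_eq_iff)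
      ultimately show ?thesis using st by (simp add: Md)
    next
      assume "d = - q1"
      moreover have "ddag (quat_conj (- q1)) = - q1" by (simp add: q_eq_iff)
      ultimately show ?thesis using st by (simp add: Md)
    qed
  qed
  then show ?thesis using m0 zmem z4 by (intro exI[of _ z] exI[of _ m]) auto
qed

text \<open>The inverse of an element with nrm (c p + d) < 1/2 serves. After a translation the image
  of p is within squared distance C of \<open>hor z\<close>, so the factor 1/2 brings the first term
  of \<open>gdist\<close> below (z$4)^2, while nrm (p - z) is at least that. If c p + d = 0, the
  first term is nrm (a p + b), at most 1.\<close>

lemma ex_gdist_negative:
  assumes e: "orthogonal_triple e2 e3" "e2 \<in> \<Lambda>" "e3 \<in> \<Lambda>"
    and z: "2 \<le> z$4" "(1 + nrm e2 + nrm e3) / 4 < (z$4)\<^sup>2" and p: "p$4 = 0"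
  shows "\<exists>M\<in>G. gdist z M p < 0"
proof -
  obtain a b c d where M: "Mat2 a b c d \<in> G" and cd: "nrm (c \<cdot> p + d) < 1/2"
    using approximation[OF p, of "1/2"] by auto
  let ?Z = "(z$4)\<^sup>2"
  have SL: "Mat2 a b c d \<in> SLH" and mem: "c \<in> \<Lambda>" using M by (simp_all add: G_iff)
  have pz: "?Z \<le> nrm (p - z)" by (subst nrm_hor) (simp add: p)
  have Z4: "4 \<le> ?Z" using power_mono[OF z(1), of 2] by simp
  have dp: "ddag p = p" using p by (simp add: ddag_fixed_iff)
  show ?thesis
  proof (cases "c \<cdot> p + d = 0")
    case True
    then have d: "d = - (c \<cdot> p)" by (simp add: eq_neg_iff_add_eq_0 add.commute)
    have "(a \<cdot> p + b) \<cdot> ddag c = - (a \<cdot> ddag d - b \<cdot> ddag c)"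
      by (simp add: d ddag_simps dp qm_simps)
    also have "a \<cdot> ddag d - b \<cdot> ddag c = q1" using SL by (simp add: SLH_iff)
    finally have "(a \<cdot> p + b) \<cdot> ddag c = - q1" .
    then have n: "nrm (a \<cdot> p + b) * nrm c = 1" by (metis nrm_ddag nrm_minus nrm_one nrm_qm)
    then have "c \<noteq> 0" by auto
    then have "1 \<le> nrm c" using nrm_ge_1 mem by blast
    then have "nrm (a \<cdot> p + b) \<le> 1"
      using n mult_left_mono[of 1 "nrm c" "nrm (a \<cdot> p + b)"] by simp
    then have "gdist z (hat Ham ddag (Mat2 a b c d)) p < 0"
      unfolding gdist_hat dp True using pz Z4 by simp
    then show ?thesis using G_hat[OF M] by blast
  next
    case False
    let ?Y = "c \<cdot> p + d"
    define v where "v = moebius (Mat2 a b c d) p"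
    have v4: "v$4 = 0" unfolding v_def using moebius_height[OF SL False] p by simp
    have vY: "a \<cdot> p + b = v \<cdot> ?Y" unfolding v_def using moebius_mult_denom[OF False] by simp
    define y1 y2 y3 where "y1 = (hor z - v)$1" "y2 = inner (hor z - v) e2 / nrm e2" "y3 = inner (hor z - v) e3 / nrm e3"
    note y_def = this
    define q where "q = of_int (round y1) *\<^sub>R q1 + of_int (round y2) *\<^sub>R e2 + of_int (round y3) *\<^sub>R e3"
    have q: "q \<in> \<Lambda>" "q$4 = 0"
      using e by (auto simp: q_def orthogonal_triple_def intro!: add_mem int_scale_mem one_mem)
    have "hor z - v = y1 *\<^sub>R q1 + y2 *\<^sub>R e2 + y3 *\<^sub>R e3"
      unfolding y_def by (rule orthogonal_triple_coords[OF e(1)]) (simp add: v4)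
    then have "v + q - hor z = (of_int (round y1) - y1) *\<^sub>R q1 + (of_int (round y2) - y2) *\<^sub>R e2
        + (of_int (round y3) - y3) *\<^sub>R e3"
      unfolding q_def by (simp add: algebra_simps)
    then have C: "nrm (v + q - hor z) \<le> (1 + nrm e2 + nrm e3) / 4"
      using nrm_small_coords[OF e(1)] of_int_round_abs_le by metis
    have N: "mm (Mat2 q1 q 0 q1) (Mat2 a b c d) \<in> G" by (intro G_mult G_shift q M)
    let ?N = "Mat2 (a + q \<cdot> c) (b + q \<cdot> d) c d"
    have NG: "?N \<in> G" using N by simp
    have "((a + q \<cdot> c) \<cdot> p + (b + q \<cdot> d)) - ddag z \<cdot> ?Y = (a \<cdot> p + b) + q \<cdot> ?Y - ddag z \<cdot> ?Y"
      by (simp add: qm_simps algebra_simps)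
    also have "\<dots> = (v + q - ddag z) \<cdot> ?Y" unfolding vY by (simp add: qm_add_left qm_diff_left)
    finally have X: "nrm (((a + q \<cdot> c) \<cdot> p + (b + q \<cdot> d)) - ddag z \<cdot> ?Y) = nrm (v + q - ddag z) * nrm ?Y"
      by (simp add: nrm_qm)
    have "nrm (v + q - ddag z) = nrm (v + q - hor z) + ?Z"
      by (simp add: nrm_eq v4 q)
    then have "nrm (v + q - ddag z) < 2 * ?Z" using C z(2) by linarith
    moreover have "nrm (v + q - ddag z) * nrm ?Y \<le> nrm (v + q - ddag z) * (1/2)"
      using cd by (intro mult_left_mono) auto
    ultimately have "nrm (v + q - ddag z) * nrm ?Y < ?Z" by linarith
    then have "gdist z (hat Ham ddag ?N) p < 0"
      unfolding gdist_hat dp X using pz by linarith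
    then show ?thesis using G_hat[OF NG] by blast
  qed
qed

text \<open>The bottom face, at height 0, is compact and covered by the open sets on which some
  \<open>gdist\<close> is negative. All corners of a cell, including those above the face, are
  within 4 / N of one of its bottom corners, so a Lebesgue number of the cover determines N.\<close>

lemma ex_grid:
  assumes e: "orthogonal_triple e2 e3" "e2 \<in> \<Lambda>" "e3 \<in> \<Lambda>"
    and z: "2 \<le> z$4" "(1 + nrm e2 + nrm e3) / 4 < (z$4)\<^sup>2"
  shows "\<exists>N\<ge>2::nat. \<forall>m1<N. \<forall>m2<N. \<forall>m3<N. \<exists>M\<in>G. \<forall>i1<2::nat. \<forall>i2<2::nat. \<forall>i3<2::nat. \<forall>h<2::nat.
      gdist z M (box_point z e2 e3 (real (m1 + i1) / N - 1/2) (real (m2 + i2) / N - 1/2) (real (m3 + i3) / N - 1/2) (real h / N)) < 0"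
proof -
  define P :: "real^4 \<Rightarrow> real^4" where "P y = box_point z e2 e3 (y$1) (y$2) (y$3) (y$4)" for y
  define S :: "(real^4) set" where "S = cbox (vector [- 1/2, - 1/2, - 1/2, 0]) (vector [1/2, 1/2, 1/2, 0])"
  define V where "V M = {y. gdist z M (P y) < 0}" for M
  have opn: "open (V M)" for M
  proof -
    obtain a b c d where M: "M = Mat2 a b c d" by (cases M)
    show ?thesis unfolding V_def M gdist_def P_def box_point_def nrm_norm mat2.case
      by (intro open_Collect_less continuous_intros continuous_on_const)
  qed
  have cov: "S \<subseteq> \<Union>(V ` G)"
  proof
    fix y assume "y \<in> S"
    then have "y$4 = 0" by (auto simp: S_def mem_box_cart forall_4)
    then have "P y $ 4 = 0" using e(1) by (simp add: P_def box_point_def orthogonal_triple_def)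
    from ex_gdist_negative[OF e z this] show "y \<in> \<Union>(V ` G)" by (auto simp: V_def)
  qed
  have comp: "compact S" by (simp add: S_def compact_cbox)
  obtain \<epsilon> where eps: "0 < \<epsilon>" "\<And>y. y \<in> S \<Longrightarrow> \<exists>W\<in>V ` G. ball y \<epsilon> \<subseteq> W"
    by (rule Heine_Borel_lemma[OF comp cov]) (use opn in auto)
  obtain N :: nat where N: "max 2 (4 / \<epsilon>) < real N" using reals_Archimedean2 by blast
  have N2: "2 \<le> N" and N0: "0 < real N" using N by auto
  have Ne: "4 / real N < \<epsilon>" using N N0 eps(1) by (simp add: field_simps)
  have "\<exists>M\<in>G. \<forall>i1<2::nat. \<forall>i2<2::nat. \<forall>i3<2::nat. \<forall>h<2::nat.
      gdist z M (box_point z e2 e3 (real (m1 + i1) / N - 1/2) (real (m2 + i2) / N - 1/2) (real (m3 + i3) / N - 1/2) (real h / N)) < 0"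
    if m: "m1 < N" "m2 < N" "m3 < N" for m1 m2 m3
  proof -
    define y :: "real^4" where "y = vector [real m1 / N - 1/2, real m2 / N - 1/2, real m3 / N - 1/2, 0]"
    have "y \<in> S" using N0 m by (auto simp: y_def S_def mem_box_cart forall_4 pos_divide_le_eq)
    then obtain M where M: "M \<in> G" "ball y \<epsilon> \<subseteq> V M" using eps(2) by blast
    have "gdist z M (box_point z e2 e3 (real (m1 + i1) / N - 1/2) (real (m2 + i2) / N - 1/2) (real (m3 + i3) / N - 1/2) (real h / N)) < 0"
      if i: "i1 < 2" "i2 < 2" "i3 < 2" "h < 2" for i1 i2 i3 h :: nat
    proof -
      define u :: "real^4" where "u = vector [real (m1 + i1) / N - 1/2, real (m2 + i2) / N - 1/2, real (m3 + i3) / N - 1/2, real h / N]"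
      have "norm (u - y) \<le> (\<Sum>i\<in>UNIV. \<bar>(u - y) $ i\<bar>)" by (rule norm_le_l1_cart)
      also have "\<dots> = real i1 / N + real i2 / N + real i3 / N + real h / N"
        by (simp add: sum_4 u_def y_def add_divide_distrib)
      also have "\<dots> \<le> 1 / N + 1 / N + 1 / N + 1 / N"
        using i N0 by (intro add_mono divide_right_mono) auto
      also have "\<dots> < \<epsilon>" using Ne by simp
      finally have "u \<in> ball y \<epsilon>" by (simp add: dist_norm norm_minus_commute)
      then have "u \<in> V M" using M by blast
      then show ?thesis by (simp add: V_def P_def u_def)
    qed
    then show ?thesis using M(1) by blast
  qed
  then show ?thesis using N2 by blast
qed

end

section \<open>Orders of the rational algebra\<close>

abbreviation rone :: "rat^4" where "rone \<equiv> vector [1, 0, 0, 0]"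

definition nq :: "rat \<Rightarrow> rat \<Rightarrow> rat^4 \<Rightarrow> rat" where
  "nq a b x = (x$1)\<^sup>2 - a * (x$2)\<^sup>2 - b * (x$3)\<^sup>2 + a * b * (x$4)\<^sup>2"

lemma nq_mult: "nq a b (quat_mult a b x y) = nq a b x * nq a b y"
  by (simp add: nq_def quat_mult_def power2_eq_square algebra_simps)

text \<open>If q is the reduced denominator, q^m divides D for every m, and m = D is decisive
  because 2^D > D. It is applied to norms, whose powers are again norms from the order.\<close>

lemma rat_Ints_of_bounded_denominators:
  fixes r :: rat
  assumes "0 < D" "\<And>m::nat. of_nat D * r ^ m \<in> \<int>"
  shows "r \<in> \<int>"
proof -
  obtain p q where pq: "quotient_of r = (p, q)" by fastforce
  then have r: "r = of_int p / of_int q" and q: "0 < q" and cop: "coprime p q"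
    using quotient_of_div quotient_of_denom_pos quotient_of_coprime by auto
  have dv: "q ^ m dvd int D" for m
  proof -
    obtain k where "of_nat D * r ^ m = of_int k" using assms(2)[of m] by (elim Ints_cases)
    then have "(of_nat D :: rat) * of_int p ^ m = of_int k * of_int q ^ m"
      using q by (simp add: r power_divide field_simps)
    then have "(of_int (int D * p ^ m) :: rat) = of_int (k * q ^ m)" by simp
    then have "int D * p ^ m = k * q ^ m" by (simp only: of_int_eq_iff)
    then have "q ^ m dvd int D * p ^ m" by simp
    moreover have "coprime (q ^ m) (p ^ m)" using cop by (simp add: coprime_commute)
    ultimately show ?thesis by (simp add: coprime_dvd_mult_left_iff)
  qed
  have "q = 1"
  proof (rule ccontr)
    assume "q \<noteq> 1"
    then have q2: "2 \<le> q" using q by simp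
    have "q ^ D \<le> int D" using dv[of D] assms(1) zdvd_imp_le by simp
    moreover have "2 ^ D \<le> q ^ D" using q2 by (intro power_mono) auto
    moreover have "int D < 2 ^ D" using of_nat_less_two_power by blast
    ultimately show False by linarith
  qed
  then show ?thesis by (simp add: r)
qed

lemma ex_common_denominator:
  fixes A :: "rat set"
  assumes "finite A"
  shows "\<exists>D::nat. 0 < D \<and> (\<forall>r\<in>A. of_nat D * r \<in> \<int>)"
  using assms
proof induction
  case empty
  show ?case by (intro exI[of _ 1]) simp
next
  case (insert r A)
  then obtain D where D: "0 < D" "\<And>r. r \<in> A \<Longrightarrow> of_nat D * r \<in> \<int>" by auto
  obtain p q where "quotient_of r = (p, q)" by fastforce
  then have r: "r = of_int p / of_int q" and q: "0 < q"
    using quotient_of_div quotient_of_denom_pos by auto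
  have "of_nat (D * nat q) * r = of_int (int D * p)" using q by (simp add: r of_nat_nat)
  then have 1: "of_nat (D * nat q) * r \<in> \<int>" by (metis Ints_of_int)
  have 2: "of_nat (D * nat q) * s \<in> \<int>" if "s \<in> A" for s
  proof -
    have "of_nat (D * nat q) * s = of_nat (nat q) * (of_nat D * s)" by simp
    then show ?thesis using D(2)[OF that] by (metis Ints_mult Ints_of_nat)
  qed
  show ?case using D q 1 2 by (intro exI[of _ "D * nat q"]) auto
qed

lemma quat_alg_simps [simp]:
  "carrier (quat_alg a b) = UNIV" "mult (quat_alg a b) = quat_mult a b"
  "add (quat_alg a b) = (+)" "zero (quat_alg a b) = 0" "one (quat_alg a b) = vector [1, 0, 0, 0]"
  by (simp_all add: quat_alg_def)

lemma quat_alg_a_inv: "\<ominus>\<^bsub>quat_alg a b\<^esub> x = - x"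
proof -
  interpret ring "quat_alg a b" by (rule ring_quat_alg)
  show ?thesis using minus_equality[of "- x" x] by simp
qed

lemma add_monoid_inv: "inv\<^bsub>add_monoid (quat_alg a b)\<^esub> x = - x"
  using quat_alg_a_inv[of a b x] by (simp add: a_inv_def)

lemma rat4_decomp:
  fixes x :: "rat^4"
  shows "x = x$1 *s vector [1, 0, 0, 0] + x$2 *s vector [0, 1, 0, 0] + x$3 *s vector [0, 0, 1, 0] +
    x$4 *s vector [0, 0, 0, 1]"
  by (simp add: vec_eq_iff forall_4)

text \<open>A quaternion with real square is real or pure, and a real one would commute with
  y.\<close>

lemma anticommute_pure:
  assumes "x \<cdot> x = r *\<^sub>R q1" "x \<cdot> y = - (y \<cdot> x)" "x \<noteq> 0" "y \<noteq> 0"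
  shows "x$1 = 0"
proof (rule ccontr)
  assume "x$1 \<noteq> 0"
  then have "x = x$1 *\<^sub>R q1" using assms(1) by (auto simp: q_eq_iff qm_nth)
  then have "x \<cdot> y = y \<cdot> x" by (metis qm_one_left qm_one_right qm_scaleR_left qm_scaleR_right)
  with assms(2) have "x \<cdot> y = - (x \<cdot> y)" by simp
  then have "x \<cdot> y = 0" by (simp add: q_eq_iff)
  then show False using assms(3,4) by simp
qed

section \<open>The order and its image under the embedding\<close>

locale embedded_order =
  fixes a b :: rat and \<sigma> :: "rat^4 \<Rightarrow> rat^4" and \<O> :: "(rat^4) set" and \<iota> :: "rat^4 \<Rightarrow> real^4"
  assumes order: "quat_order a b \<O>"
    and eucl: "sigma_euclidean ((quat_alg a b)\<lparr>carrier := \<O>\<rparr>) \<sigma>"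
    and emb: "involution_embedding a b \<sigma> \<iota>"
begin

abbreviation rm :: "rat^4 \<Rightarrow> rat^4 \<Rightarrow> rat^4" (infixl "\<bullet>\<^sub>q" 70) where "x \<bullet>\<^sub>q y \<equiv> quat_mult a b x y"
abbreviation "ri \<equiv> (vector [0, 1, 0, 0] :: rat^4)"
abbreviation "rj \<equiv> (vector [0, 0, 1, 0] :: rat^4)"
abbreviation "rk \<equiv> (vector [0, 0, 0, 1] :: rat^4)"
abbreviation "R \<equiv> (quat_alg a b)\<lparr>carrier := \<O>\<rparr>"

lemma iota_mult: "\<iota> (x \<bullet>\<^sub>q y) = \<iota> x \<cdot> \<iota> y"
  and iota_add: "\<iota> (x + y) = \<iota> x + \<iota> y"
  and iota_one: "\<iota> rone = q1"
  and iota_scale: "\<iota> (r *s x) = of_rat r *\<^sub>R \<iota> x"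
  and iota_sigma: "\<iota> (\<sigma> x) = ddag (\<iota> x)"
  and inj_iota: "inj \<iota>"
  using emb ring_hom_mult[of \<iota> "quat_alg a b" Ham x y] ring_hom_add[of \<iota> "quat_alg a b" Ham x y]
    ring_hom_one[of \<iota> "quat_alg a b" Ham]
  by (simp_all add: involution_embedding_def scalar_mult_eq_scaleR)

lemma iota_eq_iff: "\<iota> x = \<iota> y \<longleftrightarrow> x = y"
  using inj_iota by (simp add: inj_eq)

lemma iota_zero: "\<iota> 0 = 0"
  using iota_add[of 0 0] by simp

lemma iota_eq_0: "\<iota> x = 0 \<longleftrightarrow> x = 0"
  using iota_eq_iff[of x 0] by (simp add: iota_zero)

lemma iota_minus: "\<iota> (- x) = - \<iota> x"
  using iota_add[of x "- x"] by (simp add: iota_zero eq_neg_iff_add_eq_0 add.commute)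

lemma iota_diff: "\<iota> (x - y) = \<iota> x - \<iota> y"
  using iota_add[of x "- y"] by (simp add: iota_minus)

lemmas iota_simps = iota_mult iota_add iota_one iota_scale iota_sigma iota_zero iota_minus iota_diff

text \<open>Linearity is pulled back from \<open>ddag\<close> along the injective embedding.\<close>

lemma sigma_add: "\<sigma> (x + y) = \<sigma> x + \<sigma> y"
  and sigma_scale: "\<sigma> (r *s x) = r *s \<sigma> x"
  by (simp_all add: iota_simps ddag_simps flip: iota_eq_iff)

text \<open>The embedding need not send basis vectors to multiples of basis vectors. That i, j, k go
  to pure quaternions follows from anticommutation and yields the compatibility with conjugation and
  norm.\<close>

lemma iota_basis_pure: "\<iota> ri $ 1 = 0" "\<iota> rj $ 1 = 0" "\<iota> rk $ 1 = 0"
  and iota_ij: "\<iota> ri \<cdot> \<iota> rj = \<iota> rk"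
  and iota_rk_nonzero: "\<iota> rk \<noteq> 0"
proof -
  have sq: "ri \<bullet>\<^sub>q ri = a *s rone" "rj \<bullet>\<^sub>q rj = b *s rone" "rk \<bullet>\<^sub>q rk = (- (a * b)) *s rone"
    "ri \<bullet>\<^sub>q rj = - (rj \<bullet>\<^sub>q ri)" "rj \<bullet>\<^sub>q ri = - (ri \<bullet>\<^sub>q rj)" "rk \<bullet>\<^sub>q ri = - (ri \<bullet>\<^sub>q rk)"
    and ij: "ri \<bullet>\<^sub>q rj = rk"
    by (simp_all add: quat_mult_def vec_eq_iff forall_4)
  have nz: "\<iota> ri \<noteq> 0" "\<iota> rj \<noteq> 0" "\<iota> rk \<noteq> 0"
    unfolding iota_eq_0 by (simp_all add: vec_eq_iff forall_4)
  note t = sq[THEN arg_cong[of _ _ \<iota>], unfolded iota_simps]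
  show "\<iota> ri $ 1 = 0" using anticommute_pure[OF t(1,4) nz(1,2)] .
  show "\<iota> rj $ 1 = 0" using anticommute_pure[OF t(2,5) nz(2,1)] .
  show "\<iota> rk $ 1 = 0" using anticommute_pure[OF t(3,6) nz(3,1)] .
  show "\<iota> ri \<cdot> \<iota> rj = \<iota> rk" using ij[THEN arg_cong[of _ _ \<iota>]] by (simp add: iota_mult)
  show "\<iota> rk \<noteq> 0" by (rule nz)
qed

lemma iota_conj: "\<iota> (quat_conj x) = quat_conj (\<iota> x)"
proof -
  have "quat_conj x = x$1 *s rone + (- x$2) *s ri + (- x$3) *s rj + (- x$4) *s rk"
    by (simp add: vec_eq_iff forall_4 quat_conj_def)
  then have "\<iota> (quat_conj x) = of_rat (x$1) *\<^sub>R q1 - of_rat (x$2) *\<^sub>R \<iota> ri - of_rat (x$3) *\<^sub>R \<iota> rj - of_rat (x$4) *\<^sub>R \<iota> rk"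
    by (simp add: iota_simps of_rat_minus)
  moreover have "\<iota> x = of_rat (x$1) *\<^sub>R q1 + of_rat (x$2) *\<^sub>R \<iota> ri + of_rat (x$3) *\<^sub>R \<iota> rj + of_rat (x$4) *\<^sub>R \<iota> rk"
    by (subst rat4_decomp) (simp only: iota_simps)
  ultimately show ?thesis by (simp add: q_eq_iff iota_basis_pure)
qed

lemma nrm_iota: "nrm (\<iota> x) = of_rat (nq a b x)"
proof -
  have "x \<bullet>\<^sub>q quat_conj x = nq a b x *s rone"
    by (simp add: quat_mult_def quat_conj_def vec_eq_iff forall_4 nq_def power2_eq_square algebra_simps)
  from arg_cong[OF this, of \<iota>] have "nrm (\<iota> x) *\<^sub>R q1 = of_rat (nq a b x) *\<^sub>R q1"
    by (simp add: iota_simps iota_conj qm_conj)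
  then show ?thesis by (simp add: q_eq_iff)
qed

lemma order_ring: "subring \<O> (quat_alg a b)"
  using order by (simp add: quat_order_def)

lemma O_closed:
  shows "0 \<in> \<O>" "rone \<in> \<O>" "x \<in> \<O> \<Longrightarrow> y \<in> \<O> \<Longrightarrow> x + y \<in> \<O>" "x \<in> \<O> \<Longrightarrow> - x \<in> \<O>"
    "x \<in> \<O> \<Longrightarrow> y \<in> \<O> \<Longrightarrow> x \<bullet>\<^sub>q y \<in> \<O>"
  using subringE[OF order_ring] by (auto simp: quat_alg_a_inv)

lemma O_sigma: "x \<in> \<O> \<Longrightarrow> \<sigma> x \<in> \<O>"
  using eucl by (auto simp: sigma_euclidean_def involution_def)

lemma R_simps:
  "carrier R = \<O>" "mult R = quat_mult a b" "add R = (+)" "zero R = 0" "one R = rone"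
  by (simp_all add: quat_alg_def)

lemma R_a_inv: "x \<in> \<O> \<Longrightarrow> \<ominus>\<^bsub>R\<^esub> x = - x"
proof -
  assume x: "x \<in> \<O>"
  interpret ring R using eucl by (simp add: sigma_euclidean_def)
  show ?thesis using minus_equality[of "- x" x] x O_closed(4)[OF x] by simp
qed

lemma R_minus: "x \<in> \<O> \<Longrightarrow> y \<in> \<O> \<Longrightarrow> x \<ominus>\<^bsub>R\<^esub> y = x - y"
  by (simp add: a_minus_def R_a_inv)

text \<open>Finite generation gives all norms a common denominator (D E)^2, with D for the
  coordinates and E for the parameters. Since the norm is multiplicative, this bounds the
  denominators of all powers of one norm.\<close>

lemma nq_Ints: "x \<in> \<O> \<Longrightarrow> nq a b x \<in> \<int>"
proof -
  obtain B where B: "finite B" "generate (add_monoid (quat_alg a b)) B = \<O>"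
    using order by (auto simp: quat_order_def)
  let ?A = "(\<lambda>(x, i). x $ i) ` (B \<times> (UNIV :: 4 set))"
  have "finite ?A" using B(1) by simp
  from ex_common_denominator[OF this]
  obtain D :: nat where D: "0 < D" "\<And>x i. x \<in> B \<Longrightarrow> of_nat D * x $ i \<in> \<int>" by auto
  have DO: "of_nat D * x $ i \<in> \<int>" if "x \<in> \<O>" for x i
    using that unfolding B(2)[symmetric]
  proof (induction rule: generate.induct)
    case (inv h) then show ?case using D(2) unfolding add_monoid_inv by simp
  next
    case (eng h1 h2) then show ?case by (simp add: distrib_left)
  qed (use D in auto)
  from ex_common_denominator[of "{a, b}"]
  obtain E :: nat where E: "0 < E" "of_nat E * a \<in> \<int>" "of_nat E * b \<in> \<int>" by auto
  let ?F = "(D * E)\<^sup>2"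
  have F: "of_nat ?F * nq a b x \<in> \<int>" if "x \<in> \<O>" for x
  proof -
    define X where "X i = of_nat D * x $ i" for i
    define \<alpha> \<beta> where "\<alpha> = of_nat E * a" and "\<beta> = of_nat E * b"
    have I: "X i \<in> \<int>" "\<alpha> \<in> \<int>" "\<beta> \<in> \<int>" for i
      using DO[OF that] E by (simp_all add: X_def \<alpha>_def \<beta>_def)
    have "of_nat ?F * nq a b x = (of_nat E)\<^sup>2 * (X 1)\<^sup>2 - of_nat E * \<alpha> * (X 2)\<^sup>2
      - of_nat E * \<beta> * (X 3)\<^sup>2 + \<alpha> * \<beta> * (X 4)\<^sup>2"
      by (simp add: nq_def X_def \<alpha>_def \<beta>_def power2_eq_square algebra_simps)
    also have "\<dots> \<in> \<int>" using I by (intro Ints_add Ints_diff Ints_mult Ints_power) auto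
    finally show ?thesis .
  qed
  assume x: "x \<in> \<O>"
  have pw: "\<exists>y\<in>\<O>. nq a b y = nq a b x ^ m" for m
  proof (induction m)
    case 0
    show ?case by (intro bexI[of _ rone] O_closed) (simp add: nq_def)
  next
    case (Suc m)
    then obtain y where "y \<in> \<O>" "nq a b y = nq a b x ^ m" by blast
    then show ?case using x by (intro bexI[of _ "x \<bullet>\<^sub>q y"] O_closed) (auto simp: nq_mult)
  qed
  show ?thesis
  proof (rule rat_Ints_of_bounded_denominators[of ?F])
    show "0 < ?F" using D E by simp
    show "of_nat ?F * nq a b x ^ m \<in> \<int>" for m using F pw[of m] by metis
  qed
qed

lemma ex_component: "vec.subspace {x. P (\<iota> x)} \<Longrightarrow> \<not> P (\<iota> y) \<Longrightarrow> \<exists>x\<in>\<O>. \<not> P (\<iota> x)"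
  using vec.span_minimal[of \<O> "{x. P (\<iota> x)}"] order by (auto simp: quat_order_def)

sublocale E: euclidean_order "\<iota> ` \<O>"
proof
  show "q1 \<in> \<iota> ` \<O>" using O_closed(2) iota_one by (metis imageI)
  show "x + y \<in> \<iota> ` \<O>" if "x \<in> \<iota> ` \<O>" "y \<in> \<iota> ` \<O>" for x y
    using that O_closed(3) by (auto simp flip: iota_add)
  show "- x \<in> \<iota> ` \<O>" if "x \<in> \<iota> ` \<O>" for x
    using that O_closed(4) by (auto simp flip: iota_minus)
  show "x \<cdot> y \<in> \<iota> ` \<O>" if "x \<in> \<iota> ` \<O>" "y \<in> \<iota> ` \<O>" for x y
    using that O_closed(5) by (auto simp flip: iota_mult)
  show "ddag x \<in> \<iota> ` \<O>" if "x \<in> \<iota> ` \<O>" for x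
    using that O_sigma by (auto simp flip: iota_sigma)
  show "nrm x \<in> \<int>" if x: "x \<in> \<iota> ` \<O>" for x
  proof -
    obtain y where y: "y \<in> \<O>" "x = \<iota> y" using x by blast
    then obtain k where "nq a b y = of_int k" using nq_Ints by (metis Ints_cases)
    then show ?thesis by (simp add: y nrm_iota)
  qed
  show "\<exists>x\<in>\<iota> ` \<O>. x$4 \<noteq> 0"
  proof -
    have sub: "vec.subspace {x. \<iota> x $ 4 = 0}" by (auto simp: vec.subspace_def iota_simps)
    have "\<exists>y. \<iota> y $ 4 \<noteq> 0"
    proof (rule ccontr)
      assume "\<not> ?thesis"
      then have "\<iota> y $ 4 = 0" for y by blast
      \<comment> \<open>Pure quaternions without k-component have their product in the span of 1 and
        k; as the image of k is itself pure without k-component, it would be 0.\<close>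
      then have "\<iota> rk = 0" using iota_basis_pure arg_cong[OF iota_ij, of "\<lambda>v. v$2"] arg_cong[OF iota_ij, of "\<lambda>v. v$3"]
        by (simp add: q_eq_iff qm_nth)
      then show False using iota_rk_nonzero by simp
    qed
    then show ?thesis using ex_component[OF sub] by blast
  qed
  show "\<exists>x\<in>\<iota> ` \<O>. x$2 \<noteq> 0 \<or> x$3 \<noteq> 0"
  proof -
    have sub: "vec.subspace {x. \<iota> x $ 2 = 0 \<and> \<iota> x $ 3 = 0}" by (auto simp: vec.subspace_def iota_simps)
    have "\<exists>y. \<not> (\<iota> y $ 2 = 0 \<and> \<iota> y $ 3 = 0)"
    proof (rule ccontr)
      assume "\<not> ?thesis"
      then have 0: "\<iota> y $ 2 = 0" "\<iota> y $ 3 = 0" for y by blast+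
      \<comment> \<open>Here i and j would map to multiples of k, whose product is real.\<close>
      then have "\<iota> rk = 0" using iota_basis_pure arg_cong[OF iota_ij, of "\<lambda>v. v$4"]
        by (simp add: q_eq_iff qm_nth)
      then show False using iota_rk_nonzero by simp
    qed
    then obtain y where "\<not> (\<iota> y $ 2 = 0 \<and> \<iota> y $ 3 = 0)" by blast
    from ex_component[OF sub this] show ?thesis by blast
  qed
  show "\<exists>r. wf r \<and> (\<forall>x\<in>\<iota> ` \<O>. \<forall>y\<in>\<iota> ` \<O>. y \<noteq> 0 \<and> ddag (x \<cdot> ddag y) = x \<cdot> ddag y \<longrightarrow>
      (\<exists>q\<in>\<iota> ` \<O>. ddag q = q \<and> (x - y \<cdot> q, y) \<in> r))"
  proof -
    obtain W :: "(rat^4) rel" and \<Phi> where W: "Well_order W"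
      and "\<forall>x\<in>carrier R. \<forall>y\<in>carrier R. y \<noteq> \<zero>\<^bsub>R\<^esub> \<and> x \<otimes>\<^bsub>R\<^esub> \<sigma> y \<in> fixed_part R \<sigma> \<longrightarrow>
        (\<exists>q\<in>fixed_part R \<sigma>. (\<Phi> (x \<ominus>\<^bsub>R\<^esub> y \<otimes>\<^bsub>R\<^esub> q), \<Phi> y) \<in> W - Id)"
      using eucl unfolding sigma_euclidean_def by blast
    then have \<Phi>: "\<exists>q\<in>fixed_part R \<sigma>. (\<Phi> (x \<ominus>\<^bsub>R\<^esub> y \<bullet>\<^sub>q q), \<Phi> y) \<in> W - Id"
      if "x \<in> \<O>" "y \<in> \<O>" "y \<noteq> 0" "x \<bullet>\<^sub>q \<sigma> y \<in> fixed_part R \<sigma>" for x y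
      using that unfolding R_simps by blast
    \<comment> \<open>The Euclidean function lives on the rational algebra and is transported by
      inverting the embedding.\<close>
    let ?r = "inv_image (W - Id) (\<lambda>x. \<Phi> (inv_into UNIV \<iota> x))"
    have "wf ?r" using W by (intro wf_inv_image) (simp add: well_order_on_def)
    moreover have "\<exists>q\<in>\<iota> ` \<O>. ddag q = q \<and> (\<iota> x - \<iota> y \<cdot> q, \<iota> y) \<in> ?r"
      if xy: "x \<in> \<O>" "y \<in> \<O>" "\<iota> y \<noteq> 0" "ddag (\<iota> x \<cdot> ddag (\<iota> y)) = \<iota> x \<cdot> ddag (\<iota> y)" for x y
    proof -
      have "\<iota> (\<sigma> (x \<bullet>\<^sub>q \<sigma> y)) = \<iota> (x \<bullet>\<^sub>q \<sigma> y)" using xy(4) by (simp add: iota_simps)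
      then have "x \<bullet>\<^sub>q \<sigma> y \<in> fixed_part R \<sigma>"
        using xy O_closed(5) O_sigma by (simp add: fixed_part_def iota_eq_iff)
      from \<Phi>[OF xy(1,2) _ this] xy(3) obtain q where q: "q \<in> \<O>" "\<sigma> q = q" "(\<Phi> (x \<ominus>\<^bsub>R\<^esub> y \<bullet>\<^sub>q q), \<Phi> y) \<in> W - Id"
        by (auto simp: fixed_part_def iota_eq_0)
      have "x \<ominus>\<^bsub>R\<^esub> y \<bullet>\<^sub>q q = x - y \<bullet>\<^sub>q q" using xy q O_closed(5) by (simp add: R_minus)
      moreover have "inv_into UNIV \<iota> (\<iota> x - \<iota> y \<cdot> \<iota> q) = x - y \<bullet>\<^sub>q q" "inv_into UNIV \<iota> (\<iota> y) = y"
        using inj_iota by (simp_all add: inv_f_f flip: iota_diff iota_mult)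
      moreover have "ddag (\<iota> q) = \<iota> q" using q(2) by (simp flip: iota_sigma)
      ultimately show ?thesis using q by (intro bexI[of _ "\<iota> q"]) auto
    qed
    ultimately show ?thesis by (intro exI[of _ ?r]) blast
  qed
qed

lemma SL_image: "map_mat2 \<iota> M \<in> E.G \<longleftrightarrow> M \<in> SL_sigma R \<sigma>"
proof -
  obtain A B C D where M: "M = Mat2 A B C D" by (cases M)
  have mem: "\<iota> x \<in> \<iota> ` \<O> \<longleftrightarrow> x \<in> \<O>" for x using inj_iota by (simp add: inj_image_mem_iff)
  have "map_mat2 \<iota> M \<in> E.G \<longleftrightarrow> set_mat2 M \<subseteq> \<O> \<and> Mat2 (\<iota> A) (\<iota> B) (\<iota> C) (\<iota> D) \<in> SLH"
    by (auto simp: M E.G_iff mem)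
  also have "\<dots> \<longleftrightarrow> M \<in> SL_sigma R \<sigma>"
  proof (cases "set_mat2 M \<subseteq> \<O>")
    case True
    then have O: "A \<in> \<O>" "B \<in> \<O>" "C \<in> \<O>" "D \<in> \<O>" by (simp_all add: M)
    have "M \<in> SL_sigma R \<sigma> \<longleftrightarrow>
        A \<bullet>\<^sub>q \<sigma> D - B \<bullet>\<^sub>q \<sigma> C = rone \<and> B \<bullet>\<^sub>q \<sigma> A = A \<bullet>\<^sub>q \<sigma> B \<and>
        C \<bullet>\<^sub>q \<sigma> D = D \<bullet>\<^sub>q \<sigma> C \<and> D \<bullet>\<^sub>q \<sigma> A - C \<bullet>\<^sub>q \<sigma> B = rone \<and>
        \<sigma> D \<bullet>\<^sub>q A - \<sigma> B \<bullet>\<^sub>q C = rone \<and> \<sigma> D \<bullet>\<^sub>q B = \<sigma> B \<bullet>\<^sub>q D \<and>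
        \<sigma> A \<bullet>\<^sub>q C = \<sigma> C \<bullet>\<^sub>q A \<and> \<sigma> A \<bullet>\<^sub>q D - \<sigma> C \<bullet>\<^sub>q B = rone"
    proof -
      have neg: "x \<bullet>\<^sub>q (- y) = - (x \<bullet>\<^sub>q y)" "(- x) \<bullet>\<^sub>q y = - (x \<bullet>\<^sub>q y)" for x y
        by (simp_all add: iota_simps flip: iota_eq_iff)
      have s: "set_mat2 M \<subseteq> carrier R" using True by simp
      show ?thesis unfolding M using s[unfolded M] O
        by (simp only: SL_sigma_def mem_Collect_eq hat.simps mat2_mult.simps mat2_one_def mat2.inject
            R_a_inv O_sigma R_simps neg
            uminus_add_conv_diff add_uminus_conv_diff right_minus_eq simp_thms conj_assoc)
    qed
    also have "\<dots> \<longleftrightarrow> Mat2 (\<iota> A) (\<iota> B) (\<iota> C) (\<iota> D) \<in> SLH"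
      by (simp only: SLH_iff iota_simps flip: iota_eq_iff)
    finally show ?thesis using True by simp
  next
    case False
    then show ?thesis by (simp add: SL_sigma_def)
  qed
  finally show ?thesis .
qed

lemma G_eq: "E.G = map_mat2 \<iota> ` SL_sigma R \<sigma>"
proof -
  have "M \<in> map_mat2 \<iota> ` SL_sigma R \<sigma>" if M: "M \<in> E.G" for M
  proof -
    obtain A B C D where Md: "M = Mat2 A B C D" by (cases M)
    then obtain A' B' C' D' where "A = \<iota> A'" "B = \<iota> B'" "C = \<iota> C'" "D = \<iota> D'"
      using M by (auto simp: E.G_iff)
    then have "M = map_mat2 \<iota> (Mat2 A' B' C' D')" by (simp add: Md)
    then show ?thesis using M SL_image by blast
  qed
  then show ?thesis using SL_image by blast
qed

end

section \<open>Certificates\<close>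

text \<open>A checkable proof that all entries lie in the order, which the algorithm knows only
  through generators. Entries are justified by later ones, so chains can be concatenated.\<close>

fun sum_chain :: "(rat^4) list \<Rightarrow> (rat^4) list \<Rightarrow> bool" where
  "sum_chain gs [] \<longleftrightarrow> True"
| "sum_chain gs (x # l) \<longleftrightarrow> (x = 0 \<or> (\<exists>y\<in>set l. \<exists>g\<in>set gs. x = y + g \<or> x = y - g)) \<and> sum_chain gs l"

lemma sum_chain_nth:
  "sum_chain gs l \<longleftrightarrow> (\<forall>i<length l. l ! i = 0 \<or>
     (\<exists>y\<in>set (drop (Suc i) l). \<exists>g\<in>set gs. l ! i = y + g \<or> l ! i = y - g))"
  by (induction l) (simp_all add: All_less_Suc2)

text \<open>\<open>ball_list\<close> guarantees that \<open>os\<close> contains all elements of norm at most \<open>K\<close>: such an element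
  \<open>x\<close> is reached from 0 by repeatedly doubling and adding \<open>0\<close> or \<open>\<plusminus>g\<close> for each generator \<open>g\<close>,
  following the binary digits of the coefficients of \<open>x\<close>, without leaving the ball of norm \<open>9 K\<close>.\<close>

definition ball_list :: "rat \<Rightarrow> rat \<Rightarrow> (rat^4) list \<Rightarrow> nat \<Rightarrow> rat \<Rightarrow> (rat^4) list \<Rightarrow> bool" where
  "ball_list a b gs L K os \<longleftrightarrow> sum_chain gs os \<and> 0 \<in> set os \<and>
     (\<forall>x\<in>set os. nq a b (2 *s x) \<le> 9 * K \<longrightarrow> 2 *s x \<in> set os) \<and>
     (\<forall>x\<in>set os. \<forall>g\<in>set gs. (nq a b (x + g) \<le> 9 * K \<longrightarrow> x + g \<in> set os) \<and>
        (nq a b (x - g) \<le> 9 * K \<longrightarrow> x - g \<in> set os)) \<and>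
     length gs \<le> L \<and> (\<forall>g\<in>set gs. (of_nat L)\<^sup>2 * nq a b g \<le> K)"

text \<open>The equations of \<open>SLH_iff\<close> in rational form. Membership in the order is
  certified separately, by \<open>sum_chain\<close>.\<close>

definition SLq :: "rat \<Rightarrow> rat \<Rightarrow> (rat^4 \<Rightarrow> rat^4) \<Rightarrow> rat^4 \<Rightarrow> rat^4 \<Rightarrow> rat^4 \<Rightarrow> rat^4 \<Rightarrow> bool" where
  "SLq a b \<sigma> A B C D \<longleftrightarrow>
     quat_mult a b A (\<sigma> D) - quat_mult a b B (\<sigma> C) = rone \<and> quat_mult a b B (\<sigma> A) = quat_mult a b A (\<sigma> B) \<and>
     quat_mult a b C (\<sigma> D) = quat_mult a b D (\<sigma> C) \<and> quat_mult a b D (\<sigma> A) - quat_mult a b C (\<sigma> B) = rone \<and>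
     quat_mult a b (\<sigma> D) A - quat_mult a b (\<sigma> B) C = rone \<and> quat_mult a b (\<sigma> D) B = quat_mult a b (\<sigma> B) D \<and>
     quat_mult a b (\<sigma> A) C = quat_mult a b (\<sigma> C) A \<and> quat_mult a b (\<sigma> A) D - quat_mult a b (\<sigma> C) B = rone"

text \<open>Triviality of the stabilizer is tested by the fixed point equation multiplied by its
  denominator, so nothing is inverted.\<close>

definition group_list :: "rat \<Rightarrow> rat \<Rightarrow> (rat^4 \<Rightarrow> rat^4) \<Rightarrow> (rat^4) list \<Rightarrow> rat^4 \<Rightarrow> (rat^4) mat2 list \<Rightarrow> bool" where
  "group_list a b \<sigma> os z Ms \<longleftrightarrow>
     (\<forall>M\<in>set Ms. case M of Mat2 A B C D \<Rightarrow> A \<in> set os \<and> B \<in> set os \<and> C \<in> set os \<and> D \<in> set os \<and> SLq a b \<sigma> A B C D \<and>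
        (M = Mat2 rone 0 0 rone \<or> M = Mat2 (- rone) 0 0 (- rone) \<or>
         quat_mult a b A z + B \<noteq> quat_mult a b z (quat_mult a b C z + D))) \<and>
     (\<forall>A\<in>set os. \<forall>B\<in>set os. \<forall>C\<in>set os. \<forall>D\<in>set os. SLq a b \<sigma> A B C D \<longrightarrow> Mat2 A B C D \<in> set Ms)"

text \<open>Rational counterpart of \<open>box_point\<close>: half of z + \<sigma> z embeds to the
  horizontal part of z.\<close>

definition rbox :: "(rat^4 \<Rightarrow> rat^4) \<Rightarrow> rat^4 \<Rightarrow> rat^4 \<Rightarrow> rat^4 \<Rightarrow> rat \<Rightarrow> rat \<Rightarrow> rat \<Rightarrow> rat \<Rightarrow> rat^4" where
  "rbox \<sigma> z e2 e3 y1 y2 y3 s = (1/2) *s (z + \<sigma> z) + y1 *s rone + y2 *s e2 + y3 *s e3 + s *s (z - \<sigma> z)"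

definition rgdist :: "rat \<Rightarrow> rat \<Rightarrow> rat^4 \<Rightarrow> (rat^4) mat2 \<Rightarrow> rat^4 \<Rightarrow> rat" where
  "rgdist a b z M w = (case M of Mat2 A B C D \<Rightarrow>
     nq a b (quat_mult a b w (quat_mult a b C z + D) - (quat_mult a b A z + B)) - nq a b (w - z))"

text \<open>Orthogonality is expressed by additivity of the norm. That e2 and e3 are fixed by the
  involution follows because their translations occur among the listed group elements.\<close>

definition grid_list :: "rat \<Rightarrow> rat \<Rightarrow> (rat^4 \<Rightarrow> rat^4) \<Rightarrow> rat^4 \<Rightarrow> (rat^4) mat2 list \<Rightarrow> rat \<Rightarrow> rat^4 \<Rightarrow> rat^4 \<Rightarrow> nat \<Rightarrow> bool" where
  "grid_list a b \<sigma> z Ms K e2 e3 N \<longleftrightarrow>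
     Mat2 rone rone 0 rone \<in> set Ms \<and> Mat2 rone (- rone) 0 rone \<in> set Ms \<and>
     Mat2 rone e2 0 rone \<in> set Ms \<and> Mat2 rone (- e2) 0 rone \<in> set Ms \<and>
     Mat2 rone e3 0 rone \<in> set Ms \<and> Mat2 rone (- e3) 0 rone \<in> set Ms \<and>
     e2 \<noteq> 0 \<and> e3 \<noteq> 0 \<and> nq a b (rone + e2) = 1 + nq a b e2 \<and> nq a b (rone + e3) = 1 + nq a b e3 \<and>
     nq a b (e2 + e3) = nq a b e2 + nq a b e3 \<and> 2 \<le> N \<and>
     entry_bound (nq a b (z + \<sigma> z) / 4) (nq a b (z - \<sigma> z) / 4) ((1 + nq a b e2 + nq a b e3) / 4) (of_nat N) \<le> K \<and>
     (\<forall>m1<N. \<forall>m2<N. \<forall>m3<N. \<exists>M\<in>set Ms. \<forall>i1<2. \<forall>i2<2. \<forall>i3<2. \<forall>h<2.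
        rgdist a b z M (rbox \<sigma> z e2 e3 (of_nat (m1 + i1) / of_nat N - 1/2) (of_nat (m2 + i2) / of_nat N - 1/2)
          (of_nat (m3 + i3) / of_nat N - 1/2) (of_nat h / of_nat N)) < 0)"

text \<open>The positive factor r puts z on the same side of the boundary as u. The bound 4 means
  height at least 1, since z - \<sigma> z embeds to 2 z$4 k.\<close>

definition dirichlet_certificate where
  "dirichlet_certificate a b \<sigma> gs u z Ms os K L r e2 e3 N \<longleftrightarrow>
     0 < r \<and> z - \<sigma> z = r *s (u - \<sigma> u) \<and> 4 \<le> nq a b (z - \<sigma> z) \<and>
     ball_list a b gs L K os \<and> group_list a b \<sigma> os z Ms \<and> grid_list a b \<sigma> z Ms K e2 e3 N"

section \<open>Integer combinations of the generators\<close>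

definition comb :: "(rat^4) list \<Rightarrow> (nat \<Rightarrow> int) \<Rightarrow> rat^4" where
  "comb gs c = (\<Sum>i<length gs. of_int (c i) *s gs ! i)"

lemma comb_zero: "comb gs (\<lambda>_. 0) = 0"
  and comb_add: "comb gs (\<lambda>i. c i + d i) = comb gs c + comb gs d"
  and comb_minus: "comb gs (\<lambda>i. - c i) = - comb gs c"
  by (simp_all add: comb_def sum.distrib sum_negf vec.scale_left_distrib)

lemma comb_single: "j < length gs \<Longrightarrow> comb gs (\<lambda>i. if i = j then 1 else 0) = gs ! j"
proof -
  assume j: "j < length gs"
  have "comb gs (\<lambda>i. if i = j then 1 else 0) = (\<Sum>i<length gs. if i = j then gs ! i else 0)"
    unfolding comb_def by (intro sum.cong) auto
  then show ?thesis using j by simp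
qed

lemma sum_chain_append: "sum_chain gs l1 \<Longrightarrow> sum_chain gs l2 \<Longrightarrow> sum_chain gs (l1 @ l2)"
  by (induction l1) auto

text \<open>Each link moves one coefficient by one towards 0; how far the chain leaves a ball is
  irrelevant here.\<close>

lemma ex_sum_chain_comb: "\<exists>l. sum_chain gs l \<and> comb gs c \<in> set l"
proof (induction "\<Sum>i<length gs. nat \<bar>c i\<bar>" arbitrary: c rule: less_induct)
  case less
  let ?n = "length gs"
  show ?case
  proof (cases "\<forall>i<?n. c i = 0")
    case True
    then have "comb gs c = 0" by (simp add: comb_def)
    then show ?thesis by (intro exI[of _ "[0]"]) simp
  next
    case False
    then obtain j where j: "j < ?n" "c j \<noteq> 0" by blast
    define s where "s = sgn (c j)"
    define d where "d = (\<lambda>i. if i = j then 1 else 0 :: int)"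
    have s: "s = 1 \<or> s = - 1" using j by (simp add: s_def sgn_if)
    define c' where "c' i = c i - s * d i" for i
    have abs_c': "nat \<bar>c' i\<bar> \<le> nat \<bar>c i\<bar>" "nat \<bar>c' j\<bar> < nat \<bar>c j\<bar>" for i
      using j by (auto simp: c'_def d_def s_def sgn_if)
    have "(\<Sum>i<?n. nat \<bar>c' i\<bar>) < (\<Sum>i<?n. nat \<bar>c i\<bar>)"
      using abs_c' j by (intro sum_strict_mono_ex1) auto
    from less.hyps[OF this] obtain l where l: "sum_chain gs l" "comb gs c' \<in> set l" by blast
    have g: "comb gs d = gs ! j" using comb_single[OF j(1)] by (simp add: d_def)
    have "comb gs c = comb gs c' + gs ! j \<or> comb gs c = comb gs c' - gs ! j"
    proof -
      have "c = (\<lambda>i. c' i + s * d i)" by (simp add: c'_def)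
      then have eq: "comb gs c = comb gs c' + comb gs (\<lambda>i. s * d i)" using comb_add by metis
      show ?thesis using s
      proof
        assume "s = 1" then show ?thesis using eq g by simp
      next
        assume "s = - 1" then show ?thesis using eq g by (simp add: comb_minus)
      qed
    qed
    moreover have "gs ! j \<in> set gs" using j(1) by simp
    ultimately have "sum_chain gs (comb gs c # l)" unfolding sum_chain.simps using l by blast
    then show ?thesis by (intro exI[of _ "comb gs c # l"]) simp
  qed
qed

section \<open>Soundness of certificates\<close>

context embedded_order
begin

lemma SLq_iff: "Mat2 A B C D \<in> SL_sigma R \<sigma> \<longleftrightarrow> A \<in> \<O> \<and> B \<in> \<O> \<and> C \<in> \<O> \<and> D \<in> \<O> \<and> SLq a b \<sigma> A B C D"
proof -
  have "SLq a b \<sigma> A B C D \<longleftrightarrow> Mat2 (\<iota> A) (\<iota> B) (\<iota> C) (\<iota> D) \<in> SLH"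
    by (simp only: SLH_iff SLq_def iota_simps flip: iota_eq_iff)
  moreover have "\<iota> x \<in> \<iota> ` \<O> \<longleftrightarrow> x \<in> \<O>" for x using inj_iota by (simp add: inj_image_mem_iff)
  ultimately show ?thesis using SL_image[of "Mat2 A B C D"] by (auto simp: E.G_iff)
qed

lemma iota_rbox:
  "\<iota> (rbox \<sigma> z e2 e3 y1 y2 y3 s) =
     box_point (\<iota> z) (\<iota> e2) (\<iota> e3) (of_rat y1) (of_rat y2) (of_rat y3) (of_rat s)"
proof -
  have "of_rat (1/2) *\<^sub>R (\<iota> z + ddag (\<iota> z)) = hor (\<iota> z)" by (simp add: q_eq_iff of_rat_divide)
  then show ?thesis by (simp only: rbox_def box_point_def iota_simps)
qed

lemma of_rat_rgdist: "of_rat (rgdist a b z M w) = gdist (\<iota> z) (map_mat2 \<iota> M) (\<iota> w)"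
  by (cases M) (simp add: rgdist_def gdist_def of_rat_diff flip: nrm_iota iota_simps)

lemma nq_nonneg: "0 \<le> nq a b x"
  using nrm_nonneg[of "\<iota> x"] by (simp add: nrm_iota)

lemma nq_hor: "of_rat (nq a b (z + \<sigma> z) / 4) = nrm (hor (\<iota> z))"
  and nq_ver: "of_rat (nq a b (z - \<sigma> z) / 4) = (\<iota> z $ 4)\<^sup>2"
  by (simp_all add: of_rat_divide iota_simps flip: nrm_iota)
    (simp_all add: nrm_eq power2_eq_square)

lemma of_rat_entry_bound:
  "(of_rat (entry_bound x y z w) :: real) = entry_bound (of_rat x) (of_rat y) (of_rat z) (of_rat w)"
  by (simp add: entry_bound_def of_rat_add of_rat_mult of_rat_divide of_rat_power)

lemma sum_chain_subset:
  assumes "sum_chain gs l" "set gs \<subseteq> \<O>"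
  shows "set l \<subseteq> \<O>"
  using assms(1)
proof (induction l)
  case (Cons x l)
  then have l: "set l \<subseteq> \<O>" by simp
  consider "x = 0" | y g where "y \<in> set l" "g \<in> set gs" "x = y + g \<or> x = y + - g"
    using Cons.prems by auto
  then have "x \<in> \<O>"
  proof cases
    case 2
    then have "y \<in> \<O>" "g \<in> \<O>" using l assms(2) by auto
    then show ?thesis using 2(3) O_closed(3,4) by blast
  qed (simp add: O_closed)
  then show ?case using l by simp
qed simp

lemma generate_comb:
  assumes "x \<in> generate (add_monoid (quat_alg a b)) (set gs)"
  shows "\<exists>c. x = comb gs c"
  using assms
proof (induction rule: generate.induct)
  case one
  show ?case by (intro exI[of _ "\<lambda>_. 0"]) (simp add: comb_zero)
next
  case (incl h)
  then obtain j where "j < length gs" "h = gs ! j" by (auto simp: in_set_conv_nth)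
  then show ?case using comb_single by metis
next
  case (inv h)
  then obtain j where "j < length gs" "h = gs ! j" by (auto simp: in_set_conv_nth)
  then have "inv\<^bsub>add_monoid (quat_alg a b)\<^esub> h = comb gs (\<lambda>i. - (if i = j then 1 else 0))"
    unfolding add_monoid_inv comb_minus using comb_single by metis
  then show ?case by blast
next
  case (eng h1 h2)
  then obtain c d where "h1 = comb gs c" "h2 = comb gs d" by blast
  then have "h1 \<otimes>\<^bsub>add_monoid (quat_alg a b)\<^esub> h2 = comb gs (\<lambda>i. c i + d i)" by (simp add: comb_add)
  then show ?case by blast
qed

lemma ball_list_complete:
  assumes bl: "ball_list a b gs L K os"
    and gen: "generate (add_monoid (quat_alg a b)) (set gs) = \<O>"
  shows "x \<in> \<O> \<Longrightarrow> nq a b x \<le> K \<Longrightarrow> x \<in> set os"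
proof -
  have zero: "0 \<in> set os" and dbl: "\<And>x. x \<in> set os \<Longrightarrow> nq a b (2 *s x) \<le> 9 * K \<Longrightarrow> 2 *s x \<in> set os"
    and add: "\<And>x g. x \<in> set os \<Longrightarrow> g \<in> set gs \<Longrightarrow> nq a b (x + g) \<le> 9 * K \<Longrightarrow> x + g \<in> set os"
    and sub: "\<And>x g. x \<in> set os \<Longrightarrow> g \<in> set gs \<Longrightarrow> nq a b (x - g) \<le> 9 * K \<Longrightarrow> x - g \<in> set os"
    and L: "length gs \<le> L" and g: "\<And>g. g \<in> set gs \<Longrightarrow> (of_nat L)\<^sup>2 * nq a b g \<le> K"
    using bl by (auto simp: ball_list_def)
  have le: "nq a b x \<le> B \<longleftrightarrow> norm (\<iota> x) \<le> sqrt (of_rat B)" if "0 \<le> B" for x B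
  proof -
    have "nq a b x \<le> B \<longleftrightarrow> nrm (\<iota> x) \<le> of_rat B" by (simp add: nrm_iota of_rat_less_eq)
    also have "\<dots> \<longleftrightarrow> norm (\<iota> x) \<le> sqrt (of_rat B)"
      using real_sqrt_le_iff[of "(norm (\<iota> x))\<^sup>2" "of_rat B"] by (simp add: nrm_norm)
    finally show ?thesis .
  qed
  have "comb gs c \<in> set os" if "nq a b (comb gs c) \<le> K" for c
    using that
  proof (induction "\<Sum>i<length gs. nat \<bar>c i\<bar>" arbitrary: c rule: less_induct)
    case less
    let ?n = "length gs"
    have K: "0 \<le> K" using less.prems nq_nonneg order_trans by blast
    define s where "s = sqrt (of_rat K)"
    have s0: "0 \<le> s" using K by (simp add: s_def)
    have s3: "sqrt (of_rat (9 * K)) = 3 * s"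
      by (simp add: s_def of_rat_mult real_sqrt_mult)
    have leK: "nq a b x \<le> K \<longleftrightarrow> norm (\<iota> x) \<le> s" and le9: "nq a b x \<le> 9 * K \<longleftrightarrow> norm (\<iota> x) \<le> 3 * s" for x
      using le[of K x] le[of "9 * K" x] K s3 by (simp_all add: s_def)
    show ?case
    proof (cases "\<forall>i<?n. c i = 0")
      case True
      then have "comb gs c = 0" by (simp add: comb_def)
      then show ?thesis using zero by simp
    next
      case False
      \<comment> \<open>Halving rounds towards 0, so the remainders lie in {-1, 0, 1} and every
        nonzero coefficient shrinks.\<close>
      define c' where "c' i = (if 0 \<le> c i then c i div 2 else - ((- c i) div 2))" for i
      define r where "r i = c i - 2 * c' i" for i
      have r: "r i \<in> {- 1, 0, 1}" for i
      proof -
        have "0 \<le> x \<Longrightarrow> x - 2 * (x div 2) \<in> {0, 1}" for x :: int by auto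
        from this[of "c i"] this[of "- c i"] show ?thesis by (auto simp: r_def c'_def)
      qed
      have c': "nat \<bar>c' i\<bar> \<le> nat \<bar>c i\<bar>" "c i \<noteq> 0 \<Longrightarrow> nat \<bar>c' i\<bar> < nat \<bar>c i\<bar>" for i
        by (auto simp: c'_def)
      obtain j where "j < ?n" "c j \<noteq> 0" using False by blast
      then have smaller: "(\<Sum>i<?n. nat \<bar>c' i\<bar>) < (\<Sum>i<?n. nat \<bar>c i\<bar>)"
        using c' by (intro sum_strict_mono_ex1) auto
      have gn: "real L * norm (\<iota> (gs ! i)) \<le> s" if "i < ?n" for i
      proof -
        have "real L * norm (\<iota> (gs ! i)) = norm (\<iota> (of_nat L *s gs ! i))"
          by (simp add: iota_simps)
        also have "nq a b (of_nat L *s gs ! i) = (of_nat L)\<^sup>2 * nq a b (gs ! i)"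
          by (simp add: nq_def power2_eq_square algebra_simps)
        then have "norm (\<iota> (of_nat L *s gs ! i)) \<le> s"
          using g[of "gs ! i"] that leK[of "of_nat L *s gs ! i"] by simp
        finally show ?thesis .
      qed
      define p where "p J = (\<Sum>i\<in>J. of_int (r i) *s gs ! i)" for J
      \<comment> \<open>At most L generators take part, each of length at most s / L, where s is the
        square root of K.\<close>
      have pn: "norm (\<iota> (p J)) \<le> s" if "J \<subseteq> {..<?n}" for J
      proof -
        have fin: "finite J" using that finite_subset by blast
        then have "\<iota> (p J) = (\<Sum>i\<in>J. of_int (r i) *\<^sub>R \<iota> (gs ! i))"
          unfolding p_def by (induction J) (simp_all add: iota_simps)
        then have "norm (\<iota> (p J)) \<le> (\<Sum>i\<in>J. norm ((of_int (r i) :: real) *\<^sub>R \<iota> (gs ! i)))"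
          by (simp add: norm_sum del: norm_scaleR)
        also have "\<dots> \<le> (\<Sum>i\<in>J. norm (\<iota> (gs ! i)))"
        proof (intro sum_mono)
          fix i
          have "\<bar>of_int (r i) :: real\<bar> \<le> 1" using r[of i] by auto
          then show "norm ((of_int (r i) :: real) *\<^sub>R \<iota> (gs ! i)) \<le> norm (\<iota> (gs ! i))"
            by (simp add: mult_left_le_one_le)
        qed
        also have "\<dots> \<le> (\<Sum>i\<in>J. s / real L)"
        proof (intro sum_mono)
          fix i assume "i \<in> J"
          then have i: "i < ?n" using that by auto
          then have "0 < L" using L by linarith
          then show "norm (\<iota> (gs ! i)) \<le> s / real L" using gn[OF i] by (simp add: field_simps)
        qed
        also have "\<dots> = real (card J) * (s / real L)" by simp
        also have "\<dots> \<le> s"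
        proof (cases "L = 0")
          case False
          have "card J \<le> ?n" using card_mono[OF _ that] by simp
          then have "real (card J) * (s / real L) \<le> real L * (s / real L)"
            using L s0 by (intro mult_right_mono) auto
          then show ?thesis using False by simp
        qed (use s0 in simp)
        finally show ?thesis .
      qed
      have dec: "comb gs c = 2 *s comb gs c' + p {..<?n}"
        by (simp add: comb_def p_def vec.scale_sum_right r_def vec.scale_left_diff_distrib flip: sum.distrib)
      have nc: "norm (\<iota> (comb gs c)) \<le> s" using less.prems leK by simp
      \<comment> \<open>The target and the remainder both have length at most s, hence so does half
        of their difference, and the induction hypothesis applies to it.\<close>
      have e2: "2 *\<^sub>R \<iota> (comb gs c') = \<iota> (comb gs c) - \<iota> (p {..<?n})"
        unfolding dec by (simp add: iota_simps)
      have "2 * norm (\<iota> (comb gs c')) \<le> s + s"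
        using norm_triangle_ineq4[of "\<iota> (comb gs c)" "\<iota> (p {..<?n})"] nc pn[of "{..<?n}"]
        by (simp flip: e2)
      then have "comb gs c' \<in> set os" using less.hyps[OF smaller] leK by simp
      have start: "2 *s comb gs c' \<in> set os"
      proof (rule dbl)
        show "comb gs c' \<in> set os" by fact
        have "norm (\<iota> (2 *s comb gs c')) \<le> s + s"
          using \<open>2 * norm (\<iota> (comb gs c')) \<le> s + s\<close> by (simp add: iota_simps)
        then show "nq a b (2 *s comb gs c') \<le> 9 * K" unfolding le9 using s0 by linarith
      qed
      have "2 *s comb gs c' + p {..<k} \<in> set os" if "k \<le> ?n" for k
        using that
      proof (induction k)
        case 0
        then show ?case using start by (simp add: p_def)
      next
        case (Suc k)
        let ?y = "2 *s comb gs c' + p {..<k}"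
        have y: "?y \<in> set os" using Suc by simp
        have pS: "p {..<Suc k} = p {..<k} + of_int (r k) *s gs ! k" by (simp add: p_def)
        have gk: "gs ! k \<in> set gs" using Suc.prems by simp
        have split: "p {..<?n} = p {..<Suc k} + p {Suc k..<?n}"
        proof -
          have "{..<?n} = {..<Suc k} \<union> {Suc k..<?n}" using Suc.prems by auto
          moreover have "p ({..<Suc k} \<union> {Suc k..<?n}) = p {..<Suc k} + p {Suc k..<?n}"
            unfolding p_def by (rule sum.union_disjoint) auto
          ultimately show ?thesis by (simp only:)
        qed
        \<comment> \<open>An intermediate sum differs from the target only by the remaining
          summands. It stays within 2 s, inside the radius 3 s that 9 K allows.\<close>
        have "2 *s comb gs c' + p {..<Suc k} = comb gs c - p {Suc k..<?n}"
          unfolding dec split by simp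
        then have "norm (\<iota> (2 *s comb gs c' + p {..<Suc k})) \<le> s + s"
          using norm_triangle_ineq4[of "\<iota> (comb gs c)" "\<iota> (p {Suc k..<?n})"] nc pn[of "{Suc k..<?n}"]
          by (simp add: iota_diff lessThan_atLeast0 del: sum.lessThan_Suc)
        then have n9: "nq a b (2 *s comb gs c' + p {..<Suc k}) \<le> 9 * K" unfolding le9 using s0 by linarith
        consider "r k = 0" | "r k = 1" | "r k = - 1" using r[of k] by auto
        then show ?case
        proof cases
          case 1 then show ?thesis using y pS by simp
        next
          case 2
          then have eq: "2 *s comb gs c' + p {..<Suc k} = ?y + gs ! k" using pS by simp
          show ?thesis unfolding eq by (rule add[OF y gk n9[unfolded eq]])
        next
          case 3
          then have eq: "2 *s comb gs c' + p {..<Suc k} = ?y - gs ! k" using pS by simp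
          show ?thesis unfolding eq by (rule sub[OF y gk n9[unfolded eq]])
        qed
      qed
      from this[of ?n] show ?thesis using dec by simp
    qed
  qed
  then show "x \<in> \<O> \<Longrightarrow> nq a b x \<le> K \<Longrightarrow> x \<in> set os"
    using generate_comb[of x gs] gen by auto
qed


lemma describes_iff:
  "describes_dirichlet_domain a b \<sigma> \<O> \<iota> z Ms \<longleftrightarrow> \<iota> z \<in> H4 \<and>
     (\<forall>M\<in>SL_sigma R \<sigma>. moebius (map_mat2 \<iota> M) (\<iota> z) = \<iota> z \<longrightarrow> M = Mat2 rone 0 0 rone \<or> M = Mat2 (- rone) 0 0 (- rone)) \<and>
     set Ms \<subseteq> SL_sigma R \<sigma> \<and>
     (\<forall>w\<in>H4. (\<forall>M\<in>set Ms. 0 \<le> gdist (\<iota> z) (map_mat2 \<iota> M) w) \<longleftrightarrow> (\<forall>M\<in>E.G. 0 \<le> gdist (\<iota> z) M w))"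
proof (cases "\<iota> z \<in> H4 \<and> set Ms \<subseteq> SL_sigma R \<sigma>")
  case True
  have one: "mat2_one R = Mat2 rone 0 0 rone" "mat2_minus_one R = Mat2 (- rone) 0 0 (- rone)"
    using R_a_inv[OF O_closed(2)] by (simp_all add: mat2_one_def mat2_minus_one_def R_simps)
  have d: "hyp_dist w (\<iota> z) \<le> hyp_dist w (moebius (map_mat2 \<iota> M) (\<iota> z)) \<longleftrightarrow> 0 \<le> gdist (\<iota> z) (map_mat2 \<iota> M) w"
    if "w \<in> H4" "M \<in> SL_sigma R \<sigma>" for w M
    using that True SL_image E.G_SLH by (intro hyp_dist_moebius_le_iff) auto
  have "dirichlet_domain H4 hyp_dist (SL_sigma R \<sigma>) (\<lambda>M. moebius (map_mat2 \<iota> M)) (\<iota> z) =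
      {w \<in> H4. \<forall>M\<in>E.G. 0 \<le> gdist (\<iota> z) M w}"
    unfolding dirichlet_domain_def G_eq using d by auto
  moreover have "{w \<in> H4. \<forall>M\<in>set Ms. hyp_dist w (\<iota> z) \<le> hyp_dist w (moebius (map_mat2 \<iota> M) (\<iota> z))} =
      {w \<in> H4. \<forall>M\<in>set Ms. 0 \<le> gdist (\<iota> z) (map_mat2 \<iota> M) w}"
    using d True by auto
  ultimately show ?thesis using True
    unfolding describes_dirichlet_domain_def Let_def one by auto
next
  case False
  then show ?thesis unfolding describes_dirichlet_domain_def Let_def by auto
qed

lemma orthogonal_iota_iff:
  "nq a b (x + y) = nq a b x + nq a b y \<longleftrightarrow> inner (\<iota> x) (\<iota> y) = 0"
proof -
  have "nq a b (x + y) = nq a b x + nq a b y \<longleftrightarrow>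
      (of_rat (nq a b (x + y)) :: real) = of_rat (nq a b x) + of_rat (nq a b y)"
    by (simp flip: of_rat_add)
  also have "\<dots> \<longleftrightarrow> inner (\<iota> x) (\<iota> y) = 0"
    unfolding nrm_iota[symmetric] iota_add by (simp add: nrm_inner inner_add_left inner_add_right inner_commute)
  finally show ?thesis .
qed

lemma nq_one: "nq a b rone = 1"
  by (simp add: nq_def)

lemma certificate_sound:
  assumes gen: "generate (add_monoid (quat_alg a b)) (set gs) = \<O>" and u: "\<iota> u \<in> H4"
    and cert: "dirichlet_certificate a b \<sigma> gs u z Ms os K L r e2 e3 N"
  shows "describes_dirichlet_domain a b \<sigma> \<O> \<iota> z Ms"
proof -
  have r: "0 < r" and zu: "z - \<sigma> z = r *s (u - \<sigma> u)" and z4: "4 \<le> nq a b (z - \<sigma> z)"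
    and bl: "ball_list a b gs L K os" and gl: "group_list a b \<sigma> os z Ms" and gr: "grid_list a b \<sigma> z Ms K e2 e3 N"
    using cert unfolding dirichlet_certificate_def by blast+
  let ?z = "\<iota> z" and ?Ms = "map_mat2 \<iota> ` set Ms"
  have "2 * ?z $ 4 = of_rat r * (2 * \<iota> u $ 4)"
    using arg_cong[OF zu, of "\<lambda>v. \<iota> v $ 4"] by (simp add: iota_simps)
  then have zH: "?z \<in> H4" using u r by (simp add: H4_def)
  have "1 \<le> (?z $ 4)\<^sup>2"
  proof -
    have "1 \<le> nq a b (z - \<sigma> z) / 4" using z4 by simp
    then have "(of_rat 1 :: real) \<le> of_rat (nq a b (z - \<sigma> z) / 4)" by (simp only: of_rat_less_eq)
    then show ?thesis unfolding nq_ver by simp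
  qed
  then have z1: "1 \<le> ?z $ 4" using zH abs_le_square_iff[of 1 "?z $ 4"] by (simp add: H4_def)
  have os: "set os \<subseteq> \<O>"
  proof (rule sum_chain_subset)
    show "sum_chain gs os" using bl by (simp add: ball_list_def)
    show "set gs \<subseteq> \<O>" using generate.incl[of _ "set gs" "add_monoid (quat_alg a b)"] unfolding gen by blast
  qed
  note gl1 = conjunct1[OF gl[unfolded group_list_def]] and gl2 = conjunct2[OF gl[unfolded group_list_def]]
  have MsSL: "set Ms \<subseteq> SL_sigma R \<sigma>"
  proof
    fix M assume M: "M \<in> set Ms"
    obtain A B C D where Md: "M = Mat2 A B C D" by (cases M)
    have "A \<in> set os \<and> B \<in> set os \<and> C \<in> set os \<and> D \<in> set os \<and> SLq a b \<sigma> A B C D"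
      using bspec[OF gl1 M] unfolding Md mat2.case by blast
    then show "M \<in> SL_sigma R \<sigma>" unfolding Md SLq_iff using os by blast
  qed
  then have MsG: "?Ms \<subseteq> E.G" using SL_image by blast
  have mem: "M \<in> set Ms" if M: "M \<in> SL_sigma R \<sigma>" and K: "\<forall>x\<in>set_mat2 (map_mat2 \<iota> M). nrm x \<le> of_rat K" for M
  proof -
    obtain A B C D where Md: "M = Mat2 A B C D" by (cases M)
    have "x \<in> set os" if "x \<in> {A, B, C, D}" for x
    proof -
      have "x \<in> \<O>" using that M unfolding Md SLq_iff by blast
      moreover have "nq a b x \<le> K" using that K by (auto simp: Md nrm_iota of_rat_less_eq)
      ultimately show ?thesis using ball_list_complete[OF bl gen] by blast
    qed
    then show ?thesis using gl2 M unfolding Md SLq_iff by blast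
  qed
  have en: "orthogonal_triple (\<iota> e2) (\<iota> e3)"
  proof -
    have fix4: "\<iota> e $ 4 = 0" if "Mat2 rone e 0 rone \<in> set Ms" for e
    proof -
      have "Mat2 (\<iota> rone) (\<iota> e) (\<iota> 0) (\<iota> rone) \<in> SLH" using MsSL that SL_image[of "Mat2 rone e 0 rone"] E.G_SLH by auto
      then have "\<iota> e = ddag (\<iota> e)" by (simp add: SLH_iff iota_simps)
      then show ?thesis using ddag_fixed_iff by metis
    qed
    have "inner (\<iota> rone) (\<iota> e2) = 0" "inner (\<iota> rone) (\<iota> e3) = 0" "inner (\<iota> e2) (\<iota> e3) = 0"
      using gr unfolding orthogonal_iota_iff[symmetric] nq_one by (auto simp: grid_list_def)
    then show ?thesis using gr fix4 unfolding orthogonal_triple_def iota_one iota_eq_0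
      by (auto simp: grid_list_def)
  qed
  have N: "2 \<le> N" using gr by (simp add: grid_list_def)
  have C: "(1 + nrm (\<iota> e2) + nrm (\<iota> e3)) / 4 = of_rat ((1 + nq a b e2 + nq a b e3) / 4)"
    by (simp add: nrm_iota of_rat_divide of_rat_add)
  have Kb: "entry_bound (nrm (hor ?z)) ((?z$4)\<^sup>2) ((1 + nrm (\<iota> e2) + nrm (\<iota> e3)) / 4) (real N) \<le> of_rat K"
  proof -
    have "entry_bound (nq a b (z + \<sigma> z) / 4) (nq a b (z - \<sigma> z) / 4) ((1 + nq a b e2 + nq a b e3) / 4) (of_nat N) \<le> K"
      using gr by (simp add: grid_list_def)
    then have "(of_rat (entry_bound (nq a b (z + \<sigma> z) / 4) (nq a b (z - \<sigma> z) / 4) ((1 + nq a b e2 + nq a b e3) / 4) (of_nat N)) :: real) \<le> of_rat K"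
      by (simp only: of_rat_less_eq)
    then show ?thesis unfolding of_rat_entry_bound nq_hor nq_ver C by simp
  qed
  have sound: "0 \<le> gdist ?z M w" if w: "w \<in> H4" "\<And>M. M \<in> ?Ms \<Longrightarrow> 0 \<le> gdist ?z M w" and M: "M \<in> E.G" for M w
  proof (rule E.dirichlet_sound[OF z1 en N MsG _ Kb _ _ w M])
    fix A B C D assume M: "Mat2 A B C D \<in> E.G" and K: "\<forall>x\<in>{A, B, C, D}. nrm x \<le> of_rat K"
    then obtain M' where M': "M' \<in> SL_sigma R \<sigma>" "Mat2 A B C D = map_mat2 \<iota> M'" unfolding G_eq by blast
    have "M' \<in> set Ms" by (rule mem[OF M'(1)]) (use K in \<open>simp flip: M'(2)\<close>)
    then show "Mat2 A B C D \<in> ?Ms" unfolding M'(2) by blast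
  next
    fix e assume e: "e \<in> {q1, \<iota> e2, \<iota> e3}"
    then obtain e' where e': "e = \<iota> e'" "e' \<in> {rone, e2, e3}" using iota_one by (metis insert_iff singletonD)
    then have "Mat2 rone e' 0 rone \<in> set Ms" "Mat2 rone (- e') 0 rone \<in> set Ms"
      using gr by (auto simp: grid_list_def)
    from this[THEN imageI, of "map_mat2 \<iota>"]
    show "Mat2 q1 e 0 q1 \<in> ?Ms \<and> Mat2 q1 (- e) 0 q1 \<in> ?Ms" by (simp add: iota_simps e')
  next
    fix m1 m2 m3 assume "m1 < N" "m2 < N" "m3 < N"
    moreover have "\<forall>m1<N. \<forall>m2<N. \<forall>m3<N. \<exists>M\<in>set Ms. \<forall>i1<2. \<forall>i2<2. \<forall>i3<2. \<forall>h<2.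
        rgdist a b z M (rbox \<sigma> z e2 e3 (of_nat (m1 + i1) / of_nat N - 1/2) (of_nat (m2 + i2) / of_nat N - 1/2)
          (of_nat (m3 + i3) / of_nat N - 1/2) (of_nat h / of_nat N)) < 0"
      using gr unfolding grid_list_def by (elim conjE)
    ultimately obtain M where M: "M \<in> set Ms" and neg: "\<forall>i1<2. \<forall>i2<2. \<forall>i3<2. \<forall>h<2.
        rgdist a b z M (rbox \<sigma> z e2 e3 (of_nat (m1 + i1) / of_nat N - 1/2) (of_nat (m2 + i2) / of_nat N - 1/2)
          (of_nat (m3 + i3) / of_nat N - 1/2) (of_nat h / of_nat N)) < 0"
      by meson
    have "gdist ?z (map_mat2 \<iota> M) (box_point ?z (\<iota> e2) (\<iota> e3) (real (m1 + i1) / real N - 1/2)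
        (real (m2 + i2) / real N - 1/2) (real (m3 + i3) / real N - 1/2) (real h / real N)) < 0"
      if "i1 < 2" "i2 < 2" "i3 < 2" "h < 2" for i1 i2 i3 h
    proof -
      let ?r = "rgdist a b z M (rbox \<sigma> z e2 e3 (of_nat (m1 + i1) / of_nat N - 1/2) (of_nat (m2 + i2) / of_nat N - 1/2)
          (of_nat (m3 + i3) / of_nat N - 1/2) (of_nat h / of_nat N))"
      have "(of_rat ?r :: real) < 0" using neg that by simp
      then show ?thesis unfolding of_rat_rgdist iota_rbox
        by (simp only: of_rat_diff of_rat_divide of_rat_of_nat_eq of_rat_1 of_rat_numeral_eq)
    qed
    then show "\<exists>M\<in>?Ms. \<forall>i1<2. \<forall>i2<2. \<forall>i3<2. \<forall>h<2. gdist ?z M (box_point ?z (\<iota> e2) (\<iota> e3) (real (m1 + i1) / real N - 1/2)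
        (real (m2 + i2) / real N - 1/2) (real (m3 + i3) / real N - 1/2) (real h / real N)) < 0"
      using M by blast
  qed
  have stab: "M = Mat2 rone 0 0 rone \<or> M = Mat2 (- rone) 0 0 (- rone)"
    if M: "M \<in> SL_sigma R \<sigma>" "moebius (map_mat2 \<iota> M) ?z = ?z" for M
  proof -
    obtain A B C D where Md: "M = Mat2 A B C D" by (cases M)
    have G: "Mat2 (\<iota> A) (\<iota> B) (\<iota> C) (\<iota> D) \<in> E.G" using M(1) SL_image[of M] by (simp add: Md)
    have C0: "0 \<le> (1 + nrm (\<iota> e2) + nrm (\<iota> e3)) / 4" by simp
    have "2 \<le> real N" using N by simp
    from E.stabilizer_bounded[OF G z1 this C0] M(2) Kb
    have "\<forall>x\<in>{\<iota> A, \<iota> B, \<iota> C, \<iota> D}. nrm x \<le> of_rat K" by (auto simp: Md)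
    then have "M \<in> set Ms" using mem[OF M(1)] by (simp add: Md)
    moreover have "A \<bullet>\<^sub>q z + B = z \<bullet>\<^sub>q (C \<bullet>\<^sub>q z + D)"
    proof -
      have "\<iota> C \<cdot> ?z + \<iota> D \<noteq> 0" using SLH_denom_nonzero[OF E.G_SLH[OF G] zH] .
      from moebius_mult_denom[OF this, of "\<iota> A" "\<iota> B"] M(2) have "\<iota> (A \<bullet>\<^sub>q z + B) = \<iota> (z \<bullet>\<^sub>q (C \<bullet>\<^sub>q z + D))"
        by (simp add: Md iota_simps)
      then show ?thesis by (simp only: iota_eq_iff)
    qed
    ultimately show ?thesis using bspec[OF gl1, of M] unfolding Md mat2.case by blast
  qed
  have "(\<forall>M\<in>set Ms. 0 \<le> gdist ?z (map_mat2 \<iota> M) w) \<longleftrightarrow> (\<forall>M\<in>E.G. 0 \<le> gdist ?z M w)" if w: "w \<in> H4" for w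
  proof
    assume 1: "\<forall>M\<in>set Ms. 0 \<le> gdist ?z (map_mat2 \<iota> M) w"
    have "0 \<le> gdist ?z M w" if M: "M \<in> E.G" for M
    proof (rule sound[OF w _ M])
      show "0 \<le> gdist ?z M' w" if "M' \<in> ?Ms" for M' using that 1 by blast
    qed
    then show "\<forall>M\<in>E.G. 0 \<le> gdist ?z M w" by blast
  qed (use MsG in blast)
  then show ?thesis unfolding describes_iff using zH stab MsSL by blast
qed

section \<open>Completeness of certificates\<close>

lemma ex_sum_chain_superset:
  assumes gen: "generate (add_monoid (quat_alg a b)) (set gs) = \<O>" and "finite F" "F \<subseteq> \<O>"
  shows "\<exists>l. sum_chain gs l \<and> F \<subseteq> set l"
  using assms(2,3)
proof (induction F)
  case empty
  show ?case by (intro exI[of _ "[]"]) simp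
next
  case (insert x F)
  then obtain l where l: "sum_chain gs l" "F \<subseteq> set l" by auto
  obtain c where "x = comb gs c" using insert.prems gen generate_comb[of x gs] by auto
  then obtain l' where "sum_chain gs l'" "x \<in> set l'" using ex_sum_chain_comb by blast
  then show ?case using l by (intro exI[of _ "l' @ l"]) (auto intro: sum_chain_append)
qed

lemma finite_rational_ball: "finite {x\<in>\<O>. nq a b x \<le> K}"
proof -
  have "\<iota> ` {x\<in>\<O>. nq a b x \<le> K} \<subseteq> {x\<in>\<iota> ` \<O>. nrm x \<le> of_rat K}"
    by (auto simp: nrm_iota of_rat_less_eq)
  then have "finite (\<iota> ` {x\<in>\<O>. nq a b x \<le> K})" using E.finite_ball finite_subset by blast
  then show ?thesis using inj_iota finite_imageD inj_on_subset by blast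
qed

text \<open>Both antisymmetric parts embed to positive multiples of k. Their ratio t is rational
  because the quotient of the two, formed in the rational algebra, embeds to t.\<close>

lemma antisymmetric_proportional:
  assumes "\<iota> z \<in> H4" "\<iota> u \<in> H4"
  shows "\<exists>r>0. z - \<sigma> z = r *s (u - \<sigma> u)"
proof -
  let ?v = "z - \<sigma> z" and ?w = "u - \<sigma> u"
  define t where "t = \<iota> z $ 4 / \<iota> u $ 4"
  have t: "0 < t" using assms by (simp add: t_def H4_def)
  have vw: "\<iota> ?v = t *\<^sub>R \<iota> ?w" using assms by (simp add: iota_simps q_eq_iff t_def H4_def)
  have n: "nq a b ?w \<noteq> 0"
  proof
    assume "nq a b ?w = 0"
    then have "\<iota> ?w = 0" using nrm_iota[of ?w] by simp
    then have "\<iota> ?w $ 4 = 0" by simp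
    then show False using assms(2) by (simp add: iota_simps H4_def)
  qed
  define x where "x = (1 / nq a b ?w) *s (?v \<bullet>\<^sub>q quat_conj ?w)"
  have x: "\<iota> x = t *\<^sub>R q1"
    using n by (simp add: x_def iota_scale iota_mult iota_conj vw qm_conj nrm_iota of_rat_divide)
  have "\<iota> x $ 1 = of_rat (x$1)"
    by (subst rat4_decomp) (simp add: iota_simps iota_basis_pure)
  then have "t = of_rat (x$1)" using x by simp
  then have "\<iota> ?v = \<iota> (x$1 *s ?w)" "0 < x$1" using vw t by (simp_all only: iota_scale zero_less_of_rat_iff)
  then show ?thesis using iota_eq_iff by blast
qed

text \<open>Once the geometric data are pulled back, the remaining choice is K: large enough for the
  elements used by the grid, the entry bound, the generators and the translations. Then
  \<open>os\<close> covers the ball of norm 9 K, and \<open>Ms\<close> lists all solutions with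
  entries in \<open>os\<close>.\<close>

lemma certificate_complete:
  assumes gen: "generate (add_monoid (quat_alg a b)) (set gs) = \<O>" and u: "\<iota> u \<in> H4"
  shows "\<exists>z Ms os K L r e2 e3 N. dirichlet_certificate a b \<sigma> gs u z Ms os K L r e2 e3 N"
proof -
  obtain e2' e3' where e': "e2' \<in> \<iota> ` \<O>" "e3' \<in> \<iota> ` \<O>" "orthogonal_triple e2' e3'"
    using E.ex_orthogonal unfolding orthogonal_triple_def by auto
  then obtain e2 e3 where e: "e2 \<in> \<O>" "e3 \<in> \<O>" "e2' = \<iota> e2" "e3' = \<iota> e3" by blast
  have tri: "orthogonal_triple (\<iota> e2) (\<iota> e3)" and eG: "\<iota> e2 \<in> \<iota> ` \<O>" "\<iota> e3 \<in> \<iota> ` \<O>" using e e' by auto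
  let ?C = "(1 + nrm (\<iota> e2) + nrm (\<iota> e3)) / 4"
  obtain z' and m :: nat where z': "0 < m" "real m *\<^sub>R z' \<in> \<iota> ` \<O>" "2 + ?C \<le> z'$4"
    "\<And>M. M \<in> E.G \<Longrightarrow> moebius M z' = z' \<Longrightarrow> M = Mat2 q1 0 0 q1 \<or> M = Mat2 (- q1) 0 0 (- q1)"
    using E.ex_center[OF tri eG, of "2 + ?C"] by blast
  obtain x where x: "real m *\<^sub>R z' = \<iota> x" using z'(2) by blast
  define z where "z = (1 / of_nat m) *s x"
  have zz: "\<iota> z = z'" using z'(1) by (simp add: z_def iota_scale of_rat_divide flip: x)
  have C0: "0 \<le> ?C" by simp
  have z2: "2 \<le> \<iota> z $ 4" using z'(3) C0 unfolding zz by linarith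
  have zC: "?C < (\<iota> z $ 4)\<^sup>2"
  proof -
    have "?C < \<iota> z $ 4" using z'(3) unfolding zz by linarith
    also have "\<dots> \<le> (\<iota> z $ 4)\<^sup>2" using z2 by (intro self_le_power) auto
    finally show ?thesis .
  qed
  have zH: "\<iota> z \<in> H4" using z2 by (simp add: H4_def)
  obtain r where r: "0 < r" "z - \<sigma> z = r *s (u - \<sigma> u)" using antisymmetric_proportional[OF zH u] by blast
  obtain N where N: "2 \<le> (N::nat)" and grid: "\<And>m1 m2 m3. m1 < N \<Longrightarrow> m2 < N \<Longrightarrow> m3 < N \<Longrightarrow> \<exists>M\<in>E.G. \<forall>i1<2::nat. \<forall>i2<2::nat. \<forall>i3<2::nat. \<forall>h<2::nat.
      gdist (\<iota> z) M (box_point (\<iota> z) (\<iota> e2) (\<iota> e3) (real (m1 + i1) / N - 1/2) (real (m2 + i2) / N - 1/2) (real (m3 + i3) / N - 1/2) (real h / N)) < 0"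
    using E.ex_grid[OF tri eG z2 zC] by blast
  define ok where "ok = (\<lambda>(m1, m2, m3) M. \<forall>i1<2::nat. \<forall>i2<2::nat. \<forall>i3<2::nat. \<forall>h<2::nat.
      gdist (\<iota> z) M (box_point (\<iota> z) (\<iota> e2) (\<iota> e3) (real (m1 + i1) / N - 1/2) (real (m2 + i2) / N - 1/2) (real (m3 + i3) / N - 1/2) (real h / N)) < 0)"
  \<comment> \<open>There are finitely many cells, so the elements that serve them have jointly
    bounded entries.\<close>
  have "\<exists>B. \<forall>m\<in>{..<N} \<times> {..<N} \<times> {..<N}. \<exists>M\<in>E.G. (\<forall>x\<in>set_mat2 M. nrm x \<le> B) \<and> ok m M"
  proof (rule finite_uniform_bound)
    fix m assume "m \<in> {..<N} \<times> {..<N} \<times> {..<N}"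
    then obtain m1 m2 m3 where m: "m = (m1, m2, m3)" "m1 < N" "m2 < N" "m3 < N" by auto
    obtain M where M: "M \<in> E.G" "ok m M" using grid[OF m(2-4)] unfolding ok_def m(1) prod.case by blast
    obtain A B C D where "M = Mat2 A B C D" by (cases M)
    then show "\<exists>B. \<exists>M\<in>E.G. (\<forall>x\<in>set_mat2 M. nrm x \<le> B) \<and> ok m M" using M
      by (intro exI[of _ "nrm A + nrm B + nrm C + nrm D"] bexI[of _ M]) auto
  qed (auto intro: order_trans)
  then obtain B where B: "\<And>m1 m2 m3. m1 < N \<Longrightarrow> m2 < N \<Longrightarrow> m3 < N \<Longrightarrow> \<exists>M\<in>E.G. (\<forall>x\<in>set_mat2 M. nrm x \<le> B) \<and> ok (m1, m2, m3) M"
    by blast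
  define L where "L = length gs"
  let ?eb = "entry_bound (nq a b (z + \<sigma> z) / 4) (nq a b (z - \<sigma> z) / 4) ((1 + nq a b e2 + nq a b e3) / 4) (of_nat N)"
  obtain n :: nat where "B \<le> real n" using real_arch_simple by blast
  then obtain BK :: rat where BK: "B \<le> of_rat BK" by (metis of_rat_of_nat_eq)
  define K where "K = \<bar>BK\<bar> + \<bar>?eb\<bar> + (of_nat L)\<^sup>2 * (\<Sum>g\<leftarrow>gs. nq a b g) + nq a b e2 + nq a b e3 + 1"
  have gsum: "0 \<le> (\<Sum>g\<leftarrow>gs. nq a b g)" by (intro sum_list_nonneg) (auto simp: nq_nonneg)
  then have gL: "0 \<le> (of_nat L)\<^sup>2 * (\<Sum>g\<leftarrow>gs. nq a b g)" by simp
  note nn = gL nq_nonneg[of e2] nq_nonneg[of e3]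
  have K1: "BK \<le> K" "?eb \<le> K" "(of_nat L)\<^sup>2 * (\<Sum>g\<leftarrow>gs. nq a b g) \<le> K" "nq a b e2 \<le> K" "nq a b e3 \<le> K" "1 \<le> K"
    unfolding K_def using nn by linarith+
  have "finite {x\<in>\<O>. nq a b x \<le> 9 * K}" by (rule finite_rational_ball)
  then obtain os where os: "sum_chain gs os" "{x\<in>\<O>. nq a b x \<le> 9 * K} \<subseteq> set os"
    using ex_sum_chain_superset[OF gen, of "{x\<in>\<O>. nq a b x \<le> 9 * K}"] by auto
  have gsO: "set gs \<subseteq> \<O>" using generate.incl[of _ "set gs" "add_monoid (quat_alg a b)"] unfolding gen by blast
  have osO: "set os \<subseteq> \<O>" by (rule sum_chain_subset[OF os(1) gsO])
  have inos: "x \<in> set os" if "x \<in> \<O>" "nq a b x \<le> K" for x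
    using that os(2) K1(6) by auto
  have ball: "ball_list a b gs L K os"
  proof -
    have in9: "x \<in> set os" if "x \<in> \<O>" "nq a b x \<le> 9 * K" for x using that os(2) by blast
    have two: "2 *s x \<in> \<O>" if "x \<in> \<O>" for x
    proof -
      have "2 *s x = x + x" by (simp add: vec_eq_iff)
      then show ?thesis using O_closed(3)[OF that that] by (simp only:)
    qed
    have sub: "x - g \<in> \<O>" if "x \<in> \<O>" "g \<in> \<O>" for x g
      using O_closed(3)[OF that(1) O_closed(4)[OF that(2)]] by simp
    have gK: "(of_nat L)\<^sup>2 * nq a b g \<le> K" if "g \<in> set gs" for g
    proof -
      have "nq a b g \<le> (\<Sum>g\<leftarrow>gs. nq a b g)"
        using that by (intro member_le_sum_list) (auto simp: nq_nonneg)
      then have "(of_nat L)\<^sup>2 * nq a b g \<le> (of_nat L)\<^sup>2 * (\<Sum>g\<leftarrow>gs. nq a b g)" by (intro mult_left_mono) auto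
      then show ?thesis using K1(3) by linarith
    qed
    have "0 \<in> set os" using inos[OF O_closed(1)] K1(6) by (simp add: nq_def)
    moreover have "2 *s x \<in> set os" if "x \<in> set os" "nq a b (2 *s x) \<le> 9 * K" for x
      by (rule in9[OF two that(2)]) (use that osO in blast)
    moreover have "x + g \<in> set os" if "x \<in> set os" "g \<in> set gs" "nq a b (x + g) \<le> 9 * K" for x g
      by (rule in9[OF O_closed(3) that(3)]) (use that osO gsO in blast)+
    moreover have "x - g \<in> set os" if "x \<in> set os" "g \<in> set gs" "nq a b (x - g) \<le> 9 * K" for x g
      by (rule in9[OF sub that(3)]) (use that osO gsO in blast)+
    moreover have "length gs \<le> L" by (simp add: L_def)
    ultimately show ?thesis unfolding ball_list_def using os(1) gK by blast
  qed
  let ?S = "{M. \<exists>A B C D. M = Mat2 A B C D \<and> A \<in> set os \<and> B \<in> set os \<and> C \<in> set os \<and> D \<in> set os \<and> SLq a b \<sigma> A B C D}"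
  have "?S \<subseteq> (\<lambda>(A, B, C, D). Mat2 A B C D) ` (set os \<times> set os \<times> set os \<times> set os)" by force
  then have "finite ?S" by (rule finite_subset) (intro finite_imageI finite_cartesian_product finite_set)
  from finite_list[OF this] obtain Ms where Ms: "set Ms = ?S" by (elim exE)
  have MsG: "M \<in> set Ms" if MSL: "M \<in> SL_sigma R \<sigma>" and MK: "\<forall>x\<in>set_mat2 (map_mat2 \<iota> M). nrm x \<le> of_rat K" for M
  proof -
    obtain A B C D where M: "M = Mat2 A B C D" by (cases M)
    have "SLq a b \<sigma> A B C D" and O: "x \<in> {A, B, C, D} \<Longrightarrow> x \<in> \<O>" for x
      using MSL unfolding M SLq_iff by blast+
    moreover have "x \<in> set os" if x: "x \<in> {A, B, C, D}" for x
      using x MK O[OF x] by (intro inos) (auto simp: M nrm_iota of_rat_less_eq)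
    ultimately show ?thesis unfolding Ms M by blast
  qed
  have group: "group_list a b \<sigma> os z Ms"
  proof -
    have "Mat2 A B C D = Mat2 rone 0 0 rone \<or> Mat2 A B C D = Mat2 (- rone) 0 0 (- rone) \<or>
        A \<bullet>\<^sub>q z + B \<noteq> z \<bullet>\<^sub>q (C \<bullet>\<^sub>q z + D)" if M: "Mat2 A B C D \<in> ?S" for A B C D
    proof (rule ccontr)
      assume neg: "\<not> ?thesis"
      have "Mat2 A B C D \<in> SL_sigma R \<sigma>" using M osO by (auto simp: SLq_iff)
      then have G: "Mat2 (\<iota> A) (\<iota> B) (\<iota> C) (\<iota> D) \<in> E.G" using SL_image[of "Mat2 A B C D"] by simp
      have y: "\<iota> C \<cdot> \<iota> z + \<iota> D \<noteq> 0" using SLH_denom_nonzero[OF E.G_SLH[OF G] zH] .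
      have "A \<bullet>\<^sub>q z + B = z \<bullet>\<^sub>q (C \<bullet>\<^sub>q z + D)" using neg by blast
      from arg_cong[OF this, of \<iota>] have "\<iota> A \<cdot> \<iota> z + \<iota> B = \<iota> z \<cdot> (\<iota> C \<cdot> \<iota> z + \<iota> D)"
        by (simp only: iota_simps)
      then have "moebius (Mat2 (\<iota> A) (\<iota> B) (\<iota> C) (\<iota> D)) (\<iota> z) = \<iota> z"
        using y by (simp add: moebius_eq qm_assoc qinv_right)
      then have "Mat2 (\<iota> A) (\<iota> B) (\<iota> C) (\<iota> D) = Mat2 q1 0 0 q1 \<or> Mat2 (\<iota> A) (\<iota> B) (\<iota> C) (\<iota> D) = Mat2 (- q1) 0 0 (- q1)"
        using z'(4)[OF G] zz by simp
      then have "Mat2 A B C D = Mat2 rone 0 0 rone \<or> Mat2 A B C D = Mat2 (- rone) 0 0 (- rone)"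
        by (simp only: mat2.inject iota_one[symmetric] iota_minus[symmetric] iota_eq_iff iota_eq_0)
      then show False using neg by blast
    qed
    note nofix = this
    show ?thesis unfolding group_list_def Ms
    proof (intro conjI ballI impI)
      fix M assume M: "M \<in> ?S"
      then obtain A B C D where Md: "M = Mat2 A B C D" and ABCD: "A \<in> set os" "B \<in> set os" "C \<in> set os" "D \<in> set os"
        "SLq a b \<sigma> A B C D" by blast
      show "case M of Mat2 A B C D \<Rightarrow> A \<in> set os \<and> B \<in> set os \<and> C \<in> set os \<and> D \<in> set os \<and> SLq a b \<sigma> A B C D \<and>
        (M = Mat2 rone 0 0 rone \<or> M = Mat2 (- rone) 0 0 (- rone) \<or> A \<bullet>\<^sub>q z + B \<noteq> z \<bullet>\<^sub>q (C \<bullet>\<^sub>q z + D))"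
        using ABCD nofix[OF M[unfolded Md]] unfolding Md mat2.case by blast
    qed blast
  qed
  have trans: "Mat2 rone e 0 rone \<in> set Ms" "Mat2 rone (- e) 0 rone \<in> set Ms"
    if "e \<in> \<O>" "\<iota> e $ 4 = 0" "nq a b e \<le> K" for e
  proof -
    have "Mat2 (\<iota> rone) (\<iota> x) (\<iota> 0) (\<iota> rone) \<in> E.G" if "x \<in> \<O>" "\<iota> x $ 4 = 0" for x
      using E.G_shift[of "\<iota> x"] that by (simp add: iota_simps)
    then have "Mat2 rone x 0 rone \<in> SL_sigma R \<sigma>" if "x \<in> \<O>" "\<iota> x $ 4 = 0" for x
      using that SL_image[of "Mat2 rone x 0 rone"] by simp
    then have *: "Mat2 rone x 0 rone \<in> set Ms" if "x \<in> \<O>" "\<iota> x $ 4 = 0" "nq a b x \<le> K" for x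
      using that K1(6) by (intro MsG) (auto simp: iota_simps nrm_iota of_rat_less_eq)
    show "Mat2 rone e 0 rone \<in> set Ms" using * that by blast
    show "Mat2 rone (- e) 0 rone \<in> set Ms" using that
      by (intro *) (auto simp: O_closed iota_minus nq_def)
  qed
  have gridl: "grid_list a b \<sigma> z Ms K e2 e3 N"
  proof -
    have "inner (\<iota> rone) (\<iota> e2) = 0" "inner (\<iota> rone) (\<iota> e3) = 0" "inner (\<iota> e2) (\<iota> e3) = 0"
      and e4: "\<iota> e2 $ 4 = 0" "\<iota> e3 $ 4 = 0" "e2 \<noteq> 0" "e3 \<noteq> 0"
      using tri by (auto simp: orthogonal_triple_def iota_one iota_eq_0)
    then have orth: "nq a b (rone + e2) = 1 + nq a b e2" "nq a b (rone + e3) = 1 + nq a b e3"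
      "nq a b (e2 + e3) = nq a b e2 + nq a b e3"
      unfolding orthogonal_iota_iff[symmetric] nq_one by auto
    have "\<exists>M\<in>set Ms. \<forall>i1<2. \<forall>i2<2. \<forall>i3<2. \<forall>h<2.
        rgdist a b z M (rbox \<sigma> z e2 e3 (of_nat (m1 + i1) / of_nat N - 1/2) (of_nat (m2 + i2) / of_nat N - 1/2)
          (of_nat (m3 + i3) / of_nat N - 1/2) (of_nat h / of_nat N)) < 0"
      if m: "m1 < N" "m2 < N" "m3 < N" for m1 m2 m3
    proof -
      obtain M' where M': "M' \<in> E.G" "\<forall>x\<in>set_mat2 M'. nrm x \<le> B" "ok (m1, m2, m3) M'" using B[OF m] by blast
      then obtain M where M: "M \<in> SL_sigma R \<sigma>" "M' = map_mat2 \<iota> M" unfolding G_eq by blast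
      have "B \<le> of_rat K" using BK K1(1) by (meson of_rat_less_eq order_trans)
      then have "M \<in> set Ms" using MsG M M'(2) by (meson order_trans)
      moreover have "rgdist a b z M (rbox \<sigma> z e2 e3 (of_nat (m1 + i1) / of_nat N - 1/2) (of_nat (m2 + i2) / of_nat N - 1/2)
          (of_nat (m3 + i3) / of_nat N - 1/2) (of_nat h / of_nat N)) < 0" (is "?r < 0")
        if i: "i1 < 2" "i2 < 2" "i3 < 2" "h < 2" for i1 i2 i3 h :: nat
      proof -
        have "gdist (\<iota> z) M' (box_point (\<iota> z) (\<iota> e2) (\<iota> e3) (real (m1 + i1) / N - 1/2) (real (m2 + i2) / N - 1/2) (real (m3 + i3) / N - 1/2) (real h / N)) < 0"
          using M'(3) i unfolding ok_def by blast
        then have "(of_rat ?r :: real) < 0" unfolding of_rat_rgdist iota_rbox M(2)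
          by (simp only: of_rat_diff of_rat_divide of_rat_of_nat_eq of_rat_1 of_rat_numeral_eq)
        then show ?thesis by simp
      qed
      ultimately show ?thesis by blast
    qed
    moreover have "\<iota> rone $ 4 = 0" by (simp add: iota_one)
    ultimately show ?thesis unfolding grid_list_def
      using trans[OF e(1) e4(1) K1(4)] trans[OF e(2) e4(2) K1(5)] trans[OF O_closed(2)] e4 orth N K1(2,6)
      by (simp add: nq_one)
  qed
  have "4 \<le> nq a b (z - \<sigma> z)"
  proof -
    have "(1::real) \<le> (\<iota> z $ 4)\<^sup>2" using z2 by (simp add: power2_eq_square mult_ge1_I)
    then have "(of_rat 1 :: real) \<le> of_rat (nq a b (z - \<sigma> z) / 4)" unfolding nq_ver by simp
    then have "1 \<le> nq a b (z - \<sigma> z) / 4" by (simp only: of_rat_less_eq)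
    then show ?thesis by simp
  qed
  then show ?thesis unfolding dirichlet_certificate_def using r ball group gridl by blast
qed

lemma card_cusps_order: "card (cusps (map_mat2 \<iota> ` SL_sigma R \<sigma>)) = 1"
  using E.card_cusps by (simp add: G_eq)

end

section \<open>Decidability of certificates\<close>

text \<open>A rational is carried unreduced, as a difference of naturals over a positive natural.
  Arithmetic then needs neither signs nor gcds, and a sign test compares two naturals.\<close>

definition ratcomp :: "(nat \<Rightarrow> rat) \<Rightarrow> bool" where
  "ratcomp f \<longleftrightarrow> (\<exists>p q n. computable p \<and> computable q \<and> computable n \<and>
     (\<forall>x. f x = (of_nat (p x) - of_nat (q x)) / of_nat (Suc (n x))))"

lemma ratcompI:
  "computable p \<Longrightarrow> computable q \<Longrightarrow> computable n \<Longrightarrow>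
   (\<And>x. f x = (of_nat (p x) - of_nat (q x)) / of_nat (Suc (n x))) \<Longrightarrow> ratcomp f"
  unfolding ratcomp_def by blast

lemma ratcomp_add: "ratcomp f \<Longrightarrow> ratcomp g \<Longrightarrow> ratcomp (\<lambda>x. f x + g x)"
proof -
  assume "ratcomp f" "ratcomp g"
  then obtain p q n p' q' n' where c: "computable p" "computable q" "computable n" "computable p'" "computable q'" "computable n'"
    and f: "\<And>x. f x = (of_nat (p x) - of_nat (q x)) / of_nat (Suc (n x))"
    and g: "\<And>x. g x = (of_nat (p' x) - of_nat (q' x)) / of_nat (Suc (n' x))"
    unfolding ratcomp_def by blast
  show ?thesis
  proof (rule ratcompI[of "\<lambda>x. p x * Suc (n' x) + p' x * Suc (n x)" "\<lambda>x. q x * Suc (n' x) + q' x * Suc (n x)"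
        "\<lambda>x. n x * n' x + n x + n' x"])
    fix x
    have s: "of_nat (Suc (n x * n' x + n x + n' x)) = (of_nat (Suc (n x)) * of_nat (Suc (n' x)) :: rat)"
      by (simp add: algebra_simps)
    have nz: "of_nat (Suc (n x)) \<noteq> (0::rat)" "of_nat (Suc (n' x)) \<noteq> (0::rat)" by (simp_all only: of_nat_eq_0_iff)
    show "f x + g x = (of_nat (p x * Suc (n' x) + p' x * Suc (n x)) - of_nat (q x * Suc (n' x) + q' x * Suc (n x))) /
        of_nat (Suc (n x * n' x + n x + n' x))"
      unfolding s f g add_frac_eq[OF nz] by (simp only: of_nat_add of_nat_mult left_diff_distrib add_diff_add)
  qed (intro computable_intros c)+
qed

lemma ratcomp_mult: "ratcomp f \<Longrightarrow> ratcomp g \<Longrightarrow> ratcomp (\<lambda>x. f x * g x)"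
proof -
  assume "ratcomp f" "ratcomp g"
  then obtain p q n p' q' n' where c: "computable p" "computable q" "computable n" "computable p'" "computable q'" "computable n'"
    and f: "\<And>x. f x = (of_nat (p x) - of_nat (q x)) / of_nat (Suc (n x))"
    and g: "\<And>x. g x = (of_nat (p' x) - of_nat (q' x)) / of_nat (Suc (n' x))"
    unfolding ratcomp_def by blast
  show ?thesis
  proof (rule ratcompI[of "\<lambda>x. p x * p' x + q x * q' x" "\<lambda>x. p x * q' x + q x * p' x"
        "\<lambda>x. n x * n' x + n x + n' x"])
    fix x
    have s: "of_nat (Suc (n x * n' x + n x + n' x)) = (of_nat (Suc (n x)) * of_nat (Suc (n' x)) :: rat)"
      by (simp add: algebra_simps)
    show "f x * g x = (of_nat (p x * p' x + q x * q' x) - of_nat (p x * q' x + q x * p' x)) /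
        of_nat (Suc (n x * n' x + n x + n' x))"
      unfolding s f g times_divide_times_eq by (simp add: algebra_simps)
  qed (intro computable_intros c)+
qed

lemma ratcomp_of_nat: "computable n \<Longrightarrow> ratcomp (\<lambda>x. of_nat (n x))"
  by (rule ratcompI[of n "\<lambda>_. 0" "\<lambda>_. 0"]) (auto intro: computable_intros)

lemma ratcomp_const: "ratcomp (\<lambda>_. c)"
proof -
  obtain p q where pq: "quotient_of c = (p, q)" by fastforce
  then have c: "c = of_int p / of_int q" and q: "0 < q"
    using quotient_of_div quotient_of_denom_pos by auto
  have "of_nat (Suc (nat (q - 1))) = (of_int q :: rat)" using q by (simp add: of_nat_nat)
  moreover have "of_nat (nat p) - of_nat (nat (- p)) = (of_int p :: rat)"
    by (cases "0 \<le> p") (simp_all add: of_nat_nat)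
  ultimately show ?thesis
    by (intro ratcompI[of "\<lambda>_. nat p" "\<lambda>_. nat (- p)" "\<lambda>_. nat (q - 1)"]) (auto simp: c intro: computable_const)
qed

lemma ratcomp_minus: "ratcomp f \<Longrightarrow> ratcomp (\<lambda>x. - f x)"
  using ratcomp_mult[OF ratcomp_const[of "- 1"], of f] by simp

lemma ratcomp_diff: "ratcomp f \<Longrightarrow> ratcomp g \<Longrightarrow> ratcomp (\<lambda>x. f x - g x)"
  using ratcomp_add[OF _ ratcomp_minus, of f g] by simp

lemma ratcomp_power: "ratcomp f \<Longrightarrow> ratcomp (\<lambda>x. f x ^ n)"
  by (induction n) (auto intro: ratcomp_const ratcomp_mult)

lemma ratcomp_divide_const: "ratcomp f \<Longrightarrow> ratcomp (\<lambda>x. f x / c)"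
  using ratcomp_mult[OF _ ratcomp_const[of "1 / c"], of f] by simp

lemma ratcomp_divide_of_nat:
  assumes "ratcomp f" "computable n" shows "ratcomp (\<lambda>x. f x / of_nat (n x))"
proof -
  \<comment> \<open>Division by 0 yields 0, which the numerator 0 reproduces.\<close>
  have "ratcomp (\<lambda>x. 1 / of_nat (n x))"
    by (rule ratcompI[of "\<lambda>x. if n x = 0 then 0 else 1" "\<lambda>_. 0" "\<lambda>x. n x - 1"])
      (auto intro!: computable_intros decidable_eq assms simp: of_nat_diff)
  from ratcomp_mult[OF assms(1) this] show ?thesis by simp
qed

lemma decidable_rat_less: "ratcomp f \<Longrightarrow> ratcomp g \<Longrightarrow> decidable (\<lambda>x. f x < g x)"
proof -
  assume "ratcomp f" "ratcomp g"
  then have "ratcomp (\<lambda>x. f x - g x)" by (rule ratcomp_diff)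
  then obtain p q n where c: "computable p" "computable q"
    and f: "\<And>x. f x - g x = (of_nat (p x) - of_nat (q x)) / of_nat (Suc (n x))"
    unfolding ratcomp_def by blast
  have "f x < g x \<longleftrightarrow> p x < q x" for x
  proof -
    have "f x < g x \<longleftrightarrow> f x - g x < 0" by simp
    also have "\<dots> \<longleftrightarrow> p x < q x" unfolding f by (simp add: divide_less_0_iff del: of_nat_Suc) 
    finally show ?thesis .
  qed
  then show ?thesis using decidable_less[OF c] by simp
qed

lemma decidable_rat_le: "ratcomp f \<Longrightarrow> ratcomp g \<Longrightarrow> decidable (\<lambda>x. f x \<le> g x)"
  using decidable_not[OF decidable_rat_less, of g f] by (simp add: not_less)

lemma decidable_rat_eq: "ratcomp f \<Longrightarrow> ratcomp g \<Longrightarrow> decidable (\<lambda>x. f x = g x)"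
  using decidable_conj[OF decidable_rat_le[of f g] decidable_rat_le[of g f]] by (simp add: eq_iff)

section \<open>Computable functions with quaternion values\<close>

definition quatcomp :: "(nat \<Rightarrow> rat^4) \<Rightarrow> bool" where
  "quatcomp f \<longleftrightarrow> (\<forall>i. ratcomp (\<lambda>x. f x $ i))"

lemma quatcomp_iff:
  "quatcomp f \<longleftrightarrow> ratcomp (\<lambda>x. f x $ 1) \<and> ratcomp (\<lambda>x. f x $ 2) \<and> ratcomp (\<lambda>x. f x $ 3) \<and> ratcomp (\<lambda>x. f x $ 4)"
  by (simp add: quatcomp_def forall_4)

lemma ratcomp_nth: "quatcomp f \<Longrightarrow> ratcomp (\<lambda>x. f x $ i)"
  by (simp add: quatcomp_def)

lemmas ratcomp_intros = ratcomp_add ratcomp_mult ratcomp_diff ratcomp_minus ratcomp_power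
  ratcomp_of_nat ratcomp_const ratcomp_divide_const ratcomp_divide_of_nat ratcomp_nth

lemma quatcomp_add: "quatcomp f \<Longrightarrow> quatcomp g \<Longrightarrow> quatcomp (\<lambda>x. f x + g x)"
  and quatcomp_diff: "quatcomp f \<Longrightarrow> quatcomp g \<Longrightarrow> quatcomp (\<lambda>x. f x - g x)"
  and quatcomp_minus: "quatcomp f \<Longrightarrow> quatcomp (\<lambda>x. - f x)"
  and quatcomp_scale: "ratcomp r \<Longrightarrow> quatcomp f \<Longrightarrow> quatcomp (\<lambda>x. r x *s f x)"
  and quatcomp_const: "quatcomp (\<lambda>_. c)"
  unfolding quatcomp_def by (simp_all add: ratcomp_intros)

lemma quatcomp_mult:
  assumes "ratcomp a" "ratcomp b" "quatcomp f" "quatcomp g"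
  shows "quatcomp (\<lambda>x. quat_mult (a x) (b x) (f x) (g x))"
  unfolding quatcomp_iff quat_mult_def vector_4_nth
  by (intro conjI ratcomp_intros assms)

lemma ratcomp_nq:
  assumes "ratcomp a" "ratcomp b" "quatcomp f"
  shows "ratcomp (\<lambda>x. nq (a x) (b x) (f x))"
  unfolding nq_def by (intro ratcomp_intros assms)

lemma decidable_quat_eq: "quatcomp f \<Longrightarrow> quatcomp g \<Longrightarrow> decidable (\<lambda>x. f x = g x)"
  unfolding vec_eq_iff forall_4 by (intro decidable_conj decidable_rat_eq ratcomp_nth)

section \<open>Decoding and canonical codes\<close>

definition code_nth :: "nat \<Rightarrow> nat \<Rightarrow> nat" where "code_nth i c = code_hd (code_drop i c)"

lemma computable_code_nth: "computable f \<Longrightarrow> computable (\<lambda>x. code_nth i (f x))"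
  unfolding code_nth_def by (intro computable_intros)

lemma code_nth_list_encode: "i < length xs \<Longrightarrow> code_nth i (list_encode xs) = xs ! i"
  using code_nth[of i "list_encode xs"] by (simp add: code_nth_def)

declare list_encode.simps [simp del]

text \<open>A positive integer q is coded by 2 q, so halving recovers the denominator;
  \<open>Suc\<close> after subtracting 1 keeps it positive on codes of no rational.\<close>

definition rat_decode :: "nat \<Rightarrow> rat" where
  "rat_decode c = of_int (int_decode (pfst c)) / of_nat (Suc (psnd c div 2 - 1))"

definition quat_decode :: "nat \<Rightarrow> rat^4" where
  "quat_decode c = vector [rat_decode (code_nth 0 c), rat_decode (code_nth 1 c),
     rat_decode (code_nth 2 c), rat_decode (code_nth 3 c)]"

definition mat2_decode :: "nat \<Rightarrow> (rat^4) mat2" where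
  "mat2_decode c = Mat2 (quat_decode (code_nth 0 c)) (quat_decode (code_nth 1 c))
     (quat_decode (code_nth 2 c)) (quat_decode (code_nth 3 c))"

lemma rat_decode_code [simp]: "rat_decode (rat_code r) = r"
proof -
  obtain p q where pq: "quotient_of r = (p, q)" by fastforce
  then have r: "r = of_int p / of_int q" and q: "0 < q"
    using quotient_of_div quotient_of_denom_pos by auto
  have "int_encode q div 2 = nat q" using q by (simp add: int_encode_def sum_encode_def)
  then have 1: "of_nat (Suc (int_encode q div 2 - 1)) = (of_int q :: rat)" using q by (simp add: of_nat_nat of_nat_diff)
  have "rat_decode (rat_code r) = of_int p / of_int q"
    unfolding rat_decode_def rat_code_def pq prod.case prod_encode_inverse fst_conv snd_conv int_encode_inverse 1 ..
  then show ?thesis by (simp only: r)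
qed

lemma quat_decode_code [simp]: "quat_decode (quat_code x) = x"
  by (simp add: quat_decode_def quat_code_def code_nth_list_encode vec_eq_iff forall_4)

lemma mat2_decode_code [simp]: "mat2_decode (mat2_code M) = M"
  by (cases M) (simp add: mat2_decode_def code_nth_list_encode)

lemma ratcomp_decode: "computable f \<Longrightarrow> ratcomp (\<lambda>x. rat_decode (f x))"
proof -
  assume f: "computable f"
  have i: "(of_int (int_decode n) :: rat) =
      of_nat (if odd n then 0 else n div 2) - of_nat (if odd n then Suc (n div 2) else 0)" for n
    by (simp add: int_decode_def sum_decode_def)
  show ?thesis
    by (rule ratcompI[of "\<lambda>x. if odd (pfst (f x)) then 0 else pfst (f x) div 2"
          "\<lambda>x. if odd (pfst (f x)) then Suc (pfst (f x) div 2) else 0" "\<lambda>x. psnd (f x) div 2 - 1"])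
      (intro computable_intros decidable_odd f | simp only: rat_decode_def i)+
qed

lemma quatcomp_decode: "computable f \<Longrightarrow> quatcomp (\<lambda>x. quat_decode (f x))"
  unfolding quatcomp_iff quat_decode_def vector_4_nth
  by (intro conjI ratcomp_decode computable_code_nth)

lemma decidable_dvd: "computable f \<Longrightarrow> computable g \<Longrightarrow> decidable (\<lambda>x. f x dvd (g x :: nat))"
proof -
  assume f: "computable f" "computable g"
  have "m dvd n \<longleftrightarrow> (\<exists>k<Suc n. n = m * k)" for m n :: nat
  proof
    assume "m dvd n"
    then obtain k where k: "n = m * k" by (elim dvdE)
    show "\<exists>k<Suc n. n = m * k"
    proof (cases "n = 0")
      case False
      then have "k \<le> n" using k by (intro dvd_imp_le) auto
      then have "k < Suc n" by simp
      then show ?thesis using k by blast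
    qed (use k in \<open>auto intro: exI[of _ 0]\<close>)
  qed auto
  then show ?thesis using f
    by (auto intro!: decidable_ex_less decidable_eq computable_intros computable_compose[of g] computable_compose[of f])
qed

text \<open>A code of a rational is canonical if it encodes a reduced fraction; only canonical codes
  may appear in the output.\<close>

definition canonical_rat :: "nat \<Rightarrow> bool" where
  "canonical_rat c \<longleftrightarrow> 0 < psnd c \<and> \<not> odd (psnd c) \<and>
     (\<forall>d<Suc (psnd c). 2 \<le> d \<longrightarrow>
        \<not> (d dvd (if odd (pfst c) then Suc (pfst c div 2) else pfst c div 2) \<and> d dvd psnd c div 2))"

definition canonical_quat :: "nat \<Rightarrow> bool" where
  "canonical_quat c \<longleftrightarrow> code_drop 3 c \<noteq> 0 \<and> code_drop 4 c = 0 \<and> canonical_rat (code_nth 0 c) \<and>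
     canonical_rat (code_nth 1 c) \<and> canonical_rat (code_nth 2 c) \<and> canonical_rat (code_nth 3 c)"

definition canonical_mat2 :: "nat \<Rightarrow> bool" where
  "canonical_mat2 c \<longleftrightarrow> code_drop 3 c \<noteq> 0 \<and> code_drop 4 c = 0 \<and> canonical_quat (code_nth 0 c) \<and>
     canonical_quat (code_nth 1 c) \<and> canonical_quat (code_nth 2 c) \<and> canonical_quat (code_nth 3 c)"

lemma abs_int_decode: "nat \<bar>int_decode n\<bar> = (if odd n then Suc (n div 2) else n div 2)"
  by (auto simp: int_decode_def sum_decode_def)

text \<open>Coprimality as a bounded search. The bound may exceed \<open>n\<close> because the
  second component in the code of a rational is twice its denominator.\<close>

lemma coprime_iff_no_common_divisor:
  fixes m n :: nat
  assumes "0 < n" "n \<le> k"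
  shows "coprime m n \<longleftrightarrow> (\<forall>d<Suc k. 2 \<le> d \<longrightarrow> \<not> (d dvd m \<and> d dvd n))"
proof
  assume "coprime m n"
  then show "\<forall>d<Suc k. 2 \<le> d \<longrightarrow> \<not> (d dvd m \<and> d dvd n)" using coprime_common_divisor_nat by force
next
  assume *: "\<forall>d<Suc k. 2 \<le> d \<longrightarrow> \<not> (d dvd m \<and> d dvd n)"
  have "gcd m n \<le> n" using assms(1) by (simp add: gcd_le2_nat)
  then have "gcd m n < Suc k" using assms(2) by simp
  then have "\<not> 2 \<le> gcd m n" using * gcd_dvd1[of m n] gcd_dvd2[of m n] by blast
  moreover have "0 < gcd m n" using assms(1) by simp
  ultimately show "coprime m n" unfolding coprime_iff_gcd_eq_1 by linarith
qed

text \<open>The output must literally be an \<open>output_code\<close>, so decoding and re-encoding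
  a code found by the search has to return it.\<close>

lemma canonical_rat_iff: "canonical_rat c \<longleftrightarrow> rat_code (rat_decode c) = c"
proof
  assume c: "canonical_rat c"
  define p q where "p = int_decode (pfst c)" and "q = psnd c div 2"
  have q: "0 < q" "psnd c = 2 * q" "q \<le> psnd c" using c by (auto simp: canonical_rat_def q_def elim: evenE)
  have "coprime (nat \<bar>p\<bar>) q"
    using c coprime_iff_no_common_divisor[OF q(1,3)] unfolding p_def abs_int_decode
    by (simp add: canonical_rat_def q_def)
  then have cop: "coprime p (int q)" by (simp add: coprime_int_iff flip: coprime_nat_abs_left_iff) 
  have "rat_decode c = Fract p (int q)"
    using q(1) by (simp add: rat_decode_def p_def q_def Fract_of_int_quotient of_nat_diff)
  then have "quotient_of (rat_decode c) = (p, int q)"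
    using cop q(1) by (simp add: quotient_of_Fract normalize_stable)
  then show "rat_code (rat_decode c) = c"
    using q(2) prod_decode_inverse[of c]
    by (simp add: rat_code_def p_def int_encode_def[of "int q"] sum_encode_def del: prod_decode_inverse)
      (metis prod.collapse)
next
  assume c: "rat_code (rat_decode c) = c"
  obtain p q where pq: "quotient_of (rat_decode c) = (p, q)" by fastforce
  then have q: "0 < q" and cop: "coprime p q" using quotient_of_denom_pos quotient_of_coprime by auto
  have ce: "c = prod_encode (int_encode p, int_encode q)" using c by (simp add: rat_code_def pq)
  have e: "int_encode q = 2 * nat q" using q by (simp add: int_encode_def sum_encode_def)
  have "coprime (nat \<bar>p\<bar>) (nat q)" using cop q by (simp add: coprime_int_iff[symmetric])
  then have "coprime (nat \<bar>int_decode (int_encode p)\<bar>) (nat q)" by simp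
  then show "canonical_rat c"
    using q coprime_iff_no_common_divisor[of "nat q" "2 * nat q"]
    unfolding canonical_rat_def abs_int_decode ce prod_encode_inverse fst_conv snd_conv e by simp
qed

lemma list_decode_4:
  assumes "code_drop 3 c \<noteq> 0" "code_drop 4 c = 0"
  shows "c = list_encode [code_nth 0 c, code_nth 1 c, code_nth 2 c, code_nth 3 c]"
proof -
  have "length (list_decode c) = 4" using assms by (simp add: code_drop_eq_0)
  then obtain x0 x1 x2 x3 where "list_decode c = [x0, x1, x2, x3]"
    by (auto simp: length_Suc_conv eval_nat_numeral)
  then have "c = list_encode [x0, x1, x2, x3]" by (metis list_decode_inverse)
  then show ?thesis by (simp add: code_nth_list_encode)
qed

lemma canonical_quat_code: "canonical_quat c \<Longrightarrow> quat_code (quat_decode c) = c"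
  using list_decode_4[of c] by (simp add: canonical_quat_def quat_code_def quat_decode_def canonical_rat_iff)

lemma canonical_mat2_code: "canonical_mat2 c \<Longrightarrow> mat2_code (mat2_decode c) = c"
  using list_decode_4[of c] by (simp add: canonical_mat2_def mat2_decode_def canonical_quat_code)

lemma code_drop_list_encode: "code_drop i (list_encode xs) = 0 \<longleftrightarrow> length xs \<le> i"
  by (simp add: code_drop_eq_0)

lemma canonical_quat_quat_code: "canonical_quat (quat_code x)"
  unfolding canonical_quat_def quat_code_def code_drop_list_encode
  by (simp add: code_nth_list_encode canonical_rat_iff)

lemma canonical_mat2_mat2_code: "canonical_mat2 (mat2_code M)"
  by (cases M) (simp add: canonical_mat2_def code_drop_list_encode code_nth_list_encode canonical_quat_quat_code)

lemma decidable_canonical_rat: "computable f \<Longrightarrow> decidable (\<lambda>x. canonical_rat (f x))"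
proof -
  assume f: "computable f"
  have "decidable canonical_rat" unfolding canonical_rat_def
    by (intro decidable_conj decidable_not decidable_all_less decidable_imp decidable_dvd decidable_odd
        decidable_less decidable_le computable_intros)
  then show ?thesis using f by (rule decidable_compose)
qed

lemma decidable_canonical_quat: "computable f \<Longrightarrow> decidable (\<lambda>x. canonical_quat (f x))"
  unfolding canonical_quat_def
  by (intro decidable_conj decidable_not decidable_eq decidable_canonical_rat computable_code_nth computable_intros)

lemma decidable_canonical_mat2: "computable f \<Longrightarrow> decidable (\<lambda>x. canonical_mat2 (f x))"
  unfolding canonical_mat2_def
  by (intro decidable_conj decidable_not decidable_eq decidable_canonical_quat computable_code_nth computable_intros)

section \<open>Deciding the conditions of a certificate\<close>

definition sigma_of :: "rat^4 \<Rightarrow> rat^4 \<Rightarrow> rat^4 \<Rightarrow> rat^4 \<Rightarrow> rat^4 \<Rightarrow> rat^4" where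
  "sigma_of s1 s2 s3 s4 v = v$1 *s s1 + v$2 *s s2 + v$3 *s s3 + v$4 *s s4"

lemma quatcomp_sigma_of:
  assumes "quatcomp s1" "quatcomp s2" "quatcomp s3" "quatcomp s4" "quatcomp f"
  shows "quatcomp (\<lambda>x. sigma_of (s1 x) (s2 x) (s3 x) (s4 x) (f x))"
  unfolding sigma_of_def by (intro quatcomp_add quatcomp_scale ratcomp_nth assms)

lemma ball_map: "(\<forall>v\<in>set (map f l). P v) \<longleftrightarrow> (\<forall>m\<in>set l. P (f m))"
  and bex_map: "(\<exists>v\<in>set (map f l). P v) \<longleftrightarrow> (\<exists>m\<in>set l. P (f m))"
  and mem_map: "v \<in> set (map f l) \<longleftrightarrow> (\<exists>m\<in>set l. v = f m)"
  by auto

text \<open>A bounded quantifier adds its variable by pairing, so below it every parameter is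
  evaluated at a projection. The composed instances supplied to the proofs below serve this
  purpose.\<close>

lemma ratcomp_compose: "ratcomp f \<Longrightarrow> computable g \<Longrightarrow> ratcomp (\<lambda>x. f (g x))"
  unfolding ratcomp_def using computable_compose[of _ g] by meson

lemma quatcomp_compose: "quatcomp f \<Longrightarrow> computable g \<Longrightarrow> quatcomp (\<lambda>x. f (g x))"
  unfolding quatcomp_def using ratcomp_compose by blast

lemmas quatcomp_intros = quatcomp_add quatcomp_diff quatcomp_minus quatcomp_scale quatcomp_const
  quatcomp_mult quatcomp_decode quatcomp_sigma_of

lemmas decidable_intros = decidable_conj decidable_disj decidable_imp decidable_not
  decidable_Ball_list decidable_Bex_list decidable_rat_less decidable_rat_le decidable_rat_eq
  decidable_quat_eq decidable_le

lemma sum_chain_code: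
  "sum_chain (map quat_decode (list_decode g)) (map quat_decode (list_decode c)) \<longleftrightarrow>
     (\<forall>i<length (list_decode c). quat_decode (code_hd (code_drop i c)) = 0 \<or>
       (\<exists>y\<in>set (list_decode (code_drop (Suc i) c)). \<exists>h\<in>set (list_decode g).
          quat_decode (code_hd (code_drop i c)) = quat_decode y + quat_decode h \<or>
          quat_decode (code_hd (code_drop i c)) = quat_decode y - quat_decode h))"
  unfolding sum_chain_nth by (simp add: list_decode_drop code_nth drop_map)

lemma decidable_sum_chain:
  assumes "computable g" "computable c"
  shows "decidable (\<lambda>x. sum_chain (map quat_decode (list_decode (g x))) (map quat_decode (list_decode (c x))))"
  unfolding sum_chain_code
  by (intro decidable_all_nth decidable_intros quatcomp_intros computable_intros assms
      computable_compose[OF assms(1)] computable_compose[OF assms(2)])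

lemma decidable_ball_list:
  assumes "ratcomp a" "ratcomp b" "computable g" "computable L" "ratcomp K" "computable c"
  shows "decidable (\<lambda>x. ball_list (a x) (b x) (map quat_decode (list_decode (g x))) (L x) (K x)
     (map quat_decode (list_decode (c x))))"
proof -
  have len: "length (map quat_decode (list_decode m)) \<le> n \<longleftrightarrow> code_drop n m = 0" for m n
    by (simp add: code_drop_eq_0)
  show ?thesis
    unfolding ball_list_def ball_map bex_map mem_map len
    by (intro decidable_intros decidable_sum_chain decidable_eq ratcomp_nq ratcomp_intros quatcomp_intros computable_intros assms
        ratcomp_compose[OF assms(1)] ratcomp_compose[OF assms(2)] computable_compose[OF assms(3)]
        computable_compose[OF assms(4)] ratcomp_compose[OF assms(5)] computable_compose[OF assms(6)])
qed

lemma decidable_group_list: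
  assumes "ratcomp a" "ratcomp b" "quatcomp s1" "quatcomp s2" "quatcomp s3" "quatcomp s4"
    "computable c" "quatcomp z" "computable m"
  shows "decidable (\<lambda>x. group_list (a x) (b x) (sigma_of (s1 x) (s2 x) (s3 x) (s4 x))
     (map quat_decode (list_decode (c x))) (z x) (map mat2_decode (list_decode (m x))))"
  unfolding group_list_def ball_map mem_map mat2_decode_def mat2.case mat2.inject SLq_def
  by (intro decidable_intros ratcomp_intros quatcomp_intros computable_code_nth computable_intros assms
      ratcomp_compose[OF assms(1)] ratcomp_compose[OF assms(2)] quatcomp_compose[OF assms(3)]
      quatcomp_compose[OF assms(4)] quatcomp_compose[OF assms(5)] quatcomp_compose[OF assms(6)]
      computable_compose[OF assms(7)] quatcomp_compose[OF assms(8)] computable_compose[OF assms(9)])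

lemma ratcomp_rgdist:
  assumes "ratcomp a" "ratcomp b" "quatcomp z" "computable m" "quatcomp w"
  shows "ratcomp (\<lambda>x. rgdist (a x) (b x) (z x) (mat2_decode (m x)) (w x))"
  unfolding rgdist_def mat2_decode_def mat2.case
  by (intro ratcomp_diff ratcomp_nq quatcomp_intros computable_code_nth assms)

lemma quatcomp_rbox:
  assumes "quatcomp s1" "quatcomp s2" "quatcomp s3" "quatcomp s4" "quatcomp z" "quatcomp e2" "quatcomp e3"
    "ratcomp y1" "ratcomp y2" "ratcomp y3" "ratcomp s"
  shows "quatcomp (\<lambda>x. rbox (sigma_of (s1 x) (s2 x) (s3 x) (s4 x)) (z x) (e2 x) (e3 x) (y1 x) (y2 x) (y3 x) (s x))"
  unfolding rbox_def by (intro quatcomp_intros ratcomp_const assms)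

lemma decidable_grid_list:
  assumes "ratcomp a" "ratcomp b" "quatcomp s1" "quatcomp s2" "quatcomp s3" "quatcomp s4"
    "quatcomp z" "computable m" "ratcomp K" "quatcomp e2" "quatcomp e3" "computable N"
  shows "decidable (\<lambda>x. grid_list (a x) (b x) (sigma_of (s1 x) (s2 x) (s3 x) (s4 x)) (z x)
     (map mat2_decode (list_decode (m x))) (K x) (e2 x) (e3 x) (N x))"
proof -
  have mem: "decidable (\<lambda>x. Mat2 (A x) (B x) (C x) (D x) \<in> set (map mat2_decode (list_decode (m x))))"
    if "quatcomp A" "quatcomp B" "quatcomp C" "quatcomp D" for A B C D
    unfolding mem_map mat2_decode_def mat2.inject
    by (intro decidable_intros quatcomp_intros computable_code_nth computable_intros assms(8)
        that[THEN quatcomp_compose])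
  note c = ratcomp_compose[OF assms(1)] ratcomp_compose[OF assms(2)] quatcomp_compose[OF assms(3)]
      quatcomp_compose[OF assms(4)] quatcomp_compose[OF assms(5)] quatcomp_compose[OF assms(6)]
      quatcomp_compose[OF assms(7)] computable_compose[OF assms(8)] ratcomp_compose[OF assms(9)]
      quatcomp_compose[OF assms(10)] quatcomp_compose[OF assms(11)] computable_compose[OF assms(12)]
  have grid: "decidable (\<lambda>x. \<forall>m1<N x. \<forall>m2<N x. \<forall>m3<N x. \<exists>M\<in>set (map mat2_decode (list_decode (m x))).
      \<forall>i1<2. \<forall>i2<2. \<forall>i3<2. \<forall>h<2.
        rgdist (a x) (b x) (z x) M (rbox (sigma_of (s1 x) (s2 x) (s3 x) (s4 x)) (z x) (e2 x) (e3 x)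
          (of_nat (m1 + i1) / of_nat (N x) - 1/2) (of_nat (m2 + i2) / of_nat (N x) - 1/2)
          (of_nat (m3 + i3) / of_nat (N x) - 1/2) (of_nat h / of_nat (N x))) < 0)"
    unfolding bex_map
    by (intro decidable_all_less decidable_Bex_list decidable_rat_less ratcomp_rgdist quatcomp_rbox
        ratcomp_diff ratcomp_divide_of_nat ratcomp_of_nat ratcomp_const computable_intros assms c)
  show ?thesis
    unfolding grid_list_def entry_bound_def
    by (intro decidable_conj mem grid decidable_not decidable_quat_eq decidable_rat_eq decidable_rat_le decidable_le
        ratcomp_add ratcomp_mult ratcomp_power ratcomp_divide_const ratcomp_of_nat ratcomp_nq ratcomp_const
        quatcomp_add quatcomp_diff quatcomp_minus quatcomp_const quatcomp_sigma_of computable_const assms)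
qed

text \<open>The program is chosen before the input. It searches for the code of a whole certificate,
  stored as a list whose first entry is the output, and demands canonical codes there.\<close>

lemma ex_certificate_search:
  "\<exists>F. \<forall>a b \<sigma> gs u.
     (\<forall>x. \<sigma> x = sigma_of (\<sigma> (vector [1,0,0,0])) (\<sigma> (vector [0,1,0,0])) (\<sigma> (vector [0,0,1,0])) (\<sigma> (vector [0,0,0,1])) x) \<longrightarrow>
     (\<exists>z Ms os K L r e2 e3 N. dirichlet_certificate a b \<sigma> gs u z Ms os K L r e2 e3 N) \<longrightarrow>
     (\<exists>z Ms os K L r e2 e3 N. dirichlet_certificate a b \<sigma> gs u z Ms os K L r e2 e3 N \<and>
        rec_eval F [input_code a b \<sigma> gs u] (output_code z Ms))"
proof -
  define A where "A x = rat_decode (code_nth 0 x)" for x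
  define B where "B x = rat_decode (code_nth 1 x)" for x
  define S where "S i x = quat_decode (code_nth i (code_nth 2 x))" for i x
  define g where "g x = code_nth 3 x" for x
  define U where "U x = quat_decode (code_nth 4 x)" for x
  define T where "T x y \<longleftrightarrow> canonical_quat (pfst (code_nth 0 y)) \<and>
     (\<forall>m\<in>set (list_decode (psnd (code_nth 0 y))). canonical_mat2 m) \<and>
     dirichlet_certificate (A x) (B x) (sigma_of (S 0 x) (S 1 x) (S 2 x) (S 3 x)) (map quat_decode (list_decode (g x))) (U x)
       (quat_decode (pfst (code_nth 0 y))) (map mat2_decode (list_decode (psnd (code_nth 0 y))))
       (map quat_decode (list_decode (code_nth 1 y))) (rat_decode (code_nth 2 y)) (code_nth 3 y)
       (rat_decode (code_nth 4 y)) (quat_decode (code_nth 5 y)) (quat_decode (code_nth 6 y)) (code_nth 7 y)"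
    for x y
  have "decidable (\<lambda>e. T (pfst e) (psnd e))"
    unfolding T_def dirichlet_certificate_def A_def B_def S_def g_def U_def
    by (intro decidable_conj decidable_canonical_quat decidable_Ball_list decidable_canonical_mat2
        decidable_rat_less decidable_rat_le decidable_quat_eq decidable_ball_list decidable_group_list decidable_grid_list
        ratcomp_nq ratcomp_decode ratcomp_const quatcomp_diff quatcomp_scale quatcomp_sigma_of quatcomp_decode
        computable_code_nth computable_intros)
  from decidable_search[OF this computable_code_nth[OF computable_id, of 0]]
  obtain F where F: "\<And>x y. T x y \<Longrightarrow> \<exists>y. T x y \<and> rec_eval F [x] (code_nth 0 y)" by blast
  show ?thesis
  proof (intro exI[of _ F] allI impI)
    fix a b :: rat and \<sigma> :: "rat^4 \<Rightarrow> rat^4" and gs :: "(rat^4) list" and u :: "rat^4"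
    assume \<sigma>: "\<forall>x. \<sigma> x = sigma_of (\<sigma> (vector [1,0,0,0])) (\<sigma> (vector [0,1,0,0])) (\<sigma> (vector [0,0,1,0])) (\<sigma> (vector [0,0,0,1])) x"
      and "\<exists>z Ms os K L r e2 e3 N. dirichlet_certificate a b \<sigma> gs u z Ms os K L r e2 e3 N"
    then obtain z Ms os K L r e2 e3 N where cert: "dirichlet_certificate a b \<sigma> gs u z Ms os K L r e2 e3 N"
      by (elim exE)
    define x where "x = input_code a b \<sigma> gs u"
    have x: "A x = a" "B x = b" "map quat_decode (list_decode (g x)) = gs" "U x = u"
      "S 0 x = \<sigma> (vector [1,0,0,0])" "S 1 x = \<sigma> (vector [0,1,0,0])" "S 2 x = \<sigma> (vector [0,0,1,0])" "S 3 x = \<sigma> (vector [0,0,0,1])"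
      by (simp_all add: x_def input_code_def A_def B_def g_def U_def S_def code_nth_list_encode comp_def)
    have sx: "sigma_of (S 0 x) (S 1 x) (S 2 x) (S 3 x) = \<sigma>"
      unfolding x using \<sigma> by (intro ext) (rule sym, blast)
    have T: "T x y \<longleftrightarrow> canonical_quat (pfst (code_nth 0 y)) \<and>
       (\<forall>m\<in>set (list_decode (psnd (code_nth 0 y))). canonical_mat2 m) \<and>
       dirichlet_certificate a b \<sigma> gs u
       (quat_decode (pfst (code_nth 0 y))) (map mat2_decode (list_decode (psnd (code_nth 0 y))))
       (map quat_decode (list_decode (code_nth 1 y))) (rat_decode (code_nth 2 y)) (code_nth 3 y)
       (rat_decode (code_nth 4 y)) (quat_decode (code_nth 5 y)) (quat_decode (code_nth 6 y)) (code_nth 7 y)" for y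
      unfolding T_def sx by (simp only: x)
    have "T x (list_encode [output_code z Ms, list_encode (map quat_code os), rat_code K, L, rat_code r,
        quat_code e2, quat_code e3, N])"
      unfolding T using cert
      by (simp add: code_nth_list_encode output_code_def canonical_quat_quat_code canonical_mat2_mat2_code comp_def)
    from F[OF this] obtain y where y: "T x y" "rec_eval F [x] (code_nth 0 y)" by blast
    let ?o = "code_nth 0 y"
    have can: "canonical_quat (pfst ?o)" "\<forall>m\<in>set (list_decode (psnd ?o)). canonical_mat2 m"
      using y(1) unfolding T by blast+
    have "map mat2_code (map mat2_decode (list_decode (psnd ?o))) = list_decode (psnd ?o)"
      using can(2) by (simp add: canonical_mat2_code map_idI)
    then have "output_code (quat_decode (pfst ?o)) (map mat2_decode (list_decode (psnd ?o))) = ?o"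
      using canonical_quat_code[OF can(1)] by (simp add: output_code_def del: map_map)
    then have "rec_eval F [x] (output_code (quat_decode (pfst ?o)) (map mat2_decode (list_decode (psnd ?o))))"
      using y(2) by simp
    moreover have "dirichlet_certificate a b \<sigma> gs u
       (quat_decode (pfst ?o)) (map mat2_decode (list_decode (psnd ?o)))
       (map quat_decode (list_decode (code_nth 1 y))) (rat_decode (code_nth 2 y)) (code_nth 3 y)
       (rat_decode (code_nth 4 y)) (quat_decode (code_nth 5 y)) (quat_decode (code_nth 6 y)) (code_nth 7 y)"
      using y(1) unfolding T by blast
    ultimately show "\<exists>z Ms os K L r e2 e3 N. dirichlet_certificate a b \<sigma> gs u z Ms os K L r e2 e3 N \<and>
        rec_eval F [input_code a b \<sigma> gs u] (output_code z Ms)"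
      unfolding x_def[symmetric] by blast
  qed
qed

theorem theorem1p3:
  shows "\<exists>F :: recf. \<forall>(a::rat) (b::rat) (\<sigma> :: rat^4 \<Rightarrow> rat^4) (\<O> :: (rat^4) set) (\<iota> :: rat^4 \<Rightarrow> real^4).
     a \<noteq> 0 \<and> b \<noteq> 0 \<and> definite a b \<and> orthogonal_involution a b \<sigma> \<and>
     quat_order a b \<O> \<and> sigma_euclidean ((quat_alg a b)\<lparr>carrier := \<O>\<rparr>) \<sigma> \<and>
     involution_embedding a b \<sigma> \<iota>
     \<longrightarrow>
     (\<forall>gs u. generate (add_monoid (quat_alg a b)) (set gs) = \<O> \<and> \<iota> u \<in> H4 \<longrightarrow>
        (\<exists>z Ms. rec_eval F [input_code a b \<sigma> gs u] (output_code z Ms) \<and>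
                describes_dirichlet_domain a b \<sigma> \<O> \<iota> z Ms)) \<and>
     card (cusps (map_mat2 \<iota> ` SL_sigma ((quat_alg a b)\<lparr>carrier := \<O>\<rparr>) \<sigma>)) = 1"
proof -
  obtain F where F: "\<forall>a b \<sigma> gs u.
     (\<forall>x. \<sigma> x = sigma_of (\<sigma> (vector [1,0,0,0])) (\<sigma> (vector [0,1,0,0])) (\<sigma> (vector [0,0,1,0])) (\<sigma> (vector [0,0,0,1])) x) \<longrightarrow>
     (\<exists>z Ms os K L r e2 e3 N. dirichlet_certificate a b \<sigma> gs u z Ms os K L r e2 e3 N) \<longrightarrow>
     (\<exists>z Ms os K L r e2 e3 N. dirichlet_certificate a b \<sigma> gs u z Ms os K L r e2 e3 N \<and>
        rec_eval F [input_code a b \<sigma> gs u] (output_code z Ms))"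
    using ex_certificate_search by (elim exE)
  show ?thesis
  proof (intro exI[of _ F] allI impI)
    fix a b :: rat and \<sigma> :: "rat^4 \<Rightarrow> rat^4" and \<O> :: "(rat^4) set" and \<iota> :: "rat^4 \<Rightarrow> real^4"
    assume *: "a \<noteq> 0 \<and> b \<noteq> 0 \<and> definite a b \<and> orthogonal_involution a b \<sigma> \<and>
     quat_order a b \<O> \<and> sigma_euclidean ((quat_alg a b)\<lparr>carrier := \<O>\<rparr>) \<sigma> \<and>
     involution_embedding a b \<sigma> \<iota>"
    interpret embedded_order a b \<sigma> \<O> \<iota> by unfold_locales (use * in blast)+
    have "\<sigma> x = sigma_of (\<sigma> (vector [1,0,0,0])) (\<sigma> (vector [0,1,0,0])) (\<sigma> (vector [0,0,1,0])) (\<sigma> (vector [0,0,0,1])) x" for x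
      by (subst rat4_decomp) (simp only: sigma_of_def sigma_add sigma_scale)
    note search = F[THEN spec, THEN spec, THEN spec, THEN spec, THEN spec, THEN mp, THEN mp, OF allI[OF this]]
    have "\<exists>z Ms. rec_eval F [input_code a b \<sigma> gs u] (output_code z Ms) \<and> describes_dirichlet_domain a b \<sigma> \<O> \<iota> z Ms"
      if "generate (add_monoid (quat_alg a b)) (set gs) = \<O>" "\<iota> u \<in> H4" for gs u
      \<comment> \<open>Completeness makes the search halt; soundness applies to whichever
        certificate it finds.\<close>
      using search[OF certificate_complete[OF that]] certificate_sound[OF that] by blast
    then show "(\<forall>gs u. generate (add_monoid (quat_alg a b)) (set gs) = \<O> \<and> \<iota> u \<in> H4 \<longrightarrow>
        (\<exists>z Ms. rec_eval F [input_code a b \<sigma> gs u] (output_code z Ms) \<and>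
                describes_dirichlet_domain a b \<sigma> \<O> \<iota> z Ms)) \<and>
     card (cusps (map_mat2 \<iota> ` SL_sigma ((quat_alg a b)\<lparr>carrier := \<O>\<rparr>) \<sigma>)) = 1"
      using card_cusps_order by blast
  qed
qed

end
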